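(* For every real $K\ge 1$ and every $z\in\mathbb{C}$ there exists a constant $C_{K,z}>0$, depending only on $K$ and $z$, such that the following holds. Let $n\ge 1$ and let $\mathbf{x}=(\mathbf{x}_{ij})_{1\le i,j\le n}$ be a deterministic real $n\times n$ matrix with $\sum_{i,j=1}^n \mathbf{x}_{ij}=0$, $\sum_{i,j=1}^n \mathbf{x}_{ij}^2=n^2$ and $\max_{1\le i,j\le n}|\mathbf{x}_{ij}|=K$. Let $\pi$ be a uniform random permutation of $[n]\times[n]$ and let $X=(X_{ij})_{1\le i,j\le n}$ be the random matrix $X_{ij}=\mathbf{x}_{\pi(i,j)}$. Then for every $\varepsilon>0$, $$\mathbb{P}\Big(s_n(X-z\sqrt{n}\,\mathrm{Id})\le \varepsilon n^{-1/2}\Big)\le C_{K,z}\Big(\varepsilon+\frac{1}{n^{1/2}}\Big).$$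
   Context: $[n]=\{1,\dots,n\}$. For an $n\times n$ complex matrix $A$, $s_1(A)\ge\dots\ge s_n(A)$ are the singular values of $A$, i.e. the eigenvalues of $\sqrt{AA^*}$ where $A^*$ is the conjugate transpose; $s_n(A)$ is the smallest one. $\mathrm{Id}$ is the $n\times n$ identity matrix. The conditions on $\mathbf{x}$ force $K\ge1$ (and cannot be met for $n=1$, so the statement concerns $n\ge2$). *)

theory Defs
  imports
    "HOL-Probability.Probability"
    "HOL-Combinatorics.Permutations"
    "Jordan_Normal_Form.Matrix"
    "Jordan_Normal_Form.Char_Poly"
    "Jordan_Normal_Form.Schur_Decomposition"
begin

definition psd_mat :: "complex mat \<Rightarrow> bool" where
  "psd_mat B \<longleftrightarrow>
     square_mat B \<and> mat_adjoint B = B \<and>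
     (\<forall>v \<in> carrier_vec (dim_row B). 0 \<le> Re ((B *\<^sub>v v) \<bullet>c v))"

text \<open>Every positive semidefinite matrix has exactly one positive semidefinite square root;
  outside that case the value is unspecified.\<close>

definition psd_sqrt :: "complex mat \<Rightarrow> complex mat" where
  "psd_sqrt M = (THE B. psd_mat B \<and> B * B = M)"

text \<open>The eigenvalues of a square matrix, counted with algebraic multiplicity.\<close>

definition eigenvalue_mset :: "complex mat \<Rightarrow> complex multiset" where
  "eigenvalue_mset A = proots (char_poly A)"

text \<open>The list \<open>s\<^sub>1(A) \<ge> \<dots> \<ge> s\<^sub>n(A)\<close>. The eigenvalues of a positive semidefinite matrix are
  real, so \<open>Re\<close> only changes their type.\<close>

definition singular_values :: "complex mat \<Rightarrow> real list" where
  "singular_values A =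
     rev (sorted_list_of_multiset
       (image_mset Re (eigenvalue_mset (psd_sqrt (A * mat_adjoint A)))))"

text \<open>\<open>singular_value k A\<close> is \<open>s\<^sub>k(A)\<close> with the usual numbering, starting at \<open>k = 1\<close>.\<close>

definition singular_value :: "nat \<Rightarrow> complex mat \<Rightarrow> real" where
  "singular_value k A = singular_values A ! (k - 1)"

text \<open>Matrix entries are indexed from \<open>0\<close>, so \<open>[n] \<times> [n]\<close> becomes \<open>{0..<n} \<times> {0..<n}\<close>.\<close>

definition mat_positions :: "nat \<Rightarrow> (nat \<times> nat) set" where
  "mat_positions n = {0..<n} \<times> {0..<n}"

definition uniform_perm :: "nat \<Rightarrow> (nat \<times> nat \<Rightarrow> nat \<times> nat) pmf" where
  "uniform_perm n = pmf_of_set {\<pi>. \<pi> permutes mat_positions n}"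

definition permuted_mat :: "nat \<Rightarrow> 'a mat \<Rightarrow> (nat \<times> nat \<Rightarrow> nat \<times> nat) \<Rightarrow> 'a mat" where
  "permuted_mat n x \<pi> = mat n n (\<lambda>(i, j). x $$ \<pi> (i, j))"

end

theory Submission
  imports Defs
begin

text \<open>
  Geometric approach of Rudelson and Vershynin, with independence replaced by invariance: the law
  of \<open>\<pi>\<close> does not change under composition with a (random) permutation of the positions,
  so one may condition on \<open>\<pi>\<close> and average over random swaps.

  If \<open>s\<^sub>n\<close> is small, some unit vector \<open>w\<close> is almost annihilated from the left. Vectors within a
  small distance of a constant plus a sparse vector are excluded with probability \<open>1 - O(n powr (-1/2))\<close>
  by a union bound over a grid: the operator norm is \<open>O(sqrt n)\<close> (negative association gives
  sub-Gaussian tails), and for a single vector swaps between paired rows turn each row product into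
  a Rademacher sum. Otherwise a positive proportion of coordinates of \<open>w\<close> has modulus at least
  \<open>\<kappa> / sqrt n\<close>, so averaging over rows reduces the claim to one row \<open>i\<close>: its product with a unit
  normal \<open>u\<close> of the other rows is small. As \<open>u\<close> is not almost constant, there are of order \<open>n\<close>
  disjoint pairs of coordinates on which \<open>u\<close> differs by at least \<open>\<kappa> / sqrt n\<close>; swapping
  entries of row \<open>i\<close> along these pairs gives a signed sum to which the Littlewood-Offord
  inequality applies, with bound \<open>O(\<epsilon> + n powr (-1/2))\<close>.
\<close>

section \<open>Averages over permutations\<close>

text \<open>Probabilities are plain finite averages, so conditioning becomes a pointwise statement:
  fix \<pi>, precompose it with a finite family of permutations and average over that family alone.
  Nondegeneracy of the entries enters through \<open>spread\<close>: centring, second moment one and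
  the bound K force a proportion \<beta> of the entries to be at least \<alpha> and a proportion
  \<beta> to be at most -\<alpha>, with \<alpha> and \<beta> determined by K. Two random positions
  then carry entries 2 * \<alpha> apart with probability bounded below, which stands in for a
  nondegenerate independent entry. The union bound dictates the order of the constants. K fixes the
  exponential rate for a single vector; \<kappa> is then taken so small that the operator norm and z
  can absorb the distance to the grid; only afterwards is \<delta> chosen, so small that the grid
  for vectors with at most \<delta> * n exceptional coordinates grows more slowly than the
  single-vector probability decays. Left vectors are treated like right ones because X and its
  transpose have the same law. Small n and large \<epsilon> are absorbed into the final
  constant.\<close>

definition avg :: "'a set \<Rightarrow> ('a \<Rightarrow> real) \<Rightarrow> real" where
  "avg S f = (\<Sum>s\<in>S. f s) / real (card S)"

lemma avg_mono: "(\<And>s. s \<in> S \<Longrightarrow> f s \<le> g s) \<Longrightarrow> avg S f \<le> avg S g"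
  unfolding avg_def by (intro divide_right_mono sum_mono) auto

lemma avg_cong: "(\<And>s. s \<in> S \<Longrightarrow> f s = g s) \<Longrightarrow> avg S f = avg S g"
  unfolding avg_def by simp

lemma avg_nonneg: "(\<And>s. s \<in> S \<Longrightarrow> 0 \<le> f s) \<Longrightarrow> 0 \<le> avg S f"
  unfolding avg_def by (intro divide_nonneg_nonneg sum_nonneg) auto

lemma avg_add: "avg S (\<lambda>s. f s + g s) = avg S f + avg S g"
  unfolding avg_def by (simp add: sum.distrib add_divide_distrib)

lemma avg_cmult: "avg S (\<lambda>s. c * f s) = c * avg S f"
  unfolding avg_def by (simp add: sum_distrib_left)

lemma avg_const: "finite S \<Longrightarrow> S \<noteq> {} \<Longrightarrow> avg S (\<lambda>s. c) = c"
  unfolding avg_def by simp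

lemma avg_sum: "avg S (\<lambda>s. \<Sum>i\<in>I. f i s) = (\<Sum>i\<in>I. avg S (f i))"
  unfolding avg_def by (subst sum.swap) (simp add: sum_divide_distrib)

lemma avg_swap: "avg S (\<lambda>s. avg T (f s)) = avg T (\<lambda>t. avg S (\<lambda>s. f s t))"
  unfolding avg_def by (simp add: sum_divide_distrib[symmetric] divide_divide_eq_left mult.commute)
    (subst sum.swap, simp)

lemma avg_le_const:
  assumes "finite S" "S \<noteq> {}" "\<And>s. s \<in> S \<Longrightarrow> f s \<le> c"
  shows "avg S f \<le> c"
  using avg_mono[of S f "\<lambda>_. c"] assms avg_const by metis

lemma avg_reindex:
  assumes "bij_betw h S T"
  shows "avg T f = avg S (\<lambda>s. f (h s))"
  unfolding avg_def using sum.reindex_bij_betw[OF assms, of f] bij_betw_same_card[OF assms] by simp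

lemma avg_union_bound:
  assumes "finite I" "\<And>s. s \<in> S \<Longrightarrow> Q s \<Longrightarrow> \<exists>i\<in>I. R i s" 
  shows "avg S (\<lambda>s. of_bool (Q s)) \<le> (\<Sum>i\<in>I. avg S (\<lambda>s. of_bool (R i s)))"
  unfolding avg_sum[symmetric]
proof (rule avg_mono)
  fix s assume s: "s \<in> S"
  show "of_bool (Q s) \<le> (\<Sum>i\<in>I. of_bool (R i s) :: real)"
  proof (cases "Q s")
    case True
    then obtain i where i: "i \<in> I" "R i s" using assms(2) s by auto
    have "of_bool (R i s) \<le> (\<Sum>i\<in>I. of_bool (R i s) :: real)"
      using assms(1) i by (intro member_le_sum) auto
    then show ?thesis using i by simp
  qed (simp add: sum_nonneg)
qed

lemma avg_exp_markov:
  assumes "\<theta> \<ge> 0"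
  shows "avg S (\<lambda>s. of_bool (f s \<ge> t)) \<le> exp (- \<theta> * t) * avg S (\<lambda>s. exp (\<theta> * f s))"
  unfolding avg_cmult[symmetric]
proof (rule avg_mono)
  fix s
  have "t \<le> f s \<Longrightarrow> 1 \<le> exp (\<theta> * f s - \<theta> * t)"
    using assms by (simp add: mult_left_mono)
  then show "of_bool (t \<le> f s) \<le> exp (- \<theta> * t) * exp (\<theta> * f s)"
    by (simp add: exp_add[symmetric] algebra_simps)
qed

section \<open>Uniform random permutations and exchange of positions\<close>

abbreviation perms :: "'a set \<Rightarrow> ('a \<Rightarrow> 'a) set" where
  "perms P \<equiv> {\<pi>. \<pi> permutes P}"

lemma finite_perms [simp]: "finite P \<Longrightarrow> finite (perms P)"
  by (rule finite_permutations)

lemma perms_nonempty [simp]: "perms P \<noteq> {}"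
  using permutes_id[of P] by blast

lemma avg_perms_const: "finite P \<Longrightarrow> avg (perms P) (\<lambda>\<pi>. c) = c"
  by (rule avg_const) (simp_all only: finite_perms perms_nonempty, simp_all)

lemma avg_perms_compose_right:
  assumes "\<tau> permutes P"
  shows "avg (perms P) (\<lambda>\<pi>. f (\<pi> \<circ> \<tau>)) = avg (perms P) f"
  unfolding avg_def by (simp add: sum_permutations_compose_right[OF assms, of f])

text \<open>The substitute for independence. Each member of the family preserves the uniform law, so
  any finite family may be averaged over, group or not; inside the outer average \<pi> is fixed and
  only t is random.\<close>

lemma avg_perms_exchange:
  fixes f :: "('a \<Rightarrow> 'a) \<Rightarrow> real" and \<tau> :: "'t \<Rightarrow> 'a \<Rightarrow> 'a"
  assumes "finite T" "T \<noteq> {}" "\<And>t. t \<in> T \<Longrightarrow> \<tau> t permutes P"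
  shows "avg (perms P) f = avg (perms P) (\<lambda>\<pi>. avg T (\<lambda>t. f (\<pi> \<circ> \<tau> t)))"
proof -
  have "avg (perms P) (\<lambda>\<pi>. avg T (\<lambda>t. f (\<pi> \<circ> \<tau> t))) = avg T (\<lambda>t. avg (perms P) (\<lambda>\<pi>. f (\<pi> \<circ> \<tau> t)))"
    by (rule avg_swap)
  also have "\<dots> = avg T (\<lambda>t. avg (perms P) f)"
    by (intro avg_cong avg_perms_compose_right assms)
  finally show ?thesis using assms by (simp add: avg_const)
qed

lemma avg_perms_exchange_le:
  fixes f :: "('a \<Rightarrow> 'a) \<Rightarrow> real" and \<tau> :: "'t \<Rightarrow> 'a \<Rightarrow> 'a"
  assumes "finite T" "T \<noteq> {}" "\<And>t. t \<in> T \<Longrightarrow> \<tau> t permutes P"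
    and "\<And>\<pi>. \<pi> permutes P \<Longrightarrow> avg T (\<lambda>t. f (\<pi> \<circ> \<tau> t)) \<le> g \<pi>"
  shows "avg (perms P) f \<le> avg (perms P) g"
  by (subst avg_perms_exchange[OF assms(1-3), where f = f]) (auto intro: avg_mono assms(4))

section \<open>Exponential moments of linear statistics\<close>

text \<open>Chebyshev's sum inequality: the double sum of \<open>(f q - f q') * (g q - g q')\<close>
  is nonpositive, and expanding it gives twice the difference of the two sides.\<close>

lemma Chebyshev_sum_antitone:
  fixes f g :: "'a \<Rightarrow> real"
  assumes "\<And>q q'. q \<in> P \<Longrightarrow> q' \<in> P \<Longrightarrow> (f q - f q') * (g q - g q') \<le> 0"
  shows "real (card P) * (\<Sum>q\<in>P. f q * g q) \<le> (\<Sum>q\<in>P. f q) * (\<Sum>q\<in>P. g q)"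
proof -
  have "(\<Sum>q\<in>P. \<Sum>q'\<in>P. (f q - f q') * (g q - g q')) \<le> 0"
    by (intro sum_nonpos assms)
  also have "(\<Sum>q\<in>P. \<Sum>q'\<in>P. (f q - f q') * (g q - g q'))
     = (\<Sum>q\<in>P. \<Sum>q'\<in>P. f q * g q + f q' * g q' - f q * g q' - g q * f q')"
    by (intro sum.cong refl) (simp add: algebra_simps)
  also have "\<dots> = 2 * (real (card P) * (\<Sum>q\<in>P. f q * g q)) - 2 * ((\<Sum>q\<in>P. f q) * (\<Sum>q\<in>P. g q))"
    by (simp add: sum.distrib sum_subtractf sum_distrib_left[symmetric] sum_distrib_right[symmetric])
  finally show ?thesis by simp
qed

text \<open>A special case of the negative association of random permutations: fixing one value
  to be larger makes the remaining values smaller.\<close>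

lemma perms_prod_comonotone_le:
  fixes f :: "'a \<Rightarrow> 'a \<Rightarrow> real" and x :: "'a \<Rightarrow> real"
  assumes P: "finite P" "P \<noteq> {}" and Q: "Q \<subseteq> P"
    and pos: "\<And>p q. p \<in> P \<Longrightarrow> q \<in> P \<Longrightarrow> 0 \<le> f p q"
    and mono: "\<And>p q q'. p \<in> P \<Longrightarrow> q \<in> P \<Longrightarrow> q' \<in> P \<Longrightarrow> x q \<le> x q' \<Longrightarrow> f p q \<le> f p q'"
  shows "avg (perms P) (\<lambda>\<pi>. \<Prod>p\<in>Q. f p (\<pi> p)) \<le> (\<Prod>p\<in>Q. avg P (f p))"
proof -
  have "finite Q" using P Q finite_subset by blast
  then show ?thesis using Q
  proof (induction Q rule: finite_induct)
    case empty
    then show ?case using P by (simp add: avg_perms_const)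
  next
    case (insert p0 Q)
    define G where "G = (\<lambda>\<pi>. \<Prod>p\<in>Q. f p (\<pi> p))"
    define g where "g = (\<lambda>q. \<Sum>\<pi> | \<pi> permutes P \<and> \<pi> p0 = q. G \<pi>)"
    have p0: "p0 \<in> P" "p0 \<notin> Q" "Q \<subseteq> P" using insert by auto
    have fin: "finite {\<pi>. \<pi> permutes P \<and> \<pi> p0 = q}" for q
      using finite_perms[OF P(1)] by (rule rev_finite_subset) auto
    have anti: "g q' \<le> g q" if q: "q \<in> P" "q' \<in> P" "x q \<le> x q'" for q q'
    proof -
      \<comment> \<open>Exchanging the values q and q' identifies the fibres
        \<open>\<pi> p0 = q\<close> and \<open>\<pi> p0 = q'\<close>. On the fibre over q, the
        factors away from p0 never see q; the only value affected is q', which drops to q and can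
        only decrease its factor.\<close>
      define s where "s = Transposition.transpose q q'"
      have s: "s permutes P" unfolding s_def using q by (intro permutes_swap_id)
      have "g q' = (\<Sum>\<pi> | \<pi> permutes P \<and> \<pi> p0 = q. G (s \<circ> \<pi>))"
        unfolding g_def
      proof (rule sum.reindex_bij_witness[of _ "\<lambda>\<pi>. s \<circ> \<pi>" "\<lambda>\<pi>. s \<circ> \<pi>"])
        fix \<pi> assume "\<pi> \<in> {\<pi>. \<pi> permutes P \<and> \<pi> p0 = q'}"
        then show "s \<circ> \<pi> \<in> {\<pi>. \<pi> permutes P \<and> \<pi> p0 = q}" using s by (auto intro: permutes_compose simp: s_def)
      next
        fix \<pi> assume "\<pi> \<in> {\<pi>. \<pi> permutes P \<and> \<pi> p0 = q}"
        then show "s \<circ> \<pi> \<in> {\<pi>. \<pi> permutes P \<and> \<pi> p0 = q'}" using s by (auto intro: permutes_compose simp: s_def)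
      qed (auto simp: s_def o_def)
      also have "\<dots> \<le> g q"
        unfolding g_def
      proof (rule sum_mono)
        fix \<pi> assume "\<pi> \<in> {\<pi>. \<pi> permutes P \<and> \<pi> p0 = q}"
        then have pi: "\<pi> permutes P" "\<pi> p0 = q" by auto
        show "G (s \<circ> \<pi>) \<le> G \<pi>"
          unfolding G_def
        proof (rule prod_mono, intro conjI)
          fix p assume p: "p \<in> Q"
          then have pP: "p \<in> P" using p0 by auto
          have "\<pi> p \<in> P" using pP pi by (simp add: permutes_in_image)
          moreover have "(s \<circ> \<pi>) p \<in> P" using permutes_in_image[OF permutes_compose[OF pi(1) s]] pP by blast
          ultimately show "0 \<le> f p ((s \<circ> \<pi>) p)" using pos pP by auto
          have "\<pi> p \<noteq> q" using pi p p0 by (metis permutes_inj injD)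
          then show "f p ((s \<circ> \<pi>) p) \<le> f p (\<pi> p)"
            using mono[OF pP q] by (auto simp: s_def Transposition.transpose_def)
        qed
      qed
      finally show ?thesis .
    qed
    have dec: "(\<Sum>\<pi>\<in>perms P. F \<pi>) = (\<Sum>q\<in>P. \<Sum>\<pi> | \<pi> permutes P \<and> \<pi> p0 = q. F \<pi>)" for F :: "_ \<Rightarrow> real"
      using sum.group[of "perms P" P "\<lambda>\<pi>. \<pi> p0" F] P p0 by (simp add: image_subset_iff permutes_in_image)
    have eq1: "(\<Sum>\<pi>\<in>perms P. f p0 (\<pi> p0) * G \<pi>) = (\<Sum>q\<in>P. f p0 q * g q)"
      unfolding dec g_def sum_distrib_left by (intro sum.cong) auto
    have eq2: "(\<Sum>\<pi>\<in>perms P. G \<pi>) = (\<Sum>q\<in>P. g q)"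
      unfolding dec g_def by simp
    have "real (card P) * (\<Sum>q\<in>P. f p0 q * g q) \<le> (\<Sum>q\<in>P. f p0 q) * (\<Sum>q\<in>P. g q)"
    proof (rule Chebyshev_sum_antitone)
      fix q q' assume "q \<in> P" "q' \<in> P"
      then show "(f p0 q - f p0 q') * (g q - g q') \<le> 0"
        using mono[OF p0(1), of q q'] mono[OF p0(1), of q' q] anti[of q q'] anti[of q' q]
        by (cases "x q \<le> x q'") (auto intro: mult_nonpos_nonneg mult_nonneg_nonpos)
    qed
    moreover have "real (card P) > 0" using P by (simp add: card_gt_0_iff)
    ultimately have "(\<Sum>q\<in>P. f p0 q * g q) \<le> avg P (f p0) * (\<Sum>q\<in>P. g q)"
      by (simp add: avg_def field_simps)
    then have "avg (perms P) (\<lambda>\<pi>. f p0 (\<pi> p0) * G \<pi>) \<le> avg P (f p0) * avg (perms P) G"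
      unfolding avg_def[of "perms P"] eq1 eq2 times_divide_eq_right by (rule divide_right_mono) simp
    also have "\<dots> \<le> avg P (f p0) * (\<Prod>p\<in>Q. avg P (f p))"
      using insert p0 pos unfolding G_def by (intro mult_left_mono avg_nonneg) auto
    finally show ?case using insert by (simp add: G_def)
  qed
qed

text \<open>The linear term is kept exact so that it vanishes when a centred variable is averaged,
  which leaves a sub-Gaussian bound. For y \<le> 1 the right side dominates
  \<open>1 + y + y\<^sup>2\<close>; for y > 1 already \<open>exp (y\<^sup>2)\<close>
  dominates.\<close>

lemma exp_le_add_exp_square: "exp y \<le> y + exp (y\<^sup>2)" for y :: real
proof -
  have "exp y \<le> 1 + y + y\<^sup>2" if "y \<le> 1"
  proof (cases "y \<ge> 0")
    case True then show ?thesis using exp_bound[of y] that by simp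
  next
    case False
    define f where "f = (\<lambda>y::real. 1 + y + y\<^sup>2 - exp y)"
    have "f 0 \<le> f y"
    proof (rule DERIV_nonpos_imp_nonincreasing[of y 0])
      fix t :: real assume t: "y \<le> t" "t \<le> 0"
      have "(f has_real_derivative (1 + 2 * t - exp t)) (at t)"
        unfolding f_def by (auto intro!: derivative_eq_intros)
      moreover have "1 + 2 * t - exp t \<le> 0" using exp_ge_add_one_self[of t] t by linarith
      ultimately show "\<exists>y. (f has_real_derivative y) (at t) \<and> y \<le> 0" by blast
    qed (use False in auto)
    then show ?thesis by (simp add: f_def)
  qed
  moreover have "1 + y\<^sup>2 \<le> exp (y\<^sup>2)" by simp
  moreover have "exp y \<le> exp (y\<^sup>2)" if "y > 1"
    using that by (simp add: power2_eq_square)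
  ultimately show ?thesis by (smt (verit))
qed

text \<open>Nonnegative coefficients make every factor \<open>exp (b p * x q)\<close> increase with
  \<open>x q\<close>, as \<open>perms_prod_comonotone_le\<close> demands; the sum then behaves at
  worst like one of independent centred variables.\<close>

lemma perms_exp_linear_le_nonneg:
  fixes x b :: "'a \<Rightarrow> real"
  assumes P: "finite P" "P \<noteq> {}" and x: "(\<Sum>p\<in>P. x p) = 0" "\<And>p. p \<in> P \<Longrightarrow> \<bar>x p\<bar> \<le> K"
    and b: "\<And>p. p \<in> P \<Longrightarrow> 0 \<le> b p"
  shows "avg (perms P) (\<lambda>\<pi>. exp (\<Sum>p\<in>P. b p * x (\<pi> p))) \<le> exp (K\<^sup>2 * (\<Sum>p\<in>P. (b p)\<^sup>2))"
proof -
  have "avg (perms P) (\<lambda>\<pi>. exp (\<Sum>p\<in>P. b p * x (\<pi> p))) = avg (perms P) (\<lambda>\<pi>. \<Prod>p\<in>P. exp (b p * x (\<pi> p)))"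
    using P by (simp add: exp_sum)
  also have "\<dots> \<le> (\<Prod>p\<in>P. avg P (\<lambda>q. exp (b p * x q)))"
    using P b by (intro perms_prod_comonotone_le[where x = x]) (auto intro: mult_left_mono)
  also have "\<dots> \<le> (\<Prod>p\<in>P. exp (K\<^sup>2 * (b p)\<^sup>2))"
  proof (rule prod_mono, intro conjI)
    fix p assume p: "p \<in> P"
    show "0 \<le> avg P (\<lambda>q. exp (b p * x q))" by (intro avg_nonneg) auto
    have "avg P (\<lambda>q. exp (b p * x q)) \<le> avg P (\<lambda>q. b p * x q + exp (K\<^sup>2 * (b p)\<^sup>2))"
    proof (rule avg_mono)
      fix q assume "q \<in> P"
      then have "(x q)\<^sup>2 \<le> K\<^sup>2" using x(2)[of q] by (metis abs_ge_zero order_trans power2_abs power_mono)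
      then have "(b p * x q)\<^sup>2 \<le> K\<^sup>2 * (b p)\<^sup>2" by (metis mult.commute mult_left_mono power_mult_distrib zero_le_power2)
      then show "exp (b p * x q) \<le> b p * x q + exp (K\<^sup>2 * (b p)\<^sup>2)"
        using exp_le_add_exp_square[of "b p * x q"] by (smt (verit) exp_le_cancel_iff)
    qed
    also have "\<dots> = exp (K\<^sup>2 * (b p)\<^sup>2)"
      using P x by (simp add: avg_add avg_cmult avg_const) (simp add: avg_def)
    finally show "avg P (\<lambda>q. exp (b p * x q)) \<le> exp (K\<^sup>2 * (b p)\<^sup>2)" .
  qed
  also have "\<dots> = exp (K\<^sup>2 * (\<Sum>p\<in>P. (b p)\<^sup>2))"
    using P by (simp add: exp_sum[symmetric] sum_distrib_left)
  finally show ?thesis .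
qed

text \<open>Coefficients of mixed sign are not comonotone. Positive and negative parts are therefore
  treated separately, the latter with -x in place of x, and recombined by the arithmetic-geometric
  mean inequality; the doubling this requires produces the factor 4.\<close>

lemma perms_exp_linear_le:
  fixes x b :: "'a \<Rightarrow> real"
  assumes P: "finite P" "P \<noteq> {}" and x: "(\<Sum>p\<in>P. x p) = 0" "\<And>p. p \<in> P \<Longrightarrow> \<bar>x p\<bar> \<le> K"
  shows "avg (perms P) (\<lambda>\<pi>. exp (\<Sum>p\<in>P. b p * x (\<pi> p))) \<le> exp (4 * K\<^sup>2 * (\<Sum>p\<in>P. (b p)\<^sup>2))"
proof -
  define u where "u = (\<lambda>p. 2 * max 0 (b p))"
  define v where "v = (\<lambda>p. 2 * max 0 (- b p))"
  have S: "(\<Sum>p\<in>P. (w p)\<^sup>2) \<le> 4 * (\<Sum>p\<in>P. (b p)\<^sup>2)" if "\<And>p. (w p)\<^sup>2 \<le> 4 * (b p)\<^sup>2" for w :: "'a \<Rightarrow> real"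
    unfolding sum_distrib_left by (intro sum_mono that)
  have u2: "(u p)\<^sup>2 \<le> 4 * (b p)\<^sup>2" and v2: "(v p)\<^sup>2 \<le> 4 * (b p)\<^sup>2" for p
    unfolding u_def v_def by (auto simp: max_def power_mult_distrib)
  have A: "avg (perms P) (\<lambda>\<pi>. exp (\<Sum>p\<in>P. u p * x (\<pi> p))) \<le> exp (4 * K\<^sup>2 * (\<Sum>p\<in>P. (b p)\<^sup>2))"
  proof -
    have "avg (perms P) (\<lambda>\<pi>. exp (\<Sum>p\<in>P. u p * x (\<pi> p))) \<le> exp (K\<^sup>2 * (\<Sum>p\<in>P. (u p)\<^sup>2))"
      using assms by (intro perms_exp_linear_le_nonneg) (auto simp: u_def)
    also have "\<dots> \<le> exp (4 * K\<^sup>2 * (\<Sum>p\<in>P. (b p)\<^sup>2))"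
      using mult_left_mono[OF S[OF u2], of "K\<^sup>2"] by (simp add: algebra_simps)
    finally show ?thesis .
  qed
  have B: "avg (perms P) (\<lambda>\<pi>. exp (\<Sum>p\<in>P. v p * (- x (\<pi> p)))) \<le> exp (4 * K\<^sup>2 * (\<Sum>p\<in>P. (b p)\<^sup>2))"
  proof -
    have "avg (perms P) (\<lambda>\<pi>. exp (\<Sum>p\<in>P. v p * (- x (\<pi> p)))) \<le> exp (K\<^sup>2 * (\<Sum>p\<in>P. (v p)\<^sup>2))"
      using assms by (intro perms_exp_linear_le_nonneg[where x = "\<lambda>p. - x p"]) (auto simp: v_def sum_negf)
    also have "\<dots> \<le> exp (4 * K\<^sup>2 * (\<Sum>p\<in>P. (b p)\<^sup>2))"
      using mult_left_mono[OF S[OF v2], of "K\<^sup>2"] by (simp add: algebra_simps)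
    finally show ?thesis .
  qed
  have "avg (perms P) (\<lambda>\<pi>. exp (\<Sum>p\<in>P. b p * x (\<pi> p)))
    \<le> avg (perms P) (\<lambda>\<pi>. 1/2 * exp (\<Sum>p\<in>P. u p * x (\<pi> p)) + 1/2 * exp (\<Sum>p\<in>P. v p * (- x (\<pi> p))))"
  proof (rule avg_mono)
    fix \<pi>
    define a c where "a = (\<Sum>p\<in>P. u p * x (\<pi> p))" and "c = (\<Sum>p\<in>P. v p * (- x (\<pi> p)))"
    have "(\<Sum>p\<in>P. b p * x (\<pi> p)) = a / 2 + c / 2"
      unfolding a_def c_def u_def v_def sum_divide_distrib sum.distrib[symmetric]
      by (intro sum.cong) (auto simp: max_def)
    moreover have "exp (a / 2 + c / 2) \<le> 1/2 * exp a + 1/2 * exp c"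
    proof -
      have "0 \<le> (exp (a/2) - exp (c/2))\<^sup>2" by simp
      then show ?thesis by (simp add: power2_diff exp_double[symmetric] exp_add)
    qed
    ultimately show "exp (\<Sum>p\<in>P. b p * x (\<pi> p)) \<le> 1/2 * exp a + 1/2 * exp c" by simp
  qed
  also have "\<dots> \<le> exp (4 * K\<^sup>2 * (\<Sum>p\<in>P. (b p)\<^sup>2))"
    unfolding avg_add avg_cmult using A B by simp
  finally show ?thesis .
qed

section \<open>Signed sums and the Littlewood-Offord inequality\<close>

text \<open>Random signs on \<open>J\<close> are encoded by the uniformly random set \<open>B \<subseteq> J\<close> of positive ones.\<close>

definition sg :: "'a set \<Rightarrow> 'a \<Rightarrow> real" where
  "sg B j = (if j \<in> B then 1 else - 1)"

lemma avg_Pow_insert: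
  assumes "finite J" "j \<notin> J"
  shows "avg (Pow (insert j J)) f = avg (Pow J) (\<lambda>B. (f B + f (insert j B)) / 2)"
proof -
  have "sum f (Pow (insert j J)) = sum f (Pow J) + sum f (insert j ` Pow J)"
    unfolding Pow_insert using assms by (intro sum.union_disjoint) auto
  also have "sum f (insert j ` Pow J) = sum (\<lambda>B. f (insert j B)) (Pow J)"
    using assms by (subst sum.reindex) (auto simp: inj_on_def o_def)
  finally show ?thesis
    using assms unfolding avg_def
    by (simp add: card_Pow sum.distrib sum_divide_distrib[symmetric] field_simps)
qed

lemma sum_sg_insert:
  assumes "finite J" "j \<notin> J" "B \<subseteq> J"
  shows "(\<Sum>i\<in>insert j J. sg B i * a i) = (\<Sum>i\<in>J. sg B i * a i) - a j"
    and "(\<Sum>i\<in>insert j J. sg (insert j B) i * a i) = (\<Sum>i\<in>J. sg B i * a i) + a j"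
proof -
  have "(\<Sum>i\<in>J. sg (insert j B) i * a i) = (\<Sum>i\<in>J. sg B i * a i)"
    using assms by (intro sum.cong) (auto simp: sg_def)
  then show "(\<Sum>i\<in>insert j J. sg B i * a i) = (\<Sum>i\<in>J. sg B i * a i) - a j"
    "(\<Sum>i\<in>insert j J. sg (insert j B) i * a i) = (\<Sum>i\<in>J. sg B i * a i) + a j"
    using assms by (auto simp: sg_def)
qed

lemma avg_Pow_insert_sum:
  fixes h :: "real \<Rightarrow> real"
  assumes "finite J" "j \<notin> J"
  shows "avg (Pow (insert j J)) (\<lambda>B. h (\<Sum>i\<in>insert j J. sg B i * a i))
       = avg (Pow J) (\<lambda>B. (h ((\<Sum>i\<in>J. sg B i * a i) - a j) + h ((\<Sum>i\<in>J. sg B i * a i) + a j)) / 2)"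
  unfolding avg_Pow_insert[OF assms]
  by (intro avg_cong) (simp only: Pow_iff sum_sg_insert[OF assms])

lemma avg_Pow_const: "finite J \<Longrightarrow> avg (Pow J) (\<lambda>B. c) = c"
  by (rule avg_const) auto

text \<open>One sign is added at a time, and averaging over it removes the odd powers of
  \<open>a j\<close>. The fourth moment is compared with the Gaussian value 3 times the squared
  variance.\<close>

lemma signed_sum_moments:
  fixes a :: "'a \<Rightarrow> real"
  assumes "finite J"
  shows "avg (Pow J) (\<lambda>B. (\<Sum>i\<in>J. sg B i * a i)) = 0"
    and "avg (Pow J) (\<lambda>B. (\<Sum>i\<in>J. sg B i * a i)^2) = (\<Sum>i\<in>J. (a i)\<^sup>2)"
    and "avg (Pow J) (\<lambda>B. (\<Sum>i\<in>J. sg B i * a i)^3) = 0"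
    and "avg (Pow J) (\<lambda>B. (\<Sum>i\<in>J. sg B i * a i)^4) \<le> 3 * (\<Sum>i\<in>J. (a i)\<^sup>2)^2"
  using assms
proof (induction J rule: finite_induct)
  case (insert j J)
  note ae = avg_add avg_cmult avg_Pow_const[OF insert(1)]
  define S where "S = (\<lambda>B. \<Sum>i\<in>J. sg B i * a i)"
  have I: "avg (Pow (insert j J)) (\<lambda>B. h (\<Sum>i\<in>insert j J. sg B i * a i))
    = avg (Pow J) (\<lambda>B. (h (S B - a j) + h (S B + a j)) / 2)" for h
    unfolding S_def by (rule avg_Pow_insert_sum[OF insert(1,2)])
  have IH: "avg (Pow J) S = 0" "avg (Pow J) (\<lambda>B. (S B)^2) = (\<Sum>i\<in>J. (a i)\<^sup>2)"
    "avg (Pow J) (\<lambda>B. (S B)^3) = 0" "avg (Pow J) (\<lambda>B. (S B)^4) \<le> 3 * (\<Sum>i\<in>J. (a i)\<^sup>2)^2"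
    using insert.IH unfolding S_def by simp_all
  { case 1
    show ?case using IH(1) unfolding I[of "\<lambda>s. s"] by simp }
  { case 2
    have "avg (Pow (insert j J)) (\<lambda>B. (\<Sum>i\<in>insert j J. sg B i * a i)^2) = avg (Pow J) (\<lambda>B. (S B)^2 + (a j)^2)"
      unfolding I[of "\<lambda>s. s^2"] by (intro avg_cong) (simp add: power2_eq_square algebra_simps)
    then show ?case using IH(2) insert(1,2) by (simp add: ae) }
  { case 3
    have "avg (Pow (insert j J)) (\<lambda>B. (\<Sum>i\<in>insert j J. sg B i * a i)^3) = avg (Pow J) (\<lambda>B. (S B)^3 + 3 * (a j)^2 * S B)"
      unfolding I[of "\<lambda>s. s^3"] by (intro avg_cong) (simp add: power2_eq_square power3_eq_cube algebra_simps)
    then show ?case using IH(1,3) insert(1,2) by (simp add: ae) }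
  { case 4
    have "avg (Pow (insert j J)) (\<lambda>B. (\<Sum>i\<in>insert j J. sg B i * a i)^4) = avg (Pow J) (\<lambda>B. ((S B)^4 + 6 * (a j)^2 * (S B)^2) + (a j)^4)"
      unfolding I[of "\<lambda>s. s^4"] by (intro avg_cong) (simp add: power2_eq_square power4_eq_xxxx algebra_simps)
    also have "\<dots> \<le> 3 * (\<Sum>i\<in>J. (a i)\<^sup>2)^2 + 6 * (a j)^2 * (\<Sum>i\<in>J. (a i)\<^sup>2) + (a j)^4"
      using IH(2,4) by (simp add: ae)
    also have "\<dots> \<le> 3 * (\<Sum>i\<in>insert j J. (a i)\<^sup>2)^2"
    proof -
      have "3 * (\<Sum>i\<in>insert j J. (a i)\<^sup>2)^2 = 3 * (\<Sum>i\<in>J. (a i)\<^sup>2)^2 + 6 * (a j)^2 * (\<Sum>i\<in>J. (a i)\<^sup>2) + 3 * (a j)^4"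
        using insert(1,2) by (simp add: power2_eq_square power4_eq_xxxx algebra_simps)
      then show ?thesis by simp
    qed
    finally show ?case . }
qed (simp_all add: avg_def)

section \<open>Laplace transform of a squared signed sum\<close>

lemma exp_minus_le_quadratic: "exp (- y) \<le> 1 - y + y\<^sup>2 / 2" if "y \<ge> 0" for y :: real
proof -
  define f where "f = (\<lambda>y::real. 1 - y + y\<^sup>2 / 2 - exp (- y))"
  have "f 0 \<le> f y"
  proof (rule DERIV_nonneg_imp_nondecreasing[of 0 y])
    fix t :: real
    have "(f has_real_derivative (- 1 + t + exp (- t))) (at t)"
      unfolding f_def by (auto intro!: derivative_eq_intros)
    moreover have "- 1 + t + exp (- t) \<ge> 0" using exp_ge_add_one_self[of "- t"] by linarith
    ultimately show "\<exists>y. (f has_real_derivative y) (at t) \<and> 0 \<le> y" by blast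
  qed (use that in auto)
  then show ?thesis by (simp add: f_def)
qed

text \<open>The bound must be uniform in the shift t. With Y the squared distance and \<mu> its
  mean, the moments give a second moment of at most \<open>3 * \<mu>\<^sup>2\<close>, and a
  quadratic upper bound for exp turns this into decay, as long as \<theta> * \<mu> is not too
  large.\<close>

lemma signed_sum_exp_square_le:
  fixes a :: "'a \<Rightarrow> real"
  assumes J: "finite J" and \<theta>: "\<theta> \<ge> 0" "\<theta> * (\<Sum>i\<in>J. (a i)\<^sup>2) \<le> 1/3"
  shows "avg (Pow J) (\<lambda>B. exp (- \<theta> * ((\<Sum>i\<in>J. sg B i * a i) - t)\<^sup>2)) \<le> exp (- \<theta> / 2 * (\<Sum>i\<in>J. (a i)\<^sup>2))"
proof -
  define v where "v = (\<Sum>i\<in>J. (a i)\<^sup>2)"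
  define \<mu> where "\<mu> = v + t\<^sup>2"
  define S where "S = (\<lambda>B. \<Sum>i\<in>J. sg B i * a i)"
  have M: "avg (Pow J) S = 0" "avg (Pow J) (\<lambda>B. (S B)^2) = v"
    "avg (Pow J) (\<lambda>B. (S B)^3) = 0" "avg (Pow J) (\<lambda>B. (S B)^4) \<le> 3 * v^2"
    using signed_sum_moments[OF J, of a] unfolding S_def v_def by simp_all
  note ae = avg_add avg_cmult avg_Pow_const[OF J]
  have v0: "v \<ge> 0" unfolding v_def by (intro sum_nonneg) auto
  then have \<mu>0: "\<mu> \<ge> 0" "\<mu> \<ge> v" unfolding \<mu>_def by auto
  have Y1: "avg (Pow J) (\<lambda>B. (S B - t)\<^sup>2) = \<mu>"
  proof -
    have "avg (Pow J) (\<lambda>B. (S B - t)\<^sup>2) = avg (Pow J) (\<lambda>B. (S B)\<^sup>2 + (- 2 * t) * S B + t\<^sup>2)"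
      by (intro avg_cong) (simp add: power2_eq_square algebra_simps)
    then show ?thesis unfolding ae \<mu>_def M by simp
  qed
  have Y2: "avg (Pow J) (\<lambda>B. ((S B - t)\<^sup>2)\<^sup>2) \<le> 3 * \<mu>\<^sup>2"
  proof -
    have "avg (Pow J) (\<lambda>B. ((S B - t)\<^sup>2)\<^sup>2) = avg (Pow J) (\<lambda>B. (S B)^4 + (- 4 * t) * (S B)^3 + (6 * t\<^sup>2) * (S B)\<^sup>2 + (- 4 * t^3) * S B + t^4)"
      by (intro avg_cong) (simp add: power2_eq_square power3_eq_cube power4_eq_xxxx algebra_simps)
    also have "\<dots> \<le> 3 * v\<^sup>2 + 6 * t\<^sup>2 * v + t^4"
      unfolding ae M using M(4) by simp
    also have "\<dots> \<le> 3 * \<mu>\<^sup>2"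
    proof -
      have "3 * \<mu>\<^sup>2 = 3 * v\<^sup>2 + 6 * t\<^sup>2 * v + 3 * t^4"
        unfolding \<mu>_def by (simp add: power2_eq_square power4_eq_xxxx algebra_simps)
      then show ?thesis by simp
    qed
    finally show ?thesis .
  qed
  \<comment> \<open>Lowering the rate from \<theta> to r only increases the left side, so r stays
    free and can be adapted to a large shift.\<close>
  have main: "avg (Pow J) (\<lambda>B. exp (- \<theta> * (S B - t)\<^sup>2)) \<le> 1 - r * \<mu> + 3/2 * r\<^sup>2 * \<mu>\<^sup>2" if r: "0 \<le> r" "r \<le> \<theta>" for r
  proof -
    have "avg (Pow J) (\<lambda>B. exp (- \<theta> * (S B - t)\<^sup>2)) \<le> avg (Pow J) (\<lambda>B. 1 + (- r) * (S B - t)\<^sup>2 + (r\<^sup>2/2) * ((S B - t)\<^sup>2)\<^sup>2)"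
    proof (rule avg_mono)
      fix B
      have "exp (- \<theta> * (S B - t)\<^sup>2) \<le> exp (- (r * (S B - t)\<^sup>2))" using r by (simp add: mult_right_mono)
      also have "\<dots> \<le> 1 - r * (S B - t)\<^sup>2 + (r * (S B - t)\<^sup>2)\<^sup>2 / 2"
        using r by (intro exp_minus_le_quadratic) auto
      finally show "exp (- \<theta> * (S B - t)\<^sup>2) \<le> 1 + (- r) * (S B - t)\<^sup>2 + (r\<^sup>2/2) * ((S B - t)\<^sup>2)\<^sup>2"
        by (simp add: power_mult_distrib)
    qed
    also have "\<dots> \<le> 1 - r * \<mu> + (r\<^sup>2/2) * (3 * \<mu>\<^sup>2)"
      unfolding ae Y1 using mult_left_mono[OF Y2, of "r\<^sup>2/2"] by simp
    finally show ?thesis by simp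
  qed
  have lin: "1 - \<theta> * v / 2 \<le> exp (- \<theta> / 2 * v)"
    using exp_ge_add_one_self[of "- \<theta> / 2 * v"] by simp
  have "avg (Pow J) (\<lambda>B. exp (- \<theta> * (S B - t)\<^sup>2)) \<le> 1 - \<theta> * v / 2"
  proof (cases "\<theta> * \<mu> \<le> 1/3")
    case True
    have "(\<theta> * \<mu>)\<^sup>2 \<le> (\<theta> * \<mu>) * (1/3)"
      unfolding power2_eq_square by (rule mult_left_mono[OF True]) (use \<theta> \<mu>0 in simp)
    then have "3/2 * (\<theta> * \<mu>)\<^sup>2 \<le> 1/2 * (\<theta> * \<mu>)" by linarith
    moreover have "\<theta> * v \<le> \<theta> * \<mu>" using \<theta> \<mu>0 by (simp add: mult_left_mono)
    moreover have "3/2 * \<theta>\<^sup>2 * \<mu>\<^sup>2 = 3/2 * (\<theta> * \<mu>)\<^sup>2" by (simp add: power_mult_distrib)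
    ultimately show ?thesis using main[of \<theta>] \<theta>(1) by linarith
  next
    case False
    then have m: "\<mu> > 0" using \<mu>0 by (cases "\<mu> = 0") auto
    \<comment> \<open>This r minimises the quadratic in \<open>main\<close>. The minimum 5/6
      suffices because \<theta> * v \<le> 1/3.\<close>
    define r where "r = 1 / (3 * \<mu>)"
    have r: "r * \<mu> = 1/3" "r \<ge> 0" "r \<le> \<theta>" using m False by (auto simp: r_def field_simps)
    moreover have "3/2 * r\<^sup>2 * \<mu>\<^sup>2 = 3/2 * (r * \<mu>)\<^sup>2" by (simp add: power_mult_distrib)
    moreover have "(r * \<mu>)\<^sup>2 = 1/9" unfolding r(1) by (simp add: power2_eq_square)
    ultimately have "1 - r * \<mu> + 3/2 * r\<^sup>2 * \<mu>\<^sup>2 = 5/6" by linarith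
    moreover have "\<theta> * v / 2 \<le> 1/6" using \<theta> by (simp add: v_def)
    ultimately show ?thesis using main[of r] r by linarith
  qed
  then show ?thesis using lin unfolding S_def v_def by linarith
qed

text \<open>Induction on \<open>J\<close>: each \<open>B \<in> F\<close> is counted in \<open>J - {j}\<close> for every \<open>j \<notin> B\<close>.\<close>

lemma LYM_inequality:
  assumes "finite J" "F \<subseteq> Pow J" "\<And>A B. A \<in> F \<Longrightarrow> B \<in> F \<Longrightarrow> \<not> A \<subset> B"
  shows "(\<Sum>B\<in>F. fact (card B) * fact (card J - card B)) \<le> (fact (card J) :: nat)"
  using assms
proof (induction "card J" arbitrary: J F)
  case 0
  then have "F \<subseteq> {{}}" by auto
  then consider "F = {}" | "F = {{}}" by blast
  then show ?case using 0 by cases auto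
next
  case (Suc m)
  show ?case
  proof (cases "J \<in> F")
    case True
    have "B = J" if B: "B \<in> F" for B
    proof -
      have "B \<subseteq> J" using B Suc.prems(2) by blast
      moreover have "\<not> B \<subset> J" by (rule Suc.prems(3)[OF B True])
      ultimately show ?thesis by blast
    qed
    with True have "F = {J}" by blast
    then show ?thesis by simp
  next
    case False
    have finF: "finite F" using finite_subset[OF Suc.prems(2)] finite_Pow_iff[of J] Suc.prems(1) by blast
    have lt: "card B < Suc m" "B \<subset> J" "finite B" if "B \<in> F" for B
    proof -
      show BJ: "B \<subset> J" using that Suc.prems(2) False by auto
      show "card B < Suc m" using psubset_card_mono[OF Suc.prems(1) BJ] Suc.hyps(2) by simp
      show "finite B" using BJ Suc.prems(1) finite_subset by blast
    qed
    have "(\<Sum>B\<in>F. fact (card B) * fact (card J - card B)) = (\<Sum>B\<in>F. \<Sum>j\<in>J - B. fact (card B) * fact (m - card B) :: nat)"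
    proof (intro sum.cong refl)
      fix B assume B: "B \<in> F"
      have "card (J - B) = Suc m - card B" using lt[OF B] Suc by (simp add: card_Diff_subset)
      also have "\<dots> = Suc (m - card B)" using lt[OF B] by simp
      finally have "card (J - B) = Suc (m - card B)" .
      moreover have "card J - card B = Suc (m - card B)" using lt[OF B] Suc by simp
      ultimately show "fact (card B) * fact (card J - card B) = (\<Sum>j\<in>J - B. fact (card B) * fact (m - card B) :: nat)"
        by (simp only: sum_constant) (simp add: algebra_simps)
    qed
    also have "\<dots> = (\<Sum>B\<in>F. \<Sum>j | j \<in> J \<and> j \<notin> B. fact (card B) * fact (m - card B))"
      by (intro sum.cong) auto
    also have "\<dots> = (\<Sum>j\<in>J. \<Sum>B | B \<in> F \<and> j \<notin> B. fact (card B) * fact (m - card B))"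
      using finF Suc.prems(1) by (rule sum.swap_restrict)
    also have "\<dots> \<le> (\<Sum>j\<in>J. fact m)"
    proof (rule sum_mono)
      fix j assume j: "j \<in> J"
      have m: "m = card (J - {j})" using j Suc by simp
      have "(\<Sum>B | B \<in> F \<and> j \<notin> B. fact (card B) * fact (card (J - {j}) - card B)) \<le> (fact (card (J - {j})) :: nat)"
        using Suc.prems by (intro Suc.hyps(1)[OF m]) auto
      then show "(\<Sum>B | B \<in> F \<and> j \<notin> B. fact (card B) * fact (m - card B)) \<le> (fact m :: nat)"
        by (simp flip: m)
    qed
    also have "\<dots> = fact (card J)" by (simp flip: Suc.hyps(2))
    finally show ?thesis .
  qed
qed

section \<open>Sperner's theorem and the central binomial coefficient\<close>

text \<open>Each summand of the LYM sum is \<open>fact m\<close> divided by a binomial coefficient,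
  hence at least \<open>fact m\<close> divided by the largest one.\<close>

lemma Sperner_bound:
  assumes J: "finite J" and F: "F \<subseteq> Pow J" "\<And>A B. A \<in> F \<Longrightarrow> B \<in> F \<Longrightarrow> \<not> A \<subset> B"
  shows "card F \<le> card J choose (card J div 2)"
proof -
  define m where "m = card J"
  define M where "M = m choose (m div 2)"
  have M0: "M > 0" unfolding M_def by (simp add: zero_less_binomial)
  have "card F * fact m = (\<Sum>B\<in>F. fact m)" by simp
  also have "\<dots> \<le> (\<Sum>B\<in>F. M * (fact (card B) * fact (m - card B)))"
  proof (rule sum_mono)
    fix B assume "B \<in> F"
    then have "card B \<le> m" using F J unfolding m_def by (auto intro: card_mono)
    then have "fact m = (m choose card B) * (fact (card B) * fact (m - card B))"
      using binomial_fact_lemma[of "card B" m] by (simp add: algebra_simps)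
    also have "\<dots> \<le> M * (fact (card B) * fact (m - card B))"
      unfolding M_def by (intro mult_right_mono binomial_maximum) auto
    finally show "fact m \<le> M * (fact (card B) * fact (m - card B))" .
  qed
  also have "\<dots> = M * (\<Sum>B\<in>F. fact (card B) * fact (m - card B))" by (simp add: sum_distrib_left)
  also have "\<dots> \<le> M * fact m"
    using LYM_inequality[OF J F] unfolding m_def by (intro mult_left_mono) auto
  finally show ?thesis unfolding M_def m_def by simp
qed

text \<open>Squaring keeps the statement within the natural numbers and makes it inductive: passing
  from n to n + 1 multiplies the left side by 4 * (2 * n + 1) * (2 * n + 3) / (n + 1)^2, which is at
  most 16.\<close>

lemma central_binomial_upper: "((2 * n) choose n)\<^sup>2 * (2 * n + 1) \<le> 16 ^ n"
proof (induction n)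
  case (Suc n)
  have step: "Suc n * ((2 * Suc n) choose Suc n) = 2 * (2 * n + 1) * ((2 * n) choose n)"
  proof -
    have a: "Suc n * ((2 * Suc n) choose Suc n) = (2 * Suc n) * (Suc (2 * n) choose n)"
      using Suc_times_binomial_eq[of "Suc (2 * n)" n] by simp
    have "Suc n * (Suc (2 * n) choose Suc n) = Suc (2 * n) * ((2 * n) choose n)"
      using Suc_times_binomial_eq[of "2 * n" n] by simp
    moreover have "Suc (2 * n) choose Suc n = Suc (2 * n) choose n"
      using binomial_symmetric[of n "Suc (2 * n)"] by (simp add: Suc_diff_le)
    ultimately show ?thesis using a by (metis (no_types, lifting) Suc_eq_plus1 mult.assoc mult.left_commute mult_Suc_right)
  qed
  have "(Suc n)\<^sup>2 * (((2 * Suc n) choose Suc n)\<^sup>2 * (2 * Suc n + 1)) = (Suc n * ((2 * Suc n) choose Suc n))\<^sup>2 * (2 * n + 3)"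
  proof -
    have "2 * Suc n + 1 = 2 * n + 3" by simp
    then show ?thesis by (simp only: power_mult_distrib mult.assoc)
  qed
  also have "\<dots> = (4 * (2 * n + 1) * (2 * n + 3)) * (((2 * n) choose n)\<^sup>2 * (2 * n + 1))"
    unfolding step by (simp add: power2_eq_square algebra_simps)
  also have "\<dots> \<le> (4 * (2 * n + 1) * (2 * n + 3)) * 16 ^ n"
    using Suc.IH by (rule mult_left_mono) auto
  also have "\<dots> \<le> (16 * (Suc n)\<^sup>2) * 16 ^ n"
    by (rule mult_right_mono) (auto simp: power2_eq_square algebra_simps)
  finally have "(Suc n)\<^sup>2 * (((2 * Suc n) choose Suc n)\<^sup>2 * (2 * Suc n + 1)) \<le> (Suc n)\<^sup>2 * 16 ^ Suc n"
    by (simp add: algebra_simps)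
  then show ?case by (simp only: mult_le_cancel1) simp
qed simp

lemma central_binomial_le: 
  assumes "m \<ge> 1"
  shows "real (m choose (m div 2)) / 2 ^ m \<le> 2 / sqrt (real m)"
proof -
  have even: "real ((2 * n) choose n) / 2 ^ (2 * n) \<le> 1 / sqrt (real (2 * n + 1))" for n
  proof -
    have "real (((2 * n) choose n)\<^sup>2 * (2 * n + 1)) \<le> real (16 ^ n)"
      using central_binomial_upper of_nat_le_iff by blast
    then have "(real ((2 * n) choose n))\<^sup>2 * real (2 * n + 1) \<le> 16 ^ n"
      by (simp only: of_nat_mult of_nat_power of_nat_numeral)
    moreover have "((2::real) ^ (2 * n))\<^sup>2 = 16 ^ n"
      unfolding power_mult power2_eq_square power_mult_distrib[symmetric] by simp
    ultimately have "(real ((2 * n) choose n))\<^sup>2 * real (2 * n + 1) \<le> ((2::real) ^ (2 * n))\<^sup>2"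
      by simp
    then have "(real ((2 * n) choose n) * sqrt (real (2 * n + 1)))\<^sup>2 \<le> ((2::real) ^ (2 * n))\<^sup>2"
      by (simp add: power_mult_distrib)
    then have "real ((2 * n) choose n) * sqrt (real (2 * n + 1)) \<le> 2 ^ (2 * n)"
      by (rule power2_le_imp_le) simp
    then show ?thesis by (simp add: field_simps)
  qed
  obtain n where "m = 2 * n \<or> m = 2 * n + 1" by (metis evenE oddE)
  then show ?thesis
  proof
    assume m: "m = 2 * n"
    have "1 / sqrt (real (2 * n + 1)) \<le> 1 / sqrt (real m)"
      using assms m by (intro divide_left_mono) auto
    also have "\<dots> \<le> 2 / sqrt (real m)" using assms by (simp add: divide_right_mono)
    finally show ?thesis using even[of n] m by simp
  next
    assume m: "m = 2 * n + 1"
    have "(2 * n + 1) choose n \<le> 2 * ((2 * n) choose n)"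
    proof (cases n)
      case (Suc k)
      then show ?thesis using binomial_maximum[of "2 * n" k] by simp
    qed simp
    then have "real (m choose (m div 2)) / 2 ^ m \<le> real (2 * ((2 * n) choose n)) / 2 ^ m"
      using m by (intro divide_right_mono) (simp_all only: of_nat_le_iff, auto)
    also have "\<dots> = real ((2 * n) choose n) / 2 ^ (2 * n)" using m by simp
    also have "\<dots> \<le> 1 / sqrt (real m)" using even[of n] m by simp
    also have "\<dots> \<le> 2 / sqrt (real m)" using assms by (simp add: divide_right_mono)
    finally show ?thesis .
  qed
qed

section \<open>Littlewood-Offord bounds\<close>

text \<open>Erdos's argument. Once all coefficients are made positive, enlarging the set of positive
  signs raises the sum by at least 2 * h, more than the length of the window; the sets that hit the
  window form an antichain.\<close>

lemma Littlewood_Offord_unit: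
  fixes a :: "'a \<Rightarrow> real"
  assumes J: "finite J" "J \<noteq> {}" and h: "h > 0" "\<And>j. j \<in> J \<Longrightarrow> h \<le> \<bar>a j\<bar>"
  shows "avg (Pow J) (\<lambda>B. of_bool (s \<le> (\<Sum>j\<in>J. sg B j * a j) \<and> (\<Sum>j\<in>J. sg B j * a j) < s + h)) \<le> 2 / sqrt (real (card J))"
proof -
  define N where "N = {j\<in>J. a j < 0}"
  \<comment> \<open>Symmetric difference with the indices of negative coefficients is an involution
    that replaces each \<open>a j\<close> by its modulus.\<close>
  define fl where "fl = (\<lambda>B. (B - N) \<union> (N - B))"
  define S where "S = (\<lambda>B. \<Sum>j\<in>J. sg B j * a j)"
  define F where "F = {B \<in> Pow J. s \<le> S B \<and> S B < s + h}"
  have invol: "fl (fl B) = B" for B unfolding fl_def by blast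
  have Sfl: "S (fl B) = (\<Sum>j\<in>J. sg B j * \<bar>a j\<bar>)" for B
    unfolding S_def by (intro sum.cong) (auto simp: sg_def fl_def N_def)
  have anti: "\<not> A \<subset> B" if AB: "A \<in> fl ` F" "B \<in> fl ` F" for A B
  proof
    assume sub: "A \<subset> B"
    have "B \<subseteq> J" using AB by (auto simp: F_def fl_def N_def)
    then obtain j where j: "j \<in> B" "j \<notin> A" "j \<in> J" using sub by blast
    have A: "S (fl A) < s + h" "s \<le> S (fl B)" "S (fl B) < s + h" "s \<le> S (fl A)" using AB by (auto simp: invol F_def)
    have "sg A i * \<bar>a i\<bar> + (if i = j then 2 * \<bar>a i\<bar> else 0) \<le> sg B i * \<bar>a i\<bar>" if "i \<in> J" for i
      using sub j by (auto simp: sg_def)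
    then have "(\<Sum>i\<in>J. sg A i * \<bar>a i\<bar> + (if i = j then 2 * \<bar>a i\<bar> else 0)) \<le> S (fl B)"
      unfolding Sfl by (intro sum_mono)
    then have "S (fl A) + 2 * \<bar>a j\<bar> \<le> S (fl B)"
      unfolding Sfl using j J by (simp add: sum.distrib)
    then show False using h(2)[OF j(3)] h(1) A by linarith
  qed
  have "inj_on fl F" by (metis inj_onI invol)
  then have "card F = card (fl ` F)" by (simp add: card_image)
  also have "\<dots> \<le> card J choose (card J div 2)"
    by (rule Sperner_bound[OF J(1) _ anti]) (auto simp: F_def fl_def N_def)
  finally have cF: "card F \<le> card J choose (card J div 2)" .
  have "avg (Pow J) (\<lambda>B. of_bool (s \<le> S B \<and> S B < s + h)) = real (card F) / 2 ^ card J"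
    unfolding avg_def F_def using J by (simp add: card_Pow sum.If_cases Int_def of_bool_def)
  also have "\<dots> \<le> real (card J choose (card J div 2)) / 2 ^ card J"
    using cF by (intro divide_right_mono) auto
  also have "\<dots> \<le> 2 / sqrt (real (card J))"
    using J by (intro central_binomial_le) (simp add: Suc_le_eq card_gt_0_iff)
  finally show ?thesis unfolding S_def .
qed

lemma Littlewood_Offord_interval:
  fixes a :: "'a \<Rightarrow> real"
  assumes J: "finite J" "J \<noteq> {}" and h: "h > 0" "\<And>j. j \<in> J \<Longrightarrow> h \<le> \<bar>a j\<bar>" and e: "\<epsilon> \<ge> 0"
  shows "avg (Pow J) (\<lambda>B. of_bool (\<bar>(\<Sum>j\<in>J. sg B j * a j) + t\<bar> \<le> \<epsilon>)) \<le> 4 * (\<epsilon> / h + 1) / sqrt (real (card J))"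
proof -
  \<comment> \<open>The closed interval of length 2 * \<epsilon> is covered by half-open windows of
    length h; the extra one takes care of the right end.\<close>
  define k where "k = nat \<lfloor>2 * \<epsilon> / h\<rfloor> + 1"
  have k: "2 * \<epsilon> / h < real k" "real k \<le> 2 * \<epsilon> / h + 1"
    using e h(1) unfolding k_def by (simp_all only: of_nat_add of_nat_1 of_nat_nat zero_le_floor divide_nonneg_pos mult_nonneg_nonneg zero_le_numeral) linarith+
  have "avg (Pow J) (\<lambda>B. of_bool (\<bar>(\<Sum>j\<in>J. sg B j * a j) + t\<bar> \<le> \<epsilon>))
     \<le> (\<Sum>i<k. avg (Pow J) (\<lambda>B. of_bool (- t - \<epsilon> + real i * h \<le> (\<Sum>j\<in>J. sg B j * a j)
             \<and> (\<Sum>j\<in>J. sg B j * a j) < - t - \<epsilon> + real i * h + h)))"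
  proof (rule avg_union_bound)
    fix B
    define S where "S = (\<Sum>j\<in>J. sg B j * a j)"
    assume "\<bar>(\<Sum>j\<in>J. sg B j * a j) + t\<bar> \<le> \<epsilon>"
    then have S: "0 \<le> S + t + \<epsilon>" "S + t + \<epsilon> \<le> 2 * \<epsilon>" by (auto simp: S_def)
    define r where "r = (S + t + \<epsilon>) / h"
    define i where "i = nat \<lfloor>r\<rfloor>"
    have "r \<ge> 0" using S h(1) by (simp add: r_def)
    then have "real i = real_of_int \<lfloor>r\<rfloor>" by (simp add: i_def)
    then have "real i \<le> r" "r < real i + 1" by linarith+
    then have i: "real i \<le> (S + t + \<epsilon>) / h" "(S + t + \<epsilon>) / h < real i + 1" by (simp_all add: r_def)
    have "(S + t + \<epsilon>) / h \<le> 2 * \<epsilon> / h" using S h by (intro divide_right_mono) auto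
    then have "real i < real k" using i(1) k(1) by linarith
    then have "i < k" by simp
    moreover have "real i * h \<le> S + t + \<epsilon>" "S + t + \<epsilon> < (real i + 1) * h"
      using i h(1) by (simp_all only: pos_le_divide_eq pos_divide_less_eq)
    then have "- t - \<epsilon> + real i * h \<le> S \<and> S < - t - \<epsilon> + real i * h + h"
      by (simp add: distrib_right)
    ultimately show "\<exists>i\<in>{..<k}. - t - \<epsilon> + real i * h \<le> (\<Sum>j\<in>J. sg B j * a j) \<and> (\<Sum>j\<in>J. sg B j * a j) < - t - \<epsilon> + real i * h + h"
      unfolding S_def by auto
  qed simp
  also have "\<dots> \<le> (\<Sum>i<k. 2 / sqrt (real (card J)))"
    by (intro sum_mono Littlewood_Offord_unit J h)
  also have "\<dots> = real k * (2 / sqrt (real (card J)))" by simp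
  also have "\<dots> \<le> (2 * \<epsilon> / h + 1) * (2 / sqrt (real (card J)))"
    using k by (intro mult_right_mono) auto
  also have "\<dots> \<le> 4 * (\<epsilon> / h + 1) / sqrt (real (card J))"
    unfolding times_divide_eq_right by (intro divide_right_mono) (simp_all add: algebra_simps)
  finally show ?thesis .
qed

lemma avg_Pow_Un:
  assumes "finite G" "finite H" "G \<inter> H = {}"
  shows "avg (Pow (G \<union> H)) f = avg (Pow H) (\<lambda>C. avg (Pow G) (\<lambda>B. f (B \<union> C)))"
proof -
  have "bij_betw (\<lambda>(C, B). B \<union> C) (Pow H \<times> Pow G) (Pow (G \<union> H))"
    by (rule bij_betw_byWitness[where f' = "\<lambda>D. (D \<inter> H, D \<inter> G)"]) (use assms in auto)
  then have "avg (Pow (G \<union> H)) f = avg (Pow H \<times> Pow G) (\<lambda>(C, B). f (B \<union> C))"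
    by (subst avg_reindex) (auto simp: case_prod_unfold)
  also have "\<dots> = avg (Pow H) (\<lambda>C. avg (Pow G) (\<lambda>B. f (B \<union> C)))"
    unfolding avg_def using assms by (simp add: sum.cartesian_product[symmetric] sum_divide_distrib[symmetric] card_cartesian_product field_simps)
  finally show ?thesis .
qed

text \<open>Only the coefficients on G are known to be large. Fixing the signs outside G turns their
  contribution into part of the shift, in which the interval bound is uniform.\<close>

lemma Littlewood_Offord:
  fixes a :: "'a \<Rightarrow> real"
  assumes I: "finite I" "G \<subseteq> I" "G \<noteq> {}" and h: "h > 0" "\<And>j. j \<in> G \<Longrightarrow> h \<le> \<bar>a j\<bar>" and e: "\<epsilon> \<ge> 0"
  shows "avg (Pow I) (\<lambda>B. of_bool (\<bar>(\<Sum>j\<in>I. sg B j * a j) + t\<bar> \<le> \<epsilon>)) \<le> 4 * (\<epsilon> / h + 1) / sqrt (real (card G))"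
proof -
  have fin: "finite G" "finite (I - G)" using I finite_subset by auto
  have "avg (Pow (G \<union> (I - G))) (\<lambda>B. of_bool (\<bar>(\<Sum>j\<in>I. sg B j * a j) + t\<bar> \<le> \<epsilon>))
     = avg (Pow (I - G)) (\<lambda>C. avg (Pow G) (\<lambda>B. of_bool (\<bar>(\<Sum>j\<in>I. sg (B \<union> C) j * a j) + t\<bar> \<le> \<epsilon>)))"
    using fin by (intro avg_Pow_Un) auto
  also have "\<dots> \<le> 4 * (\<epsilon> / h + 1) / sqrt (real (card G))"
  proof (rule avg_le_const)
    fix C assume C: "C \<in> Pow (I - G)"
    have eq: "(\<Sum>j\<in>I. sg (B \<union> C) j * a j) + t = (\<Sum>j\<in>G. sg B j * a j) + ((\<Sum>j\<in>I - G. sg C j * a j) + t)" if B: "B \<in> Pow G" for B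
    proof -
      have "(\<Sum>j\<in>I. sg (B \<union> C) j * a j) = (\<Sum>j\<in>G. sg (B \<union> C) j * a j) + (\<Sum>j\<in>I - G. sg (B \<union> C) j * a j)"
        using I by (simp add: sum.subset_diff add.commute)
      also have "(\<Sum>j\<in>G. sg (B \<union> C) j * a j) = (\<Sum>j\<in>G. sg B j * a j)"
        using B C by (intro sum.cong) (auto simp: sg_def)
      also have "(\<Sum>j\<in>I - G. sg (B \<union> C) j * a j) = (\<Sum>j\<in>I - G. sg C j * a j)"
        using B C by (intro sum.cong) (auto simp: sg_def)
      finally show ?thesis by simp
    qed
    have "avg (Pow G) (\<lambda>B. of_bool (\<bar>(\<Sum>j\<in>I. sg (B \<union> C) j * a j) + t\<bar> \<le> \<epsilon>))
      = avg (Pow G) (\<lambda>B. of_bool (\<bar>(\<Sum>j\<in>G. sg B j * a j) + ((\<Sum>j\<in>I - G. sg C j * a j) + t)\<bar> \<le> \<epsilon>))"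
      by (intro avg_cong) (simp add: eq)
    also have "\<dots> \<le> 4 * (\<epsilon> / h + 1) / sqrt (real (card G))"
      by (intro Littlewood_Offord_interval fin I h e)
    finally show "avg (Pow G) (\<lambda>B. of_bool (\<bar>(\<Sum>j\<in>I. sg (B \<union> C) j * a j) + t\<bar> \<le> \<epsilon>)) \<le> 4 * (\<epsilon> / h + 1) / sqrt (real (card G))" .
  qed (use fin in auto)
  finally show ?thesis using I by (simp add: Un_absorb1)
qed

section \<open>Swapping disjoint pairs\<close>

definition disjoint_pairs :: "('i \<Rightarrow> 'a) \<Rightarrow> ('i \<Rightarrow> 'a) \<Rightarrow> 'i set \<Rightarrow> 'a set \<Rightarrow> bool" where
  "disjoint_pairs p p' I P \<longleftrightarrow>
     inj_on p I \<and> inj_on p' I \<and> p ` I \<inter> p' ` I = {} \<and> p ` I \<subseteq> P \<and> p' ` I \<subseteq> P"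

lemma disjoint_pairsD:
  assumes "disjoint_pairs p p' I P"
  shows "k \<in> I \<Longrightarrow> l \<in> I \<Longrightarrow> p k = p l \<longleftrightarrow> k = l"
    and "k \<in> I \<Longrightarrow> l \<in> I \<Longrightarrow> p' k = p' l \<longleftrightarrow> k = l"
    and "k \<in> I \<Longrightarrow> l \<in> I \<Longrightarrow> p k \<noteq> p' l"
    and "k \<in> I \<Longrightarrow> l \<in> I \<Longrightarrow> p' k \<noteq> p l"
    and "k \<in> I \<Longrightarrow> p k \<in> P" and "k \<in> I \<Longrightarrow> p' k \<in> P"
proof -
  have D: "inj_on p I" "inj_on p' I" "p ` I \<inter> p' ` I = {}" "p ` I \<subseteq> P" "p' ` I \<subseteq> P"
    using assms by (auto simp: disjoint_pairs_def)
  show "k \<in> I \<Longrightarrow> l \<in> I \<Longrightarrow> p k = p l \<longleftrightarrow> k = l" using D(1) by (simp add: inj_on_eq_iff)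
  show "k \<in> I \<Longrightarrow> l \<in> I \<Longrightarrow> p' k = p' l \<longleftrightarrow> k = l" using D(2) by (simp add: inj_on_eq_iff)
  show "k \<in> I \<Longrightarrow> l \<in> I \<Longrightarrow> p k \<noteq> p' l" using D(3) by blast
  show "k \<in> I \<Longrightarrow> l \<in> I \<Longrightarrow> p' k \<noteq> p l" using D(3) by fastforce
  show "k \<in> I \<Longrightarrow> p k \<in> P" using D(4) by blast
  show "k \<in> I \<Longrightarrow> p' k \<in> P" using D(5) by blast
qed

lemma disjoint_pairs_subset: "disjoint_pairs p p' I P \<Longrightarrow> I' \<subseteq> I \<Longrightarrow> disjoint_pairs p p' I' P"
  unfolding disjoint_pairs_def by (blast intro: inj_on_subset)

text \<open>For disjoint pairs the chosen index is unique, so the choice operator merely inverts p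
  or p'. The set B of swapped pairs is the one that \<open>sg\<close> reads as positive
  signs.\<close>

definition swap_pairs :: "('i \<Rightarrow> 'a) \<Rightarrow> ('i \<Rightarrow> 'a) \<Rightarrow> 'i set \<Rightarrow> 'a \<Rightarrow> 'a" where
  "swap_pairs p p' B q =
     (if \<exists>l\<in>B. q = p l then p' (SOME l. l \<in> B \<and> q = p l)
      else if \<exists>l\<in>B. q = p' l then p (SOME l. l \<in> B \<and> q = p' l) else q)"

context
  fixes p p' :: "'i \<Rightarrow> 'a" and I :: "'i set" and P :: "'a set" and B :: "'i set"
  assumes dp: "disjoint_pairs p p' I P" and BI: "B \<subseteq> I"
begin

lemma swap_pairs_fst: "l \<in> I \<Longrightarrow> swap_pairs p p' B (p l) = (if l \<in> B then p' l else p l)"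
proof -
  assume l: "l \<in> I"
  have e: "k \<in> B \<and> p l = p k \<longleftrightarrow> k = l \<and> l \<in> B" for k
    using disjoint_pairsD(1)[OF dp l, of k] BI by auto
  have n: "\<not> (\<exists>k\<in>B. p l = p' k)" using disjoint_pairsD(3)[OF dp l] BI by blast
  have "(\<exists>k\<in>B. p l = p k) \<longleftrightarrow> l \<in> B" using e by auto
  then show ?thesis unfolding swap_pairs_def e using n by auto
qed

lemma swap_pairs_snd: "l \<in> I \<Longrightarrow> swap_pairs p p' B (p' l) = (if l \<in> B then p l else p' l)"
proof -
  assume l: "l \<in> I"
  have e: "k \<in> B \<and> p' l = p' k \<longleftrightarrow> k = l \<and> l \<in> B" for k
    using disjoint_pairsD(2)[OF dp l, of k] BI by auto
  have n: "\<not> (\<exists>k\<in>B. p' l = p k)" using disjoint_pairsD(4)[OF dp l] BI by blast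
  have "(\<exists>k\<in>B. p' l = p' k) \<longleftrightarrow> l \<in> B" using e by auto
  then show ?thesis unfolding swap_pairs_def e using n by auto
qed

lemma swap_pairs_other: "q \<notin> p ` I \<Longrightarrow> q \<notin> p' ` I \<Longrightarrow> swap_pairs p p' B q = q"
  using BI unfolding swap_pairs_def by auto

lemma swap_pairs_permutes: "swap_pairs p p' B permutes P"
proof -
  have inv: "swap_pairs p p' B (swap_pairs p p' B q) = q" for q
  proof -
    consider l where "l \<in> I" "q = p l" | l where "l \<in> I" "q = p' l" | "q \<notin> p ` I" "q \<notin> p' ` I" by blast
    then show ?thesis
      by cases (simp_all add: swap_pairs_fst swap_pairs_snd swap_pairs_other)
  qed
  moreover have "swap_pairs p p' B q = q" if "q \<notin> P" for q
    using dp that unfolding disjoint_pairs_def by (intro swap_pairs_other) auto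
  ultimately show ?thesis unfolding permutes_def by metis
qed

text \<open>Each pair contributes its mean over the two arrangements plus or minus half their
  difference, and that half difference factors. Random swaps thus turn a linear statistic into a
  constant plus a Rademacher sum; the minus sign appears because \<open>sg\<close> is 1 on the
  swapped pairs.\<close>

lemma sum_swap_pairs:
  fixes c a :: "'a \<Rightarrow> real"
  assumes fin: "finite P"
  shows "(\<Sum>q\<in>P. c (swap_pairs p p' B q) * a q)
    = (\<Sum>q\<in>P - (p ` I \<union> p' ` I). c q * a q) + (\<Sum>l\<in>I. (c (p l) + c (p' l)) * (a (p l) + a (p' l)) / 2)
      + (\<Sum>l\<in>I. sg B l * (- ((c (p l) - c (p' l)) * (a (p l) - a (p' l)) / 2)))"
proof -
  let ?s = "swap_pairs p p' B" and ?C = "p ` I \<union> p' ` I"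
  have D: "inj_on p I" "inj_on p' I" "p ` I \<inter> p' ` I = {}" "?C \<subseteq> P" using dp unfolding disjoint_pairs_def by auto
  have fC: "finite ?C" using D fin finite_subset by blast
  have "(\<Sum>q\<in>P. c (?s q) * a q) = (\<Sum>q\<in>P - ?C. c (?s q) * a q) + (\<Sum>q\<in>?C. c (?s q) * a q)"
    by (rule sum.subset_diff[OF D(4) fin])
  also have "(\<Sum>q\<in>P - ?C. c (?s q) * a q) = (\<Sum>q\<in>P - ?C. c q * a q)"
    by (intro sum.cong) (auto simp: swap_pairs_other)
  also have "(\<Sum>q\<in>?C. c (?s q) * a q) = (\<Sum>q\<in>p ` I. c (?s q) * a q) + (\<Sum>q\<in>p' ` I. c (?s q) * a q)"
    using D fC by (intro sum.union_disjoint) auto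
  also have "\<dots> = (\<Sum>l\<in>I. c (?s (p l)) * a (p l) + c (?s (p' l)) * a (p' l))"
    using D by (simp add: sum.reindex sum.distrib o_def)
  also have "\<dots> = (\<Sum>l\<in>I. (c (p l) + c (p' l)) * (a (p l) + a (p' l)) / 2 + sg B l * (- ((c (p l) - c (p' l)) * (a (p l) - a (p' l)) / 2)))"
    by (intro sum.cong refl) (simp add: swap_pairs_fst swap_pairs_snd sg_def field_simps)
  finally show ?thesis by (simp only: sum.distrib add.assoc)
qed

end

text \<open>One pair at a time is exchanged with a uniformly random pair of positions outside all pairs.\<close>

lemma perms_prod_pairs_le:
  fixes y :: "'a \<Rightarrow> real" and f :: "real \<Rightarrow> real \<Rightarrow> real" and p p' :: "'i \<Rightarrow> 'a"
    and \<alpha> \<beta> \<kappa> :: real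
  assumes P: "finite P" and I: "finite I" and dp: "disjoint_pairs p p' I P"
    and f: "\<And>a b. 0 \<le> f a b" "\<And>a b. f a b \<le> 1" "\<And>a b. \<alpha> \<le> a \<Longrightarrow> b \<le> - \<alpha> \<Longrightarrow> f a b \<le> \<kappa>"
    and \<kappa>: "\<kappa> \<le> 1" and \<alpha>: "\<alpha> > 0" and \<beta>: "\<beta> > 0"
    and cnt: "\<beta> * card P \<le> card {q\<in>P. \<alpha> \<le> y q}" "\<beta> * card P \<le> card {q\<in>P. y q \<le> - \<alpha>}"
    and few: "4 * real (card I) \<le> \<beta> * card P"
  shows "avg (perms P) (\<lambda>\<pi>. \<Prod>l\<in>I. f (y (\<pi> (p l))) (y (\<pi> (p' l)))) \<le> (1 - (1 - \<kappa>) * \<beta>\<^sup>2 / 4) ^ card I"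
proof (cases "P = {}")
  case True
  then have "I = {}" using dp by (auto simp: disjoint_pairs_def)
  then show ?thesis using P by (simp add: avg_perms_const)
next
  case False
  define q where "q = 1 - (1 - \<kappa>) * \<beta>\<^sup>2 / 4"
  define C where "C = p ` I \<union> p' ` I"
  define R where "R = P - C"
  have D: "inj_on p I" "inj_on p' I" "p ` I \<inter> p' ` I = {}" "C \<subseteq> P" using dp unfolding disjoint_pairs_def C_def by auto
  have finC: "finite C" "finite R" using D P finite_subset by (auto simp: R_def)
  have cP: "real (card P) > 0" using False P by (simp add: card_gt_0_iff)
  \<comment> \<open>The positions used by the pairs are at most half of the guaranteed number of
    rich ones, so another half is always available in R for exchanges.\<close>
  have cC: "real (card C) \<le> \<beta> * card P / 2"
  proof -
    have "card C \<le> card (p ` I) + card (p' ` I)" unfolding C_def by (rule card_Un_le)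
    also have "\<dots> = 2 * card I" using D by (simp add: card_image)
    finally show ?thesis using few by linarith
  qed
  have rich: "\<beta> * card P / 2 \<le> card {r\<in>R. Q (\<pi> r)}" 
    if pi: "\<pi> permutes P" and Q: "\<beta> * card P \<le> card {q\<in>P. Q q}" for Q \<pi>
  proof -
    have "bij_betw \<pi> {r\<in>P. Q (\<pi> r)} {q\<in>P. Q q}"
      unfolding bij_betw_def
    proof
      show "inj_on \<pi> {r\<in>P. Q (\<pi> r)}" using permutes_inj[OF pi] by (rule inj_on_subset) simp
      show "\<pi> ` {r\<in>P. Q (\<pi> r)} = {q\<in>P. Q q}"
        using permutes_image[OF pi] by (auto simp: permutes_in_image[OF pi])
    qed
    then have "card {q\<in>P. Q q} = card {r\<in>P. Q (\<pi> r)}" by (simp add: bij_betw_same_card)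
    also have "\<dots> \<le> card ({r\<in>R. Q (\<pi> r)} \<union> C)"
      using finC by (intro card_mono) (auto simp: R_def)
    also have "\<dots> \<le> card {r\<in>R. Q (\<pi> r)} + card C" by (rule card_Un_le)
    finally show ?thesis using Q cC by linarith
  qed
  have "R \<noteq> {}"
  proof
    assume "R = {}"
    then have "\<beta> * card P / 2 \<le> 0" using rich[OF permutes_id cnt(1)] by simp
    moreover have "0 < \<beta> * card P" using \<beta> cP by (rule mult_pos_pos)
    ultimately show False by linarith
  qed
  \<comment> \<open>For two independent positions in R, the first carries a large and the second a
    small entry with probability at least (\<beta> / 2)^2. The diagonal r = r' gets the trivial
    value 1.\<close>
  have pair': "avg (R \<times> R) (\<lambda>t. case t of (r, r') \<Rightarrow> if r = r' then 1 else f (y (\<pi> r)) (y (\<pi> r'))) \<le> q" if pi: "\<pi> permutes P" for \<pi>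
  proof -
    define L where "L = {r\<in>R. \<alpha> \<le> y (\<pi> r)}"
    define S where "S = {r\<in>R. y (\<pi> r) \<le> - \<alpha>}"
    have cR: "0 < real (card R)" "real (card R) \<le> card P" using \<open>R \<noteq> {}\<close> finC P
      by (auto simp: card_gt_0_iff R_def intro!: card_mono)
    have "(\<beta> * card P / 2) * (\<beta> * card P / 2) \<le> real (card L) * real (card S)"
      unfolding L_def S_def using \<beta> cP by (intro mult_mono rich pi cnt) auto
    moreover have "(\<beta> * card R / 2) * (\<beta> * card R / 2) \<le> (\<beta> * card P / 2) * (\<beta> * card P / 2)"
      using \<beta> cR by (intro mult_mono divide_right_mono mult_left_mono) auto
    ultimately have "\<beta>\<^sup>2 / 4 * (real (card R))\<^sup>2 \<le> real (card L) * real (card S)"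
      by (simp add: power2_eq_square field_simps)
    then have key: "\<beta>\<^sup>2 / 4 \<le> real (card L) * real (card S) / (real (card R))\<^sup>2"
      using cR by (simp add: field_simps)
    have "avg (R \<times> R) (\<lambda>t. case t of (r, r') \<Rightarrow> if r = r' then 1 else f (y (\<pi> r)) (y (\<pi> r'))) \<le> avg (R \<times> R) (\<lambda>z. 1 + (- (1 - \<kappa>)) * of_bool (z \<in> L \<times> S))"
    proof (rule avg_mono)
      fix z assume "z \<in> R \<times> R"
      then obtain r r' where z: "z = (r, r')" "r \<in> R" "r' \<in> R" by auto
      show "(case z of (r, r') \<Rightarrow> if r = r' then 1 else f (y (\<pi> r)) (y (\<pi> r'))) \<le> 1 + (- (1 - \<kappa>)) * of_bool (z \<in> L \<times> S)"
      proof (cases "z \<in> L \<times> S")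
        case True
        then have "\<alpha> \<le> y (\<pi> r)" "y (\<pi> r') \<le> - \<alpha>" by (auto simp: z L_def S_def)
        then have "r \<noteq> r'" "f (y (\<pi> r)) (y (\<pi> r')) \<le> \<kappa>" using \<alpha> f(3) by auto
        then show ?thesis using True by (simp add: z)
      next
        case False
        then have e: "of_bool (z \<in> L \<times> S) = (0 :: real)" by simp
        show ?thesis unfolding e using f(2) by (simp add: z)
      qed
    qed
    also have "\<dots> = 1 - (1 - \<kappa>) * (real (card L) * real (card S) / (real (card R))\<^sup>2)"
    proof -
      have "R \<times> R \<inter> L \<times> S = L \<times> S" by (auto simp: L_def S_def)
      then have "avg (R \<times> R) (\<lambda>z. of_bool (z \<in> L \<times> S)) = real (card (L \<times> S)) / real (card (R \<times> R))"
        unfolding avg_def using finC by (simp add: of_bool_def sum.If_cases Int_def)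
      also have "\<dots> = real (card L) * real (card S) / (real (card R))\<^sup>2"
        by (simp add: card_cartesian_product power2_eq_square)
      finally have e: "avg (R \<times> R) (\<lambda>z. of_bool (z \<in> L \<times> S)) = real (card L) * real (card S) / (real (card R))\<^sup>2" .
      have "avg (R \<times> R) (\<lambda>z. 1) = 1" using finC \<open>R \<noteq> {}\<close> by (simp add: avg_const)
      then show ?thesis unfolding avg_add avg_cmult e by (simp only: mult_minus_left diff_conv_add_uminus)
    qed
    also have "\<dots> \<le> q"
      unfolding q_def using mult_left_mono[OF key, of "1 - \<kappa>"] \<kappa> by simp
    finally show ?thesis .
  qed
  have q0: "0 \<le> q"
  proof -
    have "0 \<le> avg (R \<times> R) (\<lambda>t. case t of (r, r') \<Rightarrow> if r = r' then 1 else f (y (id r)) (y (id r')))"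
      using f(1) by (intro avg_nonneg) auto
    then show ?thesis using pair'[OF permutes_id] by linarith
  qed
  have "avg (perms P) (\<lambda>\<pi>. \<Prod>l\<in>I'. f (y (\<pi> (p l))) (y (\<pi> (p' l)))) \<le> q ^ card I'" if "I' \<subseteq> I" for I'
    using finite_subset[OF that I] that
  proof (induction I' rule: finite_induct)
    case empty
    then show ?case using P by (simp add: avg_perms_const)
  next
    case (insert l I')
    then have l: "l \<in> I" "I' \<subseteq> I" "l \<notin> I'" by auto
    note dpD = disjoint_pairsD[OF dp]
    \<comment> \<open>For r = r' this sends \<open>p' l\<close> to \<open>p l\<close> and not to r',
      which is why the diagonal was set aside. All other pairs stay fixed because r and r' avoid
      them.\<close>
    define \<tau> where "\<tau> = (\<lambda>(r, r'). Transposition.transpose (p l) r \<circ> Transposition.transpose (p' l) r')"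
    have nR: "r \<noteq> p k" "r \<noteq> p' k" if "r \<in> R" "k \<in> I" for r k using that by (auto simp: R_def C_def)
    have "avg (perms P) (\<lambda>\<pi>. \<Prod>k\<in>insert l I'. f (y (\<pi> (p k))) (y (\<pi> (p' k))))
       \<le> avg (perms P) (\<lambda>\<pi>. q * (\<Prod>k\<in>I'. f (y (\<pi> (p k))) (y (\<pi> (p' k)))))"
    proof (rule avg_perms_exchange_le[where T = "R \<times> R" and \<tau> = \<tau>])
      show "finite (R \<times> R)" "R \<times> R \<noteq> {}" using finC \<open>R \<noteq> {}\<close> by auto
      show "\<tau> t permutes P" if "t \<in> R \<times> R" for t
        using that dpD(5,6)[OF l(1)] unfolding \<tau>_def
        by (auto simp: R_def intro!: permutes_compose permutes_swap_id)
      fix \<pi> assume pi: "\<pi> permutes P"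
      define F where "F = (\<Prod>k\<in>I'. f (y (\<pi> (p k))) (y (\<pi> (p' k))))"
      have F0: "0 \<le> F" unfolding F_def using f by (intro prod_nonneg) auto
      have "avg (R \<times> R) (\<lambda>t. \<Prod>k\<in>insert l I'. f (y ((\<pi> \<circ> \<tau> t) (p k))) (y ((\<pi> \<circ> \<tau> t) (p' k))))
        \<le> avg (R \<times> R) (\<lambda>t. F * (case t of (r, r') \<Rightarrow> if r = r' then 1 else f (y (\<pi> r)) (y (\<pi> r'))))"
      proof (rule avg_mono)
        fix t assume "t \<in> R \<times> R"
        then obtain r r' where t: "t = (r, r')" "r \<in> R" "r' \<in> R" by auto
        have fix1: "\<tau> t (p k) = p k" "\<tau> t (p' k) = p' k" if "k \<in> I'" for k
        proof -
          have k: "k \<in> I" "k \<noteq> l" using that l by auto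
          show "\<tau> t (p k) = p k" "\<tau> t (p' k) = p' k"
            using nR[OF t(2) k(1)] nR[OF t(3) k(1)] dpD(1-4)[OF k(1) l(1)] k
            unfolding \<tau>_def t by (auto simp: Transposition.transpose_def)
        qed
        have sw: "\<tau> t (p l) = r" "\<tau> t (p' l) = r'" if "r \<noteq> r'"
          using nR[OF t(2) l(1)] nR[OF t(3) l(1)] dpD(3)[OF l(1) l(1)] that
          unfolding \<tau>_def t by (auto simp: Transposition.transpose_def)
        have "(\<Prod>k\<in>insert l I'. f (y ((\<pi> \<circ> \<tau> t) (p k))) (y ((\<pi> \<circ> \<tau> t) (p' k))))
          = f (y (\<pi> (\<tau> t (p l)))) (y (\<pi> (\<tau> t (p' l)))) * F"
          using insert(1,2) fix1 unfolding F_def by simp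
        also have "\<dots> \<le> (if r = r' then 1 else f (y (\<pi> r)) (y (\<pi> r'))) * F"
          using sw f(2) F0 by (intro mult_right_mono) auto
        finally show "(\<Prod>k\<in>insert l I'. f (y ((\<pi> \<circ> \<tau> t) (p k))) (y ((\<pi> \<circ> \<tau> t) (p' k))))
          \<le> F * (case t of (r, r') \<Rightarrow> if r = r' then 1 else f (y (\<pi> r)) (y (\<pi> r')))"
          unfolding t by (simp add: mult.commute)
      qed
      also have "\<dots> \<le> F * q"
        unfolding avg_cmult using pair'[OF pi] F0 by (intro mult_left_mono) auto
      finally show "avg (R \<times> R) (\<lambda>t. \<Prod>k\<in>insert l I'. f (y ((\<pi> \<circ> \<tau> t) (p k))) (y ((\<pi> \<circ> \<tau> t) (p' k)))) \<le> q * F"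
        by (simp add: mult.commute)
    qed
    also have "\<dots> \<le> q * q ^ card I'"
      unfolding avg_cmult using insert l q0 by (intro mult_left_mono) auto
    finally show ?case using insert by simp
  qed
  then show ?thesis unfolding q_def by blast
qed

lemma exp_neg_le_inverse_sqrt: "exp (- x) \<le> 1 / sqrt x" if "x > 0" for x :: real
proof -
  have "sqrt x \<le> 1 + x" using that by (intro real_le_lsqrt) (auto simp: power2_eq_square algebra_simps)
  also have "\<dots> \<le> exp x" by (rule exp_ge_add_one_self)
  finally show ?thesis using that by (simp add: exp_minus field_simps)
qed

section \<open>Small ball estimates from swaps in one row\<close>

text \<open>Half of the loss per pair in \<open>perms_prod_pairs_le\<close> with \<kappa> = exp
  (-1); the other half pays for the Chernoff factor when many good pairs are demanded.\<close>

definition swap_rate :: "real \<Rightarrow> real" where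
  "swap_rate \<beta> = (1 - exp (- 1)) * \<beta>\<^sup>2 / 8"

lemma swap_rate_pos: "\<beta> > 0 \<Longrightarrow> swap_rate \<beta> > 0"
  by (simp add: swap_rate_def)

text \<open>The randomness is used twice. The permutation decides which pairs carry entries at least
  2 * \<alpha> apart, and a Chernoff bound makes these a positive proportion; swaps within pairs
  then give a signed sum whose coefficients on the good pairs are at least \<alpha> * h, and
  Littlewood-Offord applies.\<close>

lemma small_ball_real:
  fixes y a :: "'a \<Rightarrow> real" and p p' :: "'i \<Rightarrow> 'a" and \<alpha> \<beta> h \<epsilon> :: real
  assumes J: "finite J" and I: "finite I" "I \<noteq> {}" and dp: "disjoint_pairs p p' I J"
    and \<alpha>: "\<alpha> > 0" and \<beta>: "\<beta> > 0" and h: "h > 0" and e: "\<epsilon> \<ge> 0"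
    and cnt: "\<beta> * card J \<le> card {q\<in>J. \<alpha> \<le> y q}" "\<beta> * card J \<le> card {q\<in>J. y q \<le> - \<alpha>}"
    and few: "4 * real (card I) \<le> \<beta> * card J"
    and sep: "\<And>l. l \<in> I \<Longrightarrow> h \<le> \<bar>a (p l) - a (p' l)\<bar>"
  shows "avg (perms J) (\<lambda>\<tau>. of_bool (\<bar>(\<Sum>j\<in>J. y (\<tau> j) * a j) + t\<bar> \<le> \<epsilon>))
    \<le> 5 * (\<epsilon> / (\<alpha> * h) + 1) / sqrt (swap_rate \<beta> * card I)"
proof -
  define \<eta> where "\<eta> = swap_rate \<beta>"
  define m where "m = real (card I)"
  have \<eta>: "\<eta> > 0" using \<beta> by (simp add: \<eta>_def swap_rate_pos)
  have m: "m > 0" using I by (simp add: m_def card_gt_0_iff)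
  define G where "G = (\<lambda>\<tau>. {l\<in>I. 2 * \<alpha> \<le> \<bar>y (\<tau> (p l)) - y (\<tau> (p' l))\<bar>})"
  define f where "f = (\<lambda>b c. exp (- of_bool (2 * \<alpha> \<le> \<bar>b - c\<bar>)) :: real)"
  have GI: "G \<tau> \<subseteq> I" for \<tau> by (auto simp: G_def)
  have few_good: "avg (perms J) (\<lambda>\<tau>. of_bool (card (G \<tau>) \<le> \<eta> * m)) \<le> exp (- \<eta> * m)"
  proof -
    have "avg (perms J) (\<lambda>\<tau>. of_bool (card (G \<tau>) \<le> \<eta> * m))
      \<le> avg (perms J) (\<lambda>\<tau>. exp (\<eta> * m) * (\<Prod>l\<in>I. f (y (\<tau> (p l))) (y (\<tau> (p' l)))))"
    proof (rule avg_mono)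
      fix \<tau>
      have "(\<Prod>l\<in>I. f (y (\<tau> (p l))) (y (\<tau> (p' l)))) = exp (- (\<Sum>l\<in>I. of_bool (l \<in> G \<tau>)))"
        unfolding f_def using I(1) by (simp add: exp_sum[symmetric] sum_negf G_def)
      also have "(\<Sum>l\<in>I. of_bool (l \<in> G \<tau>) :: real) = card (G \<tau>)"
        using I(1) GI[of \<tau>] by (simp add: of_bool_def sum.If_cases Int_absorb1)
      finally have pe: "(\<Prod>l\<in>I. f (y (\<tau> (p l))) (y (\<tau> (p' l)))) = exp (- real (card (G \<tau>)))" .
      have "exp (\<eta> * m) * (\<Prod>l\<in>I. f (y (\<tau> (p l))) (y (\<tau> (p' l)))) = exp (\<eta> * m - card (G \<tau>))"
        unfolding pe exp_add[symmetric] by simp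
      then show "of_bool (card (G \<tau>) \<le> \<eta> * m) \<le> exp (\<eta> * m) * (\<Prod>l\<in>I. f (y (\<tau> (p l))) (y (\<tau> (p' l))))"
        by simp
    qed
    also have "\<dots> \<le> exp (\<eta> * m) * (1 - (1 - exp (- 1)) * \<beta>\<^sup>2 / 4) ^ card I"
      unfolding avg_cmult using J I dp \<alpha> \<beta> cnt few
      by (intro mult_left_mono perms_prod_pairs_le[where \<alpha> = \<alpha>]) (auto simp: f_def)
    also have "1 - (1 - exp (- 1)) * \<beta>\<^sup>2 / 4 = 1 - 2 * \<eta>" by (simp add: \<eta>_def swap_rate_def)
    also have "exp (\<eta> * m) * (1 - 2 * \<eta>) ^ card I \<le> exp (\<eta> * m) * exp (- 2 * \<eta>) ^ card I"
    proof (intro mult_left_mono power_mono)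
      show "1 - 2 * \<eta> \<le> exp (- 2 * \<eta>)" using exp_ge_add_one_self[of "- 2 * \<eta>"] by simp
      \<comment> \<open>Raising to a power is monotone only for a nonnegative base; it is
        nonnegative because \<beta> bounds a proportion from below, so \<beta> \<le> 1.\<close>
      have "real (card {q\<in>J. \<alpha> \<le> y q}) \<le> card J" using J by (auto intro!: card_mono)
      moreover have cJ: "0 < real (card J)"
      proof (rule ccontr)
        assume "\<not> 0 < real (card J)"
        then have "real (card J) = 0" by linarith
        then show False using few m by (simp add: m_def)
      qed
      ultimately have "\<beta> * real (card J) \<le> 1 * real (card J)" using cnt(1) by linarith
      then have "\<beta> \<le> 1" using cJ by (rule mult_right_le_imp_le)
      then have "\<beta>\<^sup>2 \<le> 1" using \<beta> by (simp add: power_le_one)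
      then have "(1 - exp (- 1)) * \<beta>\<^sup>2 \<le> 1 * 1" by (intro mult_mono) auto
      then show "0 \<le> 1 - 2 * \<eta>" by (simp add: \<eta>_def swap_rate_def)
    qed auto
    also have "\<dots> = exp (- \<eta> * m)"
      unfolding m_def exp_of_nat_mult[symmetric] exp_add[symmetric] by (simp add: algebra_simps)
    finally show ?thesis .
  qed
  have many_good: "avg (perms J) (\<lambda>\<tau>. of_bool (\<bar>(\<Sum>j\<in>J. y (\<tau> j) * a j) + t\<bar> \<le> \<epsilon> \<and> \<eta> * m < card (G \<tau>)))
    \<le> avg (perms J) (\<lambda>\<tau>. 4 * (\<epsilon> / (\<alpha> * h) + 1) / sqrt (\<eta> * m))"
  proof (rule avg_perms_exchange_le[where T = "Pow I" and \<tau> = "swap_pairs p p'"])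
    show "finite (Pow I)" "Pow I \<noteq> {}" using I by auto
    show "swap_pairs p p' B permutes J" if "B \<in> Pow I" for B
      using swap_pairs_permutes[OF dp] that by auto
    fix \<pi> assume pi: "\<pi> permutes J"
    define b where "b = (\<lambda>l. - ((y (\<pi> (p l)) - y (\<pi> (p' l))) * (a (p l) - a (p' l)) / 2))"
    define k where "k = (\<Sum>q\<in>J - (p ` I \<union> p' ` I). y (\<pi> q) * a q)
       + (\<Sum>l\<in>I. (y (\<pi> (p l)) + y (\<pi> (p' l))) * (a (p l) + a (p' l)) / 2)"
    \<comment> \<open>The gap is symmetric in the two positions of a pair, so the swaps cannot
      change which pairs are good; the event about G may be conditioned on.\<close>
    have G_inv: "G (\<pi> \<circ> swap_pairs p p' B) = G \<pi>" if "B \<in> Pow I" for B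
      unfolding G_def using swap_pairs_fst[OF dp, of B] swap_pairs_snd[OF dp, of B] that
      by (intro Collect_cong) (auto simp: abs_minus_commute split: if_splits)
    have S: "(\<Sum>j\<in>J. y ((\<pi> \<circ> swap_pairs p p' B) j) * a j) = k + (\<Sum>l\<in>I. sg B l * b l)" if "B \<in> Pow I" for B
      using sum_swap_pairs[OF dp _ J, of B "\<lambda>q. y (\<pi> q)" a] that unfolding k_def b_def by simp
    have "avg (Pow I) (\<lambda>B. of_bool (\<bar>(\<Sum>j\<in>J. y ((\<pi> \<circ> swap_pairs p p' B) j) * a j) + t\<bar> \<le> \<epsilon>
        \<and> \<eta> * m < card (G (\<pi> \<circ> swap_pairs p p' B))))
      = avg (Pow I) (\<lambda>B. of_bool (\<bar>(\<Sum>l\<in>I. sg B l * b l) + (k + t)\<bar> \<le> \<epsilon> \<and> \<eta> * m < card (G \<pi>)))"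
      by (intro avg_cong) (simp only: G_inv S add_ac)
    also have "\<dots> \<le> 4 * (\<epsilon> / (\<alpha> * h) + 1) / sqrt (\<eta> * m)"
    proof (cases "\<eta> * m < card (G \<pi>)")
      case True
      have "0 < \<eta> * m" using \<eta> m by simp
      then have "G \<pi> \<noteq> {}" using True by (metis card.empty of_nat_0 order.asym)
      have "avg (Pow I) (\<lambda>B. of_bool (\<bar>(\<Sum>l\<in>I. sg B l * b l) + (k + t)\<bar> \<le> \<epsilon>)) \<le> 4 * (\<epsilon> / (\<alpha> * h) + 1) / sqrt (real (card (G \<pi>)))"
      proof (rule Littlewood_Offord[OF I(1) GI \<open>G \<pi> \<noteq> {}\<close>])
        fix l assume l: "l \<in> G \<pi>"
        have "2 * \<alpha> * h \<le> \<bar>y (\<pi> (p l)) - y (\<pi> (p' l))\<bar> * \<bar>a (p l) - a (p' l)\<bar>"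
          using l \<alpha> h sep by (intro mult_mono) (auto simp: G_def)
        then show "\<alpha> * h \<le> \<bar>b l\<bar>" unfolding b_def by (simp add: abs_mult)
      qed (use \<alpha> h e in auto)
      also have "\<dots> \<le> 4 * (\<epsilon> / (\<alpha> * h) + 1) / sqrt (\<eta> * m)"
        using True \<open>0 < \<eta> * m\<close> \<alpha> h e by (intro divide_left_mono) (auto intro!: mult_pos_pos)
      finally show ?thesis using True by simp
    next
      case False
      then show ?thesis using \<alpha> h e \<eta> m I by (simp add: avg_Pow_const)
    qed
    finally show "avg (Pow I) (\<lambda>B. of_bool (\<bar>(\<Sum>j\<in>J. y ((\<pi> \<circ> swap_pairs p p' B) j) * a j) + t\<bar> \<le> \<epsilon>
        \<and> \<eta> * m < card (G (\<pi> \<circ> swap_pairs p p' B)))) \<le> 4 * (\<epsilon> / (\<alpha> * h) + 1) / sqrt (\<eta> * m)" .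
  qed
  have "avg (perms J) (\<lambda>\<tau>. of_bool (\<bar>(\<Sum>j\<in>J. y (\<tau> j) * a j) + t\<bar> \<le> \<epsilon>))
    \<le> avg (perms J) (\<lambda>\<tau>. of_bool (card (G \<tau>) \<le> \<eta> * m) + of_bool (\<bar>(\<Sum>j\<in>J. y (\<tau> j) * a j) + t\<bar> \<le> \<epsilon> \<and> \<eta> * m < card (G \<tau>)))"
    by (rule avg_mono) auto
  also have "\<dots> \<le> exp (- (\<eta> * m)) + 4 * (\<epsilon> / (\<alpha> * h) + 1) / sqrt (\<eta> * m)"
    unfolding avg_add using few_good many_good J by (simp add: avg_perms_const)
  also have "\<dots> \<le> 1 / sqrt (\<eta> * m) + 4 * (\<epsilon> / (\<alpha> * h) + 1) / sqrt (\<eta> * m)"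
    using exp_neg_le_inverse_sqrt[of "\<eta> * m"] \<eta> m by simp
  also have "\<dots> = (1 + 4 * (\<epsilon> / (\<alpha> * h) + 1)) / sqrt (\<eta> * m)" by (simp add: add_divide_distrib)
  also have "\<dots> \<le> 5 * (\<epsilon> / (\<alpha> * h) + 1) / sqrt (\<eta> * m)"
  proof (rule divide_right_mono)
    have R: "1 + 4 * (r + 1) \<le> 5 * (r + 1)" if "0 \<le> r" for r :: real using that by (simp add: distrib_left)
    show "1 + 4 * (\<epsilon> / (\<alpha> * h) + 1) \<le> 5 * (\<epsilon> / (\<alpha> * h) + 1)" by (rule R) (use \<alpha> h e in simp)
  qed (use \<eta> m in simp)
  finally show ?thesis unfolding \<eta>_def m_def .
qed

text \<open>For at least half of the pairs the real parts, or for at least half the imaginary parts,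
  differ by h / 2. One real coordinate therefore suffices, at the price of halving both h and the
  number of pairs.\<close>

lemma small_ball_complex:
  fixes y :: "'a \<Rightarrow> real" and u :: "'a \<Rightarrow> complex" and p p' :: "'i \<Rightarrow> 'a"
    and \<alpha> \<beta> h \<epsilon> :: real
  assumes J: "finite J" and I: "finite I" "I \<noteq> {}" and dp: "disjoint_pairs p p' I J"
    and \<alpha>: "\<alpha> > 0" and \<beta>: "\<beta> > 0" and h: "h > 0" and e: "\<epsilon> \<ge> 0"
    and cnt: "\<beta> * card J \<le> card {q\<in>J. \<alpha> \<le> y q}" "\<beta> * card J \<le> card {q\<in>J. y q \<le> - \<alpha>}"
    and few: "4 * real (card I) \<le> \<beta> * card J"
    and sep: "\<And>l. l \<in> I \<Longrightarrow> h \<le> cmod (u (p l) - u (p' l))"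
  shows "avg (perms J) (\<lambda>\<tau>. of_bool (cmod ((\<Sum>j\<in>J. of_real (y (\<tau> j)) * u j) + t) \<le> \<epsilon>))
    \<le> 5 * (2 * \<epsilon> / (\<alpha> * h) + 1) / sqrt (swap_rate \<beta> * card I / 2)"
proof -
  define I1 where "I1 = {l\<in>I. h / 2 \<le> \<bar>Re (u (p l)) - Re (u (p' l))\<bar>}"
  define I2 where "I2 = {l\<in>I. h / 2 \<le> \<bar>Im (u (p l)) - Im (u (p' l))\<bar>}"
  have "I \<subseteq> I1 \<union> I2"
  proof
    fix l assume l: "l \<in> I"
    have "h \<le> \<bar>Re (u (p l) - u (p' l))\<bar> + \<bar>Im (u (p l) - u (p' l))\<bar>"
      using sep[OF l] cmod_le[of "u (p l) - u (p' l)"] by linarith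
    then show "l \<in> I1 \<union> I2" using l by (auto simp: I1_def I2_def)
  qed
  then have "card I \<le> card (I1 \<union> I2)" using I by (intro card_mono) (auto simp: I1_def I2_def)
  also have "\<dots> \<le> card I1 + card I2" by (rule card_Un_le)
  finally have half: "card I \<le> 2 * card I1 \<or> card I \<le> 2 * card I2" by linarith
  have main: "avg (perms J) (\<lambda>\<tau>. of_bool (cmod ((\<Sum>j\<in>J. of_real (y (\<tau> j)) * u j) + t) \<le> \<epsilon>))
    \<le> 5 * (2 * \<epsilon> / (\<alpha> * h) + 1) / sqrt (swap_rate \<beta> * card I / 2)"
    if K: "K \<subseteq> I" "card I \<le> 2 * card K" "\<And>l. l \<in> K \<Longrightarrow> h / 2 \<le> \<bar>a (p l) - a (p' l)\<bar>"
      and F: "\<And>\<tau>. \<bar>(\<Sum>j\<in>J. y (\<tau> j) * a j) + s\<bar> \<le> cmod ((\<Sum>j\<in>J. of_real (y (\<tau> j)) * u j) + t)" for K a s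
  proof -
    have "K \<noteq> {}" "finite K" using K I finite_subset by auto
    have cK: "0 < real (card I)" "real (card I) / 2 \<le> real (card K)" "real (card K) \<le> card I"
      using K I by (auto simp: card_gt_0_iff intro!: card_mono)
    have "avg (perms J) (\<lambda>\<tau>. of_bool (cmod ((\<Sum>j\<in>J. of_real (y (\<tau> j)) * u j) + t) \<le> \<epsilon>))
      \<le> avg (perms J) (\<lambda>\<tau>. of_bool (\<bar>(\<Sum>j\<in>J. y (\<tau> j) * a j) + s\<bar> \<le> \<epsilon>))"
      using F order_trans by (intro avg_mono) (auto simp: of_bool_def)
    also have "\<dots> \<le> 5 * (\<epsilon> / (\<alpha> * (h / 2)) + 1) / sqrt (swap_rate \<beta> * card K)"
      using \<open>K \<noteq> {}\<close> \<open>finite K\<close> \<alpha> \<beta> h e cnt few K cK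
      by (intro small_ball_real[OF J _ _ disjoint_pairs_subset[OF dp K(1)]]) auto
    also have "\<dots> \<le> 5 * (\<epsilon> / (\<alpha> * (h / 2)) + 1) / sqrt (swap_rate \<beta> * card I / 2)"
    proof (rule divide_left_mono)
      have "swap_rate \<beta> * (card I / 2) \<le> swap_rate \<beta> * card K"
        using cK swap_rate_pos[OF \<beta>] by (intro mult_left_mono) auto
      then show "sqrt (swap_rate \<beta> * card I / 2) \<le> sqrt (swap_rate \<beta> * card K)" by simp
      show "0 < sqrt (swap_rate \<beta> * card K) * sqrt (swap_rate \<beta> * card I / 2)"
        using cK swap_rate_pos[OF \<beta>] by simp
    qed (use \<alpha> h e in auto)
    finally show ?thesis by (simp add: field_simps)
  qed
  from half show ?thesis
  proof
    assume "card I \<le> 2 * card I1"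
    then show ?thesis
    proof (rule main[where a = "\<lambda>j. Re (u j)" and s = "Re t", rotated])
      fix \<tau>
      show "\<bar>(\<Sum>j\<in>J. y (\<tau> j) * Re (u j)) + Re t\<bar> \<le> cmod ((\<Sum>j\<in>J. of_real (y (\<tau> j)) * u j) + t)"
        using abs_Re_le_cmod[of "(\<Sum>j\<in>J. of_real (y (\<tau> j)) * u j) + t"] by simp
    qed (auto simp: I1_def)
  next
    assume "card I \<le> 2 * card I2"
    then show ?thesis
    proof (rule main[where a = "\<lambda>j. Im (u j)" and s = "Im t", rotated])
      fix \<tau>
      show "\<bar>(\<Sum>j\<in>J. y (\<tau> j) * Im (u j)) + Im t\<bar> \<le> cmod ((\<Sum>j\<in>J. of_real (y (\<tau> j)) * u j) + t)"
        using abs_Im_le_cmod[of "(\<Sum>j\<in>J. of_real (y (\<tau> j)) * u j) + t"] by simp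
    qed (auto simp: I2_def)
  qed
qed

section \<open>A single vector\<close>

text \<open>Jensen's inequality from the tangent of exp at the weighted mean. It later reduces a
  weighted sum over columns to single columns.\<close>

lemma exp_weighted_sum_le:
  fixes w y :: "'a \<Rightarrow> real"
  assumes w: "\<And>j. j \<in> J \<Longrightarrow> 0 \<le> w j" "(\<Sum>j\<in>J. w j) = 1"
  shows "exp (\<Sum>j\<in>J. w j * y j) \<le> (\<Sum>j\<in>J. w j * exp (y j))"
proof -
  define m where "m = (\<Sum>j\<in>J. w j * y j)"
  have "exp m = (\<Sum>j\<in>J. w j * (exp m * (1 + y j - m)))"
  proof -
    have "(\<Sum>j\<in>J. w j * (exp m * (1 + y j - m))) = exp m * ((1 - m) * (\<Sum>j\<in>J. w j) + (\<Sum>j\<in>J. w j * y j))"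
      unfolding sum_distrib_left sum.distrib[symmetric] by (intro sum.cong) (simp_all add: algebra_simps)
    then show ?thesis using w(2) by (simp add: m_def)
  qed
  also have "\<dots> \<le> (\<Sum>j\<in>J. w j * exp (y j))"
  proof (intro sum_mono mult_left_mono w)
    fix j
    have "exp m * (1 + y j - m) \<le> exp m * exp (y j - m)"
      by (intro mult_left_mono) (use exp_ge_add_one_self[of "y j - m"] in linarith, simp)
    then show "exp m * (1 + y j - m) \<le> exp (y j)" by (simp flip: exp_add)
  qed
  finally show ?thesis unfolding m_def .
qed

lemma finite_mat_positions [simp]: "finite (mat_positions n)"
  by (simp add: mat_positions_def)

lemma card_mat_positions [simp]: "card (mat_positions n) = n\<^sup>2"
  by (simp add: mat_positions_def power2_eq_square)

lemma mem_mat_positions [simp]: "(i, j) \<in> mat_positions n \<longleftrightarrow> i < n \<and> j < n"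
  by (simp add: mat_positions_def)

definition spread :: "real \<Rightarrow> real \<Rightarrow> 'a set \<Rightarrow> ('a \<Rightarrow> real) \<Rightarrow> bool" where
  "spread \<alpha> \<beta> P y \<longleftrightarrow>
     \<beta> * card P \<le> card {q\<in>P. \<alpha> \<le> y q} \<and> \<beta> * card P \<le> card {q\<in>P. y q \<le> - \<alpha>}"

text \<open>The loss per pair of rows in \<open>perms_prod_pairs_le\<close> when an entry difference
  d contributes exp (- c * d^2) and |d| \<ge> 2 * \<alpha>, with c = 1 / (768 * K^2) as in
  \<open>single_vector_small_ball\<close>.\<close>

definition row_rate :: "real \<Rightarrow> real \<Rightarrow> real \<Rightarrow> real" where
  "row_rate K \<alpha> \<beta> = (1 - exp (- (\<alpha>\<^sup>2 / (192 * K\<^sup>2)))) * \<beta>\<^sup>2 / 4"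

lemma row_rate_pos: "K > 0 \<Longrightarrow> \<alpha> > 0 \<Longrightarrow> \<beta> > 0 \<Longrightarrow> row_rate K \<alpha> \<beta> > 0"
  by (simp add: row_rate_def)

text \<open>Row l of the upper half is paired with row l + m, and random swaps of the two entries in
  each column make the product of row l with a Rademacher sum. The rows are treated one after the
  other: the swaps for l leave every factor belonging to another pair of rows untouched.\<close>

lemma avg_row_products_le:
  fixes x :: "nat \<times> nat \<Rightarrow> real" and a t :: "nat \<Rightarrow> real" and \<theta> :: real
  assumes \<theta>: "\<theta> \<ge> 0" "\<theta> * (K\<^sup>2 * (\<Sum>j<n. (a j)\<^sup>2)) \<le> 1/3"
    and xK: "\<And>q. q \<in> mat_positions n \<Longrightarrow> \<bar>x q\<bar> \<le> K"
    and m: "2 * m \<le> n" and I: "I \<subseteq> {..<m}"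
  shows "avg (perms (mat_positions n)) (\<lambda>\<pi>. \<Prod>l\<in>I. exp (- \<theta> * ((\<Sum>j<n. x (\<pi> (l, j)) * a j) - t l)\<^sup>2))
    \<le> avg (perms (mat_positions n)) (\<lambda>\<pi>. \<Prod>l\<in>I. exp (- \<theta> / 2 * (\<Sum>j<n. ((x (\<pi> (l, j)) - x (\<pi> (l + m, j))) / 2 * a j)\<^sup>2)))"
proof -
  define P where "P = mat_positions n"
  define g where "g = (\<lambda>l \<pi>. exp (- \<theta> * ((\<Sum>j<n. x (\<pi> (l, j)) * a j) - t l)\<^sup>2))"
  define f where "f = (\<lambda>l \<pi>. exp (- \<theta> / 2 * (\<Sum>j<n. ((x (\<pi> (l, j)) - x (\<pi> (l + m, j))) / 2 * a j)\<^sup>2)))"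
  have finP: "finite P" by (simp add: P_def)
  have finI: "finite I" using I finite_subset by blast
  have "avg (perms P) (\<lambda>\<pi>. \<Prod>l\<in>I. g l \<pi>) \<le> avg (perms P) (\<lambda>\<pi>. (\<Prod>l\<in>I'. f l \<pi>) * (\<Prod>l\<in>I - I'. g l \<pi>))" if "I' \<subseteq> I" for I'
    using finite_subset[OF that finI] that
  proof (induction I' rule: finite_induct)
    case (insert l I')
    then have l: "l \<in> I" "l \<notin> I'" "I' \<subseteq> I" by auto
    then have lm: "l < m" using I by auto
    define p p' where "p = (\<lambda>j. (l, j) :: nat \<times> nat)" and "p' = (\<lambda>j. (l + m, j) :: nat \<times> nat)"
    have dp: "disjoint_pairs p p' {..<n} P"
      using lm m unfolding disjoint_pairs_def p_def p'_def P_def by (auto simp: inj_on_def)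
    define H where "H = (\<lambda>\<pi>. (\<Prod>l\<in>I'. f l \<pi>) * (\<Prod>l\<in>I - insert l I'. g l \<pi>))"
    have H0: "0 \<le> H \<pi>" for \<pi> unfolding H_def f_def g_def by (intro mult_nonneg_nonneg prod_nonneg) auto
    have "avg (perms P) (\<lambda>\<pi>. \<Prod>l\<in>I. g l \<pi>) \<le> avg (perms P) (\<lambda>\<pi>. (\<Prod>l\<in>I'. f l \<pi>) * (\<Prod>l\<in>I - I'. g l \<pi>))"
      using insert l by blast
    also have "\<dots> = avg (perms P) (\<lambda>\<pi>. H \<pi> * g l \<pi>)"
    proof (intro avg_cong)
      fix \<pi>
      have "(\<Prod>l\<in>I - I'. g l \<pi>) = g l \<pi> * (\<Prod>l\<in>(I - I') - {l}. g l \<pi>)"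
        using l finI by (intro prod.remove) auto
      then show "(\<Prod>l\<in>I'. f l \<pi>) * (\<Prod>l\<in>I - I'. g l \<pi>) = H \<pi> * g l \<pi>"
        unfolding H_def by (simp add: Diff_insert[symmetric] Diff_insert2[symmetric] mult.commute mult.left_commute)
    qed
    also have "\<dots> \<le> avg (perms P) (\<lambda>\<pi>. H \<pi> * f l \<pi>)"
    proof (rule avg_perms_exchange_le[where T = "Pow {..<n}" and \<tau> = "swap_pairs p p'"])
      show "finite (Pow {..<n})" "Pow {..<n} \<noteq> {}" by auto
      show "swap_pairs p p' B permutes P" if "B \<in> Pow {..<n}" for B
        using swap_pairs_permutes[OF dp] that by auto
      fix \<pi> assume pi: "\<pi> permutes P"
      have other: "swap_pairs p p' B (k, j) = (k, j)" if "B \<in> Pow {..<n}" "k \<noteq> l" "k \<noteq> l + m" for B k j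
        using swap_pairs_other[OF dp, of B "(k, j)"] that by (auto simp: p_def p'_def)
      have Hinv: "H (\<pi> \<circ> swap_pairs p p' B) = H \<pi>" if B: "B \<in> Pow {..<n}" for B
      proof -
        have k: "k \<noteq> l" "k \<noteq> l + m" "k + m \<noteq> l" "k + m \<noteq> l + m" if "k \<in> I' \<or> k \<in> I - insert l I'" for k
          using that l lm I by auto
        show ?thesis unfolding H_def f_def g_def
          by (intro arg_cong2[where f = "(*)"] prod.cong refl) (simp_all add: other[OF B k(1,2)] other[OF B k(3,4)])
      qed
      define c where "c = (\<lambda>q. x (\<pi> q))"
      \<comment> \<open>Row l + m gets weight zero, so the row product becomes a linear statistic of
        the whole matrix, to which \<open>sum_swap_pairs\<close> applies.\<close>
      define w where "w = (\<lambda>q::nat \<times> nat. if fst q = l then a (snd q) else 0)"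
      define b where "b = (\<lambda>j. - ((c (l, j) - c (l + m, j)) * a j / 2))"
      define k where "k = (\<Sum>q\<in>P - (p ` {..<n} \<union> p' ` {..<n}). c q * w q)
         + (\<Sum>j<n. (c (p j) + c (p' j)) * (w (p j) + w (p' j)) / 2)"
      have row: "(\<Sum>j<n. x ((\<pi> \<circ> \<tau>) (l, j)) * a j) = (\<Sum>q\<in>P. c (\<tau> q) * w q)" for \<tau>
      proof -
        have "(\<Sum>q\<in>P. c (\<tau> q) * w q) = (\<Sum>q\<in>p ` {..<n}. c (\<tau> q) * w q)"
          using lm m by (intro sum.mono_neutral_right finP) (auto simp: P_def p_def w_def)
        also have "\<dots> = (\<Sum>j<n. x ((\<pi> \<circ> \<tau>) (l, j)) * a j)"
          by (subst sum.reindex) (auto simp: p_def w_def c_def inj_on_def)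
        finally show ?thesis by simp
      qed
      have S: "(\<Sum>j<n. x ((\<pi> \<circ> swap_pairs p p' B) (l, j)) * a j) = k + (\<Sum>j<n. sg B j * b j)" if "B \<in> Pow {..<n}" for B
      proof -
        have "b j = - ((c (p j) - c (p' j)) * (w (p j) - w (p' j)) / 2)" for j
          using lm by (simp add: b_def p_def p'_def w_def)
        then show ?thesis unfolding row using sum_swap_pairs[OF dp _ finP, of B c w] that
          unfolding k_def by simp
      qed
      have bsq: "(\<Sum>j<n. (b j)\<^sup>2) = (\<Sum>j<n. ((x (\<pi> (l, j)) - x (\<pi> (l + m, j))) / 2 * a j)\<^sup>2)"
        by (intro sum.cong refl) (simp add: b_def c_def)
      have "avg (Pow {..<n}) (\<lambda>B. H (\<pi> \<circ> swap_pairs p p' B) * g l (\<pi> \<circ> swap_pairs p p' B))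
        = avg (Pow {..<n}) (\<lambda>B. H \<pi> * exp (- \<theta> * ((\<Sum>j<n. sg B j * b j) - (t l - k))\<^sup>2))"
      proof (intro avg_cong)
        fix B assume B: "B \<in> Pow {..<n}"
        have "k + (\<Sum>j<n. sg B j * b j) - t l = (\<Sum>j<n. sg B j * b j) - (t l - k)" by simp
        then show "H (\<pi> \<circ> swap_pairs p p' B) * g l (\<pi> \<circ> swap_pairs p p' B)
          = H \<pi> * exp (- \<theta> * ((\<Sum>j<n. sg B j * b j) - (t l - k))\<^sup>2)"
          unfolding Hinv[OF B] g_def S[OF B] by (simp only:)
      qed
      also have "\<dots> \<le> H \<pi> * exp (- \<theta> / 2 * (\<Sum>j<n. (b j)\<^sup>2))"
        unfolding avg_cmult
      proof (intro mult_left_mono H0 signed_sum_exp_square_le \<theta>(1))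
        have "(\<Sum>j<n. (b j)\<^sup>2) \<le> (\<Sum>j<n. K\<^sup>2 * (a j)\<^sup>2)"
        proof (rule sum_mono)
          fix j assume j: "j \<in> {..<n}"
          have "\<pi> (l, j) \<in> P" "\<pi> (l + m, j) \<in> P"
            using j lm m by (simp_all add: permutes_in_image[OF pi]) (simp_all add: P_def)
          then have "\<bar>c (l, j)\<bar> \<le> K" "\<bar>c (l + m, j)\<bar> \<le> K" using xK by (auto simp: c_def P_def)
          then have "\<bar>c (l, j) - c (l + m, j)\<bar> \<le> 2 * K"
            using abs_triangle_ineq4[of "c (l, j)" "c (l + m, j)"] by linarith
          then have "\<bar>(c (l, j) - c (l + m, j)) / 2\<bar> \<le> \<bar>K\<bar>" by simp
          then have "((c (l, j) - c (l + m, j)) / 2)\<^sup>2 \<le> K\<^sup>2" by (simp only: abs_le_square_iff)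
          then have "((c (l, j) - c (l + m, j)) / 2)\<^sup>2 * (a j)\<^sup>2 \<le> K\<^sup>2 * (a j)\<^sup>2" by (rule mult_right_mono) simp
          then show "(b j)\<^sup>2 \<le> K\<^sup>2 * (a j)\<^sup>2" by (simp add: b_def power_mult_distrib power_divide)
        qed
        then have "\<theta> * (\<Sum>j<n. (b j)\<^sup>2) \<le> \<theta> * (K\<^sup>2 * (\<Sum>j<n. (a j)\<^sup>2))"
          using \<theta>(1) by (intro mult_left_mono) (auto simp: sum_distrib_left)
        then show "\<theta> * (\<Sum>j<n. (b j)\<^sup>2) \<le> 1/3" using \<theta>(2) by linarith
      qed auto
      finally show "avg (Pow {..<n}) (\<lambda>B. H (\<pi> \<circ> swap_pairs p p' B) * g l (\<pi> \<circ> swap_pairs p p' B)) \<le> H \<pi> * f l \<pi>"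
        unfolding f_def bsq .
    qed
    also have "\<dots> = avg (perms P) (\<lambda>\<pi>. (\<Prod>l\<in>insert l I'. f l \<pi>) * (\<Prod>l\<in>I - insert l I'. g l \<pi>))"
      using insert(1) l unfolding H_def by (intro avg_cong) (simp add: mult_ac)
    finally show ?case .
  qed simp
  from this[of I] show ?thesis unfolding P_def f_def g_def by simp
qed

text \<open>Each row product has bounded variance once swaps are averaged, so the Laplace transform
  factors over pairs of rows. Jensen with weights proportional to the squared coordinates reduces
  the remaining sum of squared entry differences to one column, where the pairs are disjoint
  positions and the loss is exponential in their number.\<close>

lemma single_vector_small_ball:
  fixes x :: "nat \<times> nat \<Rightarrow> real" and a t :: "nat \<Rightarrow> real"
  assumes K: "K > 0" and \<alpha>: "\<alpha> > 0" and \<beta>: "\<beta> > 0"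
    and xK: "\<And>q. q \<in> mat_positions n \<Longrightarrow> \<bar>x q\<bar> \<le> K"
    and sp: "spread \<alpha> \<beta> (mat_positions n) x" and large: "4 \<le> \<beta> * real n"
    and a: "1/8 \<le> (\<Sum>j<n. (a j)\<^sup>2)" "(\<Sum>j<n. (a j)\<^sup>2) \<le> 4"
  shows "avg (perms (mat_positions n))
      (\<lambda>\<pi>. of_bool ((\<Sum>k\<in>{..<n} - {i}. ((\<Sum>j<n. x (\<pi> (k, j)) * a j) - t k)\<^sup>2) \<le> 3 * K\<^sup>2 * row_rate K \<alpha> \<beta> * n))
    \<le> exp (2 * row_rate K \<alpha> \<beta>) * exp (- row_rate K \<alpha> \<beta> / 4 * n)"
proof -
  define P where "P = mat_positions n"
  define \<rho> where "\<rho> = row_rate K \<alpha> \<beta>"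
  \<comment> \<open>Largest value with \<theta> * K^2 * 4 \<le> 1/3, as
    \<open>avg_row_products_le\<close> requires when the squared norm may reach 4.\<close>
  define \<theta> where "\<theta> = 1 / (12 * K\<^sup>2)"
  define m where "m = n div 2"
  define I where "I = {..<m} - {i}"
  define A where "A = (\<Sum>j<n. (a j)\<^sup>2)"
  \<comment> \<open>Lower bound for \<theta> * A / 8, since A \<ge> 1/8.\<close>
  define c where "c = \<theta> / 64"
  have \<rho>: "\<rho> > 0" unfolding \<rho>_def using K \<alpha> \<beta> by (rule row_rate_pos)
  have \<theta>: "\<theta> > 0" using K by (simp add: \<theta>_def)
  have m: "2 * m \<le> n" "n \<le> 2 * m + 1" unfolding m_def by auto
  have I: "I \<subseteq> {..<m}" "finite I" by (auto simp: I_def)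
  \<comment> \<open>Halving n may lose one half by rounding, and removing row i loses one more row;
    together with the Chernoff factor this explains the prefactor exp (2 * \<rho>).\<close>
  have cI: "real n / 2 - 3/2 \<le> card I"
  proof -
    have "m - 1 \<le> card I" unfolding I_def using card_Diff1_le[of "{..<m}" i] by (simp add: card_Diff_singleton_if)
    then show ?thesis using m by linarith
  qed
  have A: "1/8 \<le> A" "A \<le> 4" using a by (auto simp: A_def)
  define d where "d = (\<lambda>(\<pi> :: nat \<times> nat \<Rightarrow> nat \<times> nat) k. (\<Sum>j<n. x (\<pi> (k, j)) * a j) - t k)"
  define D where "D = (\<lambda>(\<pi> :: nat \<times> nat \<Rightarrow> nat \<times> nat) l j. x (\<pi> (l, j)) - x (\<pi> (l + m, j)) :: real)"
  have "avg (perms P) (\<lambda>\<pi>. of_bool ((\<Sum>k\<in>{..<n} - {i}. (d \<pi> k)\<^sup>2) \<le> 3 * K\<^sup>2 * \<rho> * n))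
    \<le> avg (perms P) (\<lambda>\<pi>. exp (\<rho> * n / 4) * (\<Prod>l\<in>I. exp (- \<theta> * (d \<pi> l)\<^sup>2)))"
  proof (rule avg_mono)
    fix \<pi>
    have "(\<Sum>l\<in>I. (d \<pi> l)\<^sup>2) \<le> (\<Sum>k\<in>{..<n} - {i}. (d \<pi> k)\<^sup>2)"
      using m by (intro sum_mono2) (auto simp: I_def)
    moreover have "\<theta> * (3 * K\<^sup>2 * \<rho> * n) = \<rho> * n / 4" using K by (simp add: \<theta>_def field_simps)
    ultimately have "(\<Sum>k\<in>{..<n} - {i}. (d \<pi> k)\<^sup>2) \<le> 3 * K\<^sup>2 * \<rho> * n \<Longrightarrow> 0 \<le> \<rho> * n / 4 - \<theta> * (\<Sum>l\<in>I. (d \<pi> l)\<^sup>2)"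
      using mult_left_mono[of "\<Sum>l\<in>I. (d \<pi> l)\<^sup>2" "3 * K\<^sup>2 * \<rho> * n" \<theta>] \<theta> by linarith
    then have "of_bool ((\<Sum>k\<in>{..<n} - {i}. (d \<pi> k)\<^sup>2) \<le> 3 * K\<^sup>2 * \<rho> * n) \<le> exp (\<rho> * n / 4 - \<theta> * (\<Sum>l\<in>I. (d \<pi> l)\<^sup>2))"
      by simp
    also have "\<dots> = exp (\<rho> * n / 4) * (\<Prod>l\<in>I. exp (- \<theta> * (d \<pi> l)\<^sup>2))"
      unfolding exp_sum[OF I(2), symmetric] exp_add[symmetric] by (simp add: sum_distrib_left sum_negf)
    finally show "of_bool ((\<Sum>k\<in>{..<n} - {i}. (d \<pi> k)\<^sup>2) \<le> 3 * K\<^sup>2 * \<rho> * n)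
      \<le> exp (\<rho> * n / 4) * (\<Prod>l\<in>I. exp (- \<theta> * (d \<pi> l)\<^sup>2))" .
  qed
  also have "\<dots> \<le> exp (\<rho> * n / 4) * avg (perms P) (\<lambda>\<pi>. \<Prod>l\<in>I. exp (- \<theta> / 2 * (\<Sum>j<n. (D \<pi> l j / 2 * a j)\<^sup>2)))"
    unfolding avg_cmult P_def d_def D_def
  proof (intro mult_left_mono avg_row_products_le[where K = K] xK m(1) I(1))
    have e: "\<theta> * (K\<^sup>2 * A) = A / 12" using K by (simp add: \<theta>_def)
    show "\<theta> * (K\<^sup>2 * (\<Sum>j<n. (a j)\<^sup>2)) \<le> 1/3" unfolding A_def[symmetric] e using A by simp
  qed (use \<theta> in auto)
  also have "avg (perms P) (\<lambda>\<pi>. \<Prod>l\<in>I. exp (- \<theta> / 2 * (\<Sum>j<n. (D \<pi> l j / 2 * a j)\<^sup>2)))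
    \<le> avg (perms P) (\<lambda>\<pi>. \<Sum>j<n. (a j)\<^sup>2 / A * (\<Prod>l\<in>I. exp (- c * (D \<pi> l j)\<^sup>2)))"
  proof (rule avg_mono)
    fix \<pi>
    have "(\<Prod>l\<in>I. exp (- \<theta> / 2 * (\<Sum>j<n. (D \<pi> l j / 2 * a j)\<^sup>2)))
      = exp (\<Sum>l\<in>I. - \<theta> / 2 * (\<Sum>j<n. (D \<pi> l j / 2 * a j)\<^sup>2))"
      using I by (simp add: exp_sum)
    also have "(\<Sum>l\<in>I. - \<theta> / 2 * (\<Sum>j<n. (D \<pi> l j / 2 * a j)\<^sup>2))
      = (\<Sum>j<n. (a j)\<^sup>2 / A * (- (\<theta> * A / 8) * (\<Sum>l\<in>I. (D \<pi> l j)\<^sup>2)))"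
      unfolding sum_distrib_left
      by (subst sum.swap, intro sum.cong refl) (use A in \<open>simp add: field_simps power_mult_distrib\<close>)
    also have "exp \<dots> \<le> (\<Sum>j<n. (a j)\<^sup>2 / A * exp (- (\<theta> * A / 8) * (\<Sum>l\<in>I. (D \<pi> l j)\<^sup>2)))"
      using A by (intro exp_weighted_sum_le) (auto simp: sum_divide_distrib[symmetric] A_def)
    also have "\<dots> \<le> (\<Sum>j<n. (a j)\<^sup>2 / A * (\<Prod>l\<in>I. exp (- c * (D \<pi> l j)\<^sup>2)))"
    proof (intro sum_mono mult_left_mono)
      fix j
      have "c \<le> \<theta> * A / 8" using mult_left_mono[OF A(1), of \<theta>] \<theta> by (simp add: c_def)
      then have "c * (\<Sum>l\<in>I. (D \<pi> l j)\<^sup>2) \<le> \<theta> * A / 8 * (\<Sum>l\<in>I. (D \<pi> l j)\<^sup>2)"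
        by (intro mult_right_mono sum_nonneg) auto
      then show "exp (- (\<theta> * A / 8) * (\<Sum>l\<in>I. (D \<pi> l j)\<^sup>2)) \<le> (\<Prod>l\<in>I. exp (- c * (D \<pi> l j)\<^sup>2))"
        unfolding exp_sum[OF I(2), symmetric] by (simp add: sum_distrib_left sum_negf)
    qed (use A in auto)
    finally show "(\<Prod>l\<in>I. exp (- \<theta> / 2 * (\<Sum>j<n. (D \<pi> l j / 2 * a j)\<^sup>2)))
      \<le> (\<Sum>j<n. (a j)\<^sup>2 / A * (\<Prod>l\<in>I. exp (- c * (D \<pi> l j)\<^sup>2)))" .
  qed
  also have "\<dots> = (\<Sum>j<n. (a j)\<^sup>2 / A * avg (perms P) (\<lambda>\<pi>. \<Prod>l\<in>I. exp (- c * (D \<pi> l j)\<^sup>2)))"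
    by (simp only: avg_sum avg_cmult)
  also have "\<dots> \<le> (\<Sum>j<n. (a j)\<^sup>2 / A * exp (- \<rho> * card I))"
  proof (intro sum_mono mult_left_mono)
    fix j assume j: "j \<in> {..<n}"
    have "avg (perms P) (\<lambda>\<pi>. \<Prod>l\<in>I. exp (- c * (x (\<pi> (l, j)) - x (\<pi> (l + m, j)))\<^sup>2))
      \<le> (1 - (1 - exp (- (4 * c * \<alpha>\<^sup>2))) * \<beta>\<^sup>2 / 4) ^ card I"
    proof (rule perms_prod_pairs_le[where p = "\<lambda>l. (l, j)" and p' = "\<lambda>l. (l + m, j)" and \<alpha> = \<alpha>
          and f = "\<lambda>b b'. exp (- c * (b - b')\<^sup>2)"])
      show "disjoint_pairs (\<lambda>l. (l, j)) (\<lambda>l. (l + m, j)) I P"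
        using j m unfolding disjoint_pairs_def P_def I_def by (auto simp: inj_on_def)
      show "exp (- c * (b - b')\<^sup>2) \<le> exp (- (4 * c * \<alpha>\<^sup>2))" if "\<alpha> \<le> b" "b' \<le> - \<alpha>" for b b'
      proof -
        have "(2 * \<alpha>)\<^sup>2 \<le> (b - b')\<^sup>2" using that \<alpha> by (intro power_mono) auto
        then have "c * (4 * \<alpha>\<^sup>2) \<le> c * (b - b')\<^sup>2" using \<theta> by (intro mult_left_mono) (auto simp: c_def power_mult_distrib)
        then show ?thesis by (simp add: mult_ac)
      qed
      show "4 * real (card I) \<le> \<beta> * real (card P)"
      proof -
        have "card I \<le> card {..<m}" using I by (intro card_mono) auto
        then have "real (card I) \<le> n" using m by simp
        moreover have "4 * real n \<le> \<beta> * real n * real n" using large by (intro mult_right_mono) auto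
        ultimately show ?thesis by (simp add: P_def power2_eq_square mult.assoc)
      qed
      show "\<beta> * real (card P) \<le> card {q\<in>P. \<alpha> \<le> x q}" "\<beta> * real (card P) \<le> card {q\<in>P. x q \<le> - \<alpha>}"
        using sp unfolding spread_def P_def by blast+
    qed (use \<theta> \<alpha> \<beta> I in \<open>auto simp: c_def P_def\<close>)
    also have "4 * c * \<alpha>\<^sup>2 = \<alpha>\<^sup>2 / (192 * K\<^sup>2)" by (simp add: c_def \<theta>_def)
    also have "1 - (1 - exp (- (\<alpha>\<^sup>2 / (192 * K\<^sup>2)))) * \<beta>\<^sup>2 / 4 = 1 - \<rho>" by (simp add: \<rho>_def row_rate_def)
    also have "(1 - \<rho>) ^ card I \<le> exp (- \<rho>) ^ card I"
    proof (rule power_mono)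
      show "1 - \<rho> \<le> exp (- \<rho>)" using exp_ge_add_one_self[of "- \<rho>"] by simp
      have "card {q\<in>P. \<alpha> \<le> x q} \<le> card P" by (rule card_mono) (auto simp: P_def)
      then have "real (card {q\<in>P. \<alpha> \<le> x q}) \<le> (real n)\<^sup>2" by (simp add: P_def flip: of_nat_power)
      moreover have "\<beta> * (real n)\<^sup>2 \<le> card {q\<in>P. \<alpha> \<le> x q}" using sp by (simp add: spread_def P_def)
      ultimately have "\<beta> * (real n)\<^sup>2 \<le> 1 * (real n)\<^sup>2" by linarith
      moreover have "n \<noteq> 0" using large by (cases "n = 0") auto
      ultimately have "\<beta> \<le> 1" by (simp only: mult_le_cancel_right) simp
      then have "\<beta>\<^sup>2 \<le> 1" using \<beta> by (simp add: power_le_one)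
      then have "(1 - exp (- (\<alpha>\<^sup>2 / (192 * K\<^sup>2)))) * \<beta>\<^sup>2 \<le> 1 * 1" by (intro mult_mono) auto
      then show "0 \<le> 1 - \<rho>" by (simp add: \<rho>_def row_rate_def)
    qed
    also have "\<dots> = exp (- \<rho> * card I)" by (simp add: exp_of_nat_mult[symmetric] mult.commute)
    finally show "avg (perms P) (\<lambda>\<pi>. \<Prod>l\<in>I. exp (- c * (D \<pi> l j)\<^sup>2)) \<le> exp (- \<rho> * card I)"
      unfolding D_def .
  qed (use A in auto)
  also have "\<dots> = exp (- \<rho> * card I)"
    using A by (simp add: sum_distrib_right[symmetric] sum_divide_distrib[symmetric]) (simp add: A_def)
  also have "exp (\<rho> * n / 4) * exp (- \<rho> * card I) \<le> exp (2 * \<rho>) * exp (- \<rho> / 4 * n)"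
    unfolding exp_add[symmetric] exp_le_cancel_iff
  proof -
    have "\<rho> * (real n / 2 - 3/2) \<le> \<rho> * card I" using cI \<rho> by (intro mult_left_mono) auto
    then show "\<rho> * n / 4 + - \<rho> * card I \<le> 2 * \<rho> + - \<rho> / 4 * n" using \<rho> by (simp add: algebra_simps)
  qed
  finally show ?thesis unfolding P_def d_def \<rho>_def by simp
qed

section \<open>The operator norm\<close>

lemma theta_sum_le:
  fixes s :: real
  assumes "s \<ge> 1"
  shows "(\<Sum>i\<in>{- int L..int L}. exp (- s * (real_of_int i)\<^sup>2)) \<le> 1 + 4 * exp (- s)"
proof -
  define r where "r = exp (- s)"
  have "exp (1::real) \<ge> 2" using exp_ge_add_one_self[of 1] by simp
  also have "exp 1 \<le> exp s" using assms by simp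
  finally have r: "0 < r" "r \<le> 1/2" by (auto simp: r_def exp_minus field_simps)
  \<comment> \<open>The subtracted term strengthens the induction: r \<le> 1/2 lets it pay for the
    two new summands.\<close>
  have "(\<Sum>i\<in>{- int L..int L}. exp (- s * (real_of_int i)\<^sup>2)) \<le> 1 + 4 * r - 4 * r ^ Suc L"
  proof (induction L)
    case (Suc L)
    have "{- int (Suc L)..int (Suc L)} = insert (- int (Suc L)) (insert (int (Suc L)) {- int L..int L})" by auto
    then have "(\<Sum>i\<in>{- int (Suc L)..int (Suc L)}. exp (- s * (real_of_int i)\<^sup>2))
      = 2 * exp (- s * (real (Suc L))\<^sup>2) + (\<Sum>i\<in>{- int L..int L}. exp (- s * (real_of_int i)\<^sup>2))"
      by (simp add: power2_eq_square algebra_simps)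
    moreover have "exp (- s * (real (Suc L))\<^sup>2) \<le> r ^ Suc L"
    proof -
      have "s * (real (Suc L) * 1) \<le> s * (real (Suc L) * real (Suc L))"
        using assms by (intro mult_left_mono) auto
      then have "exp (- s * (real (Suc L))\<^sup>2) \<le> exp (real (Suc L) * (- s))"
        unfolding exp_le_cancel_iff by (simp add: power2_eq_square mult.commute)
      then show ?thesis unfolding r_def exp_of_nat_mult .
    qed
    moreover have "4 * r ^ Suc (Suc L) \<le> 2 * r ^ Suc L"
      using mult_right_mono[OF r(2), of "r ^ Suc L"] r by simp
    ultimately show ?case using Suc by linarith
  qed simp
  also have "\<dots> \<le> 1 + 4 * r" using r by simp
  finally show ?thesis by (simp add: r_def)
qed

text \<open>R bounds the squared norm. Extensional functions keep the set of lattice points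
  finite.\<close>

definition int_ball :: "'a set \<Rightarrow> real \<Rightarrow> ('a \<Rightarrow> int) set" where
  "int_ball J R = {k \<in> J \<rightarrow>\<^sub>E UNIV. (\<Sum>j\<in>J. (real_of_int (k j))\<^sup>2) \<le> R}"

text \<open>Every lattice point of the ball has Gaussian weight at least exp (- s * R), and the
  total weight factors into one-dimensional theta sums. The free s matters: for large s the base 1 +
  4 * exp (- s) is close to 1, so balls of small enough radius relative to sqrt n contain few
  points.\<close>

lemma
  assumes J: "finite J"
  shows finite_int_ball: "finite (int_ball J R)"
    and card_int_ball_le: "s \<ge> 1 \<Longrightarrow> real (card (int_ball J R)) \<le> exp (s * R) * (1 + 4 * exp (- s)) ^ card J"
proof -
  define L where "L = nat \<lceil>R\<rceil>"
  define G where "G = (\<Pi>\<^sub>E j\<in>J. {- int L..int L})"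
  have finG: "finite G" unfolding G_def using J by (intro finite_PiE) auto
  have sub: "int_ball J R \<subseteq> G"
  proof
    fix k assume k: "k \<in> int_ball J R"
    have "k j \<in> {- int L..int L}" if j: "j \<in> J" for j
    proof -
      have "(real_of_int (k j))\<^sup>2 \<le> (\<Sum>j\<in>J. (real_of_int (k j))\<^sup>2)"
        using J j by (intro member_le_sum) auto
      also have "\<dots> \<le> R" using k by (simp add: int_ball_def)
      also have "R \<le> real L" unfolding L_def by linarith
      finally have "(k j)\<^sup>2 \<le> int L" by (metis of_int_le_iff of_int_of_nat_eq of_int_power)
      moreover have "\<bar>k j\<bar> \<le> (k j)\<^sup>2"
      proof (cases "k j = 0")
        case False
        then have "\<bar>k j\<bar> * 1 \<le> \<bar>k j\<bar> * \<bar>k j\<bar>" by (intro mult_left_mono) auto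
        then show ?thesis by (simp add: power2_eq_square flip: abs_mult)
      qed simp
      ultimately have "\<bar>k j\<bar> \<le> int L" by linarith
      then show ?thesis by auto
    qed
    then show "k \<in> G" using k unfolding G_def int_ball_def PiE_def by auto
  qed
  show "finite (int_ball J R)" using sub finG by (rule finite_subset)
  assume s: "s \<ge> 1"
  have "real (card (int_ball J R)) = (\<Sum>k\<in>int_ball J R. 1)" by simp
  also have "\<dots> \<le> (\<Sum>k\<in>int_ball J R. exp (s * R) * exp (- s * (\<Sum>j\<in>J. (real_of_int (k j))\<^sup>2)))"
  proof (rule sum_mono)
    fix k assume "k \<in> int_ball J R"
    then have "s * (\<Sum>j\<in>J. (real_of_int (k j))\<^sup>2) \<le> s * R" using s by (simp add: int_ball_def)
    then show "1 \<le> exp (s * R) * exp (- s * (\<Sum>j\<in>J. (real_of_int (k j))\<^sup>2))"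
      unfolding exp_add[symmetric] by simp
  qed
  also have "\<dots> \<le> (\<Sum>k\<in>G. exp (s * R) * exp (- s * (\<Sum>j\<in>J. (real_of_int (k j))\<^sup>2)))"
    using sub finG by (intro sum_mono2) auto
  also have "\<dots> = exp (s * R) * (\<Sum>k\<in>G. \<Prod>j\<in>J. exp (- s * (real_of_int (k j))\<^sup>2))"
    using J by (simp add: sum_distrib_left exp_sum[symmetric] sum_negf)
  also have "(\<Sum>k\<in>G. \<Prod>j\<in>J. exp (- s * (real_of_int (k j))\<^sup>2)) = (\<Prod>j\<in>J. \<Sum>i\<in>{- int L..int L}. exp (- s * (real_of_int i)\<^sup>2))"
    unfolding G_def using J by (intro prod_sum_PiE[symmetric]) auto
  also have "\<dots> \<le> (\<Prod>j\<in>J. 1 + 4 * exp (- s))"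
    using theta_sum_le[OF s] by (intro prod_mono) (auto intro: sum_nonneg)
  also have "\<dots> = (1 + 4 * exp (- s)) ^ card J" by simp
  finally show "real (card (int_ball J R)) \<le> exp (s * R) * (1 + 4 * exp (- s)) ^ card J" by simp
qed

text \<open>Rounding towards zero never increases modulus, so rounding a vector coordinatewise does
  not increase its norm; it also keeps zeros, hence supports.\<close>

definition round0 :: "real \<Rightarrow> int" where
  "round0 r = (if r \<ge> 0 then \<lfloor>r\<rfloor> else - \<lfloor>- r\<rfloor>)"

lemma round0_abs_le: "\<bar>real_of_int (round0 r)\<bar> \<le> \<bar>r\<bar>"
proof (cases "r \<ge> 0")
  case True
  then have "0 \<le> real_of_int \<lfloor>r\<rfloor>" "real_of_int \<lfloor>r\<rfloor> \<le> r" by auto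
  then show ?thesis using True by (simp add: round0_def)
next
  case False
  then have "0 \<le> real_of_int \<lfloor>- r\<rfloor>" "real_of_int \<lfloor>- r\<rfloor> \<le> - r" by auto
  then show ?thesis using False by (simp add: round0_def)
qed

lemma round0_error: "\<bar>r - real_of_int (round0 r)\<bar> \<le> 1"
  unfolding round0_def by (auto simp: abs_le_iff) linarith+

lemma round0_grid:
  fixes u :: "'a \<Rightarrow> real"
  assumes g: "g > 0" and u: "(\<Sum>j\<in>J. (u j)\<^sup>2) \<le> R"
  shows "restrict (\<lambda>j. round0 (u j / g)) J \<in> int_ball J (R / g\<^sup>2)"
proof -
  have "(\<Sum>j\<in>J. (real_of_int (round0 (u j / g)))\<^sup>2) \<le> (\<Sum>j\<in>J. (u j)\<^sup>2 / g\<^sup>2)"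
    unfolding power_divide[symmetric] by (intro sum_mono) (metis round0_abs_le abs_le_square_iff)
  also have "\<dots> \<le> R / g\<^sup>2" using u by (simp add: sum_divide_distrib[symmetric] divide_right_mono)
  finally show ?thesis by (simp add: int_ball_def)
qed

lemma round0_scaled_error:
  assumes "g > 0"
  shows "(r - g * real_of_int (round0 (r / g)))\<^sup>2 \<le> g\<^sup>2"
proof -
  have "r - g * real_of_int (round0 (r / g)) = g * (r / g - real_of_int (round0 (r / g)))"
    using assms by (simp add: field_simps)
  then have "\<bar>r - g * real_of_int (round0 (r / g))\<bar> \<le> g * 1"
    using assms round0_error[of "r / g"] by (simp only: abs_mult) (intro mult_mono, auto)
  then show ?thesis using assms by (metis abs_le_square_iff abs_of_pos mult.right_neutral)
qed

section \<open>Operator norm through bilinear forms on a grid\<close>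

definition opnorm_le :: "nat \<Rightarrow> real \<Rightarrow> (nat \<Rightarrow> nat \<Rightarrow> real) \<Rightarrow> bool" where
  "opnorm_le n M A \<longleftrightarrow> (\<forall>u. (\<Sum>i<n. (\<Sum>j<n. A i j * u j)\<^sup>2) \<le> M\<^sup>2 * (\<Sum>j<n. (u j)\<^sup>2))"

definition bil :: "nat \<Rightarrow> (nat \<Rightarrow> nat \<Rightarrow> real) \<Rightarrow> (nat \<Rightarrow> real) \<Rightarrow> (nat \<Rightarrow> real) \<Rightarrow> real" where
  "bil n A v u = (\<Sum>i<n. \<Sum>j<n. v i * A i j * u j)"

lemma bil_add_left: "bil n A (\<lambda>i. v i + v' i) u = bil n A v u + bil n A v' u"
  and bil_add_right: "bil n A v (\<lambda>i. u i + u' i) = bil n A v u + bil n A v u'"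
  and bil_scale_left: "bil n A (\<lambda>i. c * v i) u = c * bil n A v u"
  and bil_scale_right: "bil n A v (\<lambda>i. c * u i) = c * bil n A v u"
  unfolding bil_def by (simp_all only: sum.distrib[symmetric] sum_distrib_left distrib_left distrib_right mult_ac)

text \<open>For given u the extremal left vector is A u itself; both vectors are normalised, and the
  degenerate cases are separate.\<close>

lemma bil_sup_bound:
  assumes "\<And>v u. (\<Sum>i<n. (v i)\<^sup>2) \<le> 1 \<Longrightarrow> (\<Sum>j<n. (u j)\<^sup>2) \<le> 1 \<Longrightarrow> bil n A v u \<le> N"
  shows "opnorm_le n N A"
  unfolding opnorm_le_def
proof
  fix u :: "nat \<Rightarrow> real"
  define w where "w = (\<lambda>i. \<Sum>j<n. A i j * u j)"
  define S where "S = (\<Sum>i<n. (w i)\<^sup>2)"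
  define U where "U = (\<Sum>j<n. (u j)\<^sup>2)"
  have SU: "S \<ge> 0" "U \<ge> 0" unfolding S_def U_def by (auto intro: sum_nonneg)
  have e: "bil n A w u = S" unfolding bil_def S_def w_def
    by (simp add: power2_eq_square sum_distrib_left mult.assoc)
  have "S \<le> N\<^sup>2 * U"
  proof (cases "S = 0 \<or> U = 0")
    case True
    have "S = 0" if "U = 0"
    proof -
      have "u j = 0" if "j < n" for j
        using \<open>U = 0\<close> that unfolding U_def by (simp add: sum_nonneg_eq_0_iff)
      then show ?thesis unfolding S_def w_def by simp
    qed
    then show ?thesis using True SU by auto
  next
    case False
    then have p: "S > 0" "U > 0" using SU by auto
    have "bil n A (\<lambda>i. 1 / sqrt S * w i) (\<lambda>j. 1 / sqrt U * u j) \<le> N"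
      using p by (intro assms) (simp_all only: power_mult_distrib sum_distrib_left[symmetric] S_def[symmetric] U_def[symmetric], simp_all add: power_divide)
    then have "S / (sqrt S * sqrt U) \<le> N" by (simp only: bil_scale_left bil_scale_right e) (simp add: field_simps)
    moreover have "S / (sqrt S * sqrt U) = sqrt S / sqrt U" using p by (simp add: field_simps)
    ultimately have "sqrt S \<le> N * sqrt U" using p by (simp add: field_simps)
    then have "(sqrt S)\<^sup>2 \<le> (N * sqrt U)\<^sup>2" using p by (intro power_mono) auto
    then show ?thesis using p by (simp add: power_mult_distrib)
  qed
  then show "(\<Sum>i<n. (\<Sum>j<n. A i j * u j)\<^sup>2) \<le> N\<^sup>2 * (\<Sum>j<n. (u j)\<^sup>2)"
    unfolding S_def U_def w_def .
qed

text \<open>A vector of the unit ball is a grid vector of the unit ball plus a remainder of norm at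
  most 1/4. Applied on both sides this bounds the supremum N by a grid term plus N / 2, and N can be
  absorbed.\<close>

lemma opnorm_le_grid:
  fixes A :: "nat \<Rightarrow> nat \<Rightarrow> real"
  assumes n: "n > 0"
    and grid: "\<And>k l. k \<in> int_ball {..<n} (16 * real n) \<Longrightarrow> l \<in> int_ball {..<n} (16 * real n)
      \<Longrightarrow> bil n A (\<lambda>i. real_of_int (k i)) (\<lambda>j. real_of_int (l j)) \<le> T"
  shows "opnorm_le n (T / (8 * real n)) A"
proof -
  define V where "V = {bil n A v u | v u. (\<Sum>i<n. (v i)\<^sup>2) \<le> 1 \<and> (\<Sum>j<n. (u j)\<^sup>2) \<le> 1}"
  define N where "N = Sup V"
  have abs1: "\<bar>v i\<bar> \<le> 1" if "(\<Sum>i<n. (v i)\<^sup>2) \<le> 1" "i < n" for v :: "nat \<Rightarrow> real" and i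
  proof -
    have "(v i)\<^sup>2 \<le> (\<Sum>i<n. (v i)\<^sup>2)" using that(2) by (intro member_le_sum) auto
    then have "(v i)\<^sup>2 \<le> 1" using that(1) by linarith
    then show ?thesis by (simp add: abs_square_le_1)
  qed
  \<comment> \<open>Finiteness of the supremum must be known before it is absorbed; a crude bound by
    the sum of moduli suffices.\<close>
  have bdd: "bdd_above V"
  proof (rule bdd_aboveI)
    fix r assume "r \<in> V"
    then obtain v u where vu: "r = bil n A v u" "(\<Sum>i<n. (v i)\<^sup>2) \<le> 1" "(\<Sum>j<n. (u j)\<^sup>2) \<le> 1" by (auto simp: V_def)
    show "r \<le> (\<Sum>i<n. \<Sum>j<n. \<bar>A i j\<bar>)"
      unfolding vu bil_def
    proof (intro sum_mono)
      fix i j assume ij: "i \<in> {..<n}" "j \<in> {..<n}"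
      have "v i * A i j * u j \<le> \<bar>v i\<bar> * \<bar>A i j\<bar> * \<bar>u j\<bar>" by (metis abs_ge_self abs_mult)
      also have "\<dots> \<le> 1 * \<bar>A i j\<bar> * 1" using abs1 vu ij by (intro mult_mono) auto
      finally show "v i * A i j * u j \<le> \<bar>A i j\<bar>" by simp
    qed
  qed
  have "V \<noteq> {}" unfolding V_def using zero_le_one by (auto intro!: exI[of _ "\<lambda>_. 0"])
  have le: "bil n A v u \<le> N" if "(\<Sum>i<n. (v i)\<^sup>2) \<le> 1" "(\<Sum>j<n. (u j)\<^sup>2) \<le> 1" for v u
    unfolding N_def using that by (intro cSup_upper bdd) (auto simp: V_def)
  \<comment> \<open>With this mesh the n coordinate errors add up to squared norm at most 1/16, and
    unit vectors become lattice points of squared norm at most 16 * n.\<close>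
  define g where "g = 1 / (4 * sqrt n)"
  have g: "g > 0" "g\<^sup>2 = 1 / (16 * real n)" using n by (auto simp: g_def power_divide power_mult_distrib)
  have round: "\<exists>k\<in>int_ball {..<n} (16 * real n). (\<Sum>i<n. (g * real_of_int (k i))\<^sup>2) \<le> 1 \<and> (\<Sum>i<n. (4 * (v i - g * real_of_int (k i)))\<^sup>2) \<le> 1"
    if v: "(\<Sum>i<n. (v i)\<^sup>2) \<le> 1" for v :: "nat \<Rightarrow> real"
  proof
    define k where "k = restrict (\<lambda>i. round0 (v i / g)) {..<n}"
    show kb: "k \<in> int_ball {..<n} (16 * real n)"
      using round0_grid[OF g(1) v] by (simp add: k_def g(2))
    have "(\<Sum>i<n. (g * real_of_int (k i))\<^sup>2) = g\<^sup>2 * (\<Sum>i<n. (real_of_int (k i))\<^sup>2)"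
      by (simp add: power_mult_distrib sum_distrib_left)
    also have "\<dots> \<le> g\<^sup>2 * (16 * real n)" using kb by (intro mult_left_mono) (auto simp: int_ball_def)
    also have "\<dots> = 1" using n by (simp add: g(2))
    finally have 1: "(\<Sum>i<n. (g * real_of_int (k i))\<^sup>2) \<le> 1" .
    have "(\<Sum>i<n. (4 * (v i - g * real_of_int (k i)))\<^sup>2) \<le> (\<Sum>i<n. 16 * g\<^sup>2)"
      unfolding power_mult_distrib using round0_scaled_error[OF g(1)]
      by (intro sum_mono) (simp add: k_def)
    also have "\<dots> = 1" using n by (simp add: g(2))
    finally show "(\<Sum>i<n. (g * real_of_int (k i))\<^sup>2) \<le> 1 \<and> (\<Sum>i<n. (4 * (v i - g * real_of_int (k i)))\<^sup>2) \<le> 1"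
      using 1 by simp
  qed
  have "r \<le> T / (16 * real n) + N / 2" if rV: "r \<in> V" for r
  proof -
    obtain v u where vu: "r = bil n A v u" "(\<Sum>i<n. (v i)\<^sup>2) \<le> 1" "(\<Sum>j<n. (u j)\<^sup>2) \<le> 1" using rV by (auto simp: V_def)
    obtain k where k: "k \<in> int_ball {..<n} (16 * real n)" "(\<Sum>i<n. (g * real_of_int (k i))\<^sup>2) \<le> 1"
      "(\<Sum>i<n. (4 * (v i - g * real_of_int (k i)))\<^sup>2) \<le> 1" using round[OF vu(2)] by blast
    obtain l where l: "l \<in> int_ball {..<n} (16 * real n)" "(\<Sum>i<n. (g * real_of_int (l i))\<^sup>2) \<le> 1"
      "(\<Sum>i<n. (4 * (u i - g * real_of_int (l i)))\<^sup>2) \<le> 1" using round[OF vu(3)] by blast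
    define v' u' where "v' = (\<lambda>i. g * real_of_int (k i))" and "u' = (\<lambda>i. g * real_of_int (l i))"
    define dv du where "dv = (\<lambda>i. 4 * (v i - v' i))" and "du = (\<lambda>i. 4 * (u i - u' i))"
    have "v = (\<lambda>i. v' i + 1/4 * dv i)" "u = (\<lambda>i. u' i + 1/4 * du i)" unfolding dv_def du_def by (simp_all add: field_simps)
    then have "bil n A v u = bil n A (\<lambda>i. v' i + 1/4 * dv i) u"
      "bil n A v' u = bil n A v' (\<lambda>i. u' i + 1/4 * du i)" by simp_all
    then have "r = bil n A v' u' + 1/4 * bil n A v' du + 1/4 * bil n A dv u"
      unfolding vu(1) bil_add_left bil_add_right bil_scale_left bil_scale_right by simp
    moreover have "bil n A v' du \<le> N" using k l unfolding v'_def du_def u'_def by (intro le) auto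
    moreover have "bil n A dv u \<le> N" using k vu unfolding dv_def v'_def by (intro le) auto
    moreover have "bil n A v' u' \<le> T / (16 * real n)"
    proof -
      have "bil n A v' u' = g\<^sup>2 * bil n A (\<lambda>i. real_of_int (k i)) (\<lambda>j. real_of_int (l j))"
        unfolding v'_def u'_def bil_scale_left bil_scale_right by (simp add: power2_eq_square)
      also have "\<dots> \<le> g\<^sup>2 * T" using grid[OF k(1) l(1)] by (intro mult_left_mono) auto
      finally show ?thesis by (simp add: g(2))
    qed
    ultimately show ?thesis by linarith
  qed
  then have "N \<le> T / (16 * real n) + N / 2" unfolding N_def by (intro cSup_least \<open>V \<noteq> {}\<close>) auto
  then have "N \<le> T / (8 * real n)" by (simp add: field_simps)
  then show ?thesis using le by (intro bil_sup_bound) (meson order_trans)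
qed

text \<open>1024 * K^2 is the moment exponent per dimension, 36 the exponent counting pairs of grid
  points, and the remaining 1 yields exp (- n); the factor 8 comes from
  \<open>opnorm_le_grid\<close>.\<close>

definition norm_bound :: "real \<Rightarrow> real" where
  "norm_bound K = (37 + 1024 * K\<^sup>2) / 8"

lemma opnorm_tail:
  fixes x :: "nat \<times> nat \<Rightarrow> real"
  assumes n: "n > 0" and x: "(\<Sum>q\<in>mat_positions n. x q) = 0"
    and xK: "\<And>q. q \<in> mat_positions n \<Longrightarrow> \<bar>x q\<bar> \<le> K"
  shows "avg (perms (mat_positions n)) (\<lambda>\<pi>. of_bool (\<not> opnorm_le n (norm_bound K * sqrt n) (\<lambda>i j. x (\<pi> (i, j)))))
    \<le> exp (- real n)"
proof -
  define P where "P = mat_positions n"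
  define G where "G = int_ball {..<n} (16 * real n)"
  define T where "T = (37 + 1024 * K\<^sup>2) * (n * sqrt n)"
  define B where "B = (\<lambda>\<pi> k l. bil n (\<lambda>i j. x (\<pi> (i, j))) (\<lambda>i. real_of_int (k i)) (\<lambda>j. real_of_int (l j)))"
  have finG: "finite G" unfolding G_def by (rule finite_int_ball) simp
  have P: "finite P" "P \<noteq> {}" using n by (auto simp: P_def mat_positions_def)
  have "avg (perms P) (\<lambda>\<pi>. of_bool (\<not> opnorm_le n (norm_bound K * sqrt n) (\<lambda>i j. x (\<pi> (i, j)))))
    \<le> (\<Sum>kl\<in>G \<times> G. avg (perms P) (\<lambda>\<pi>. of_bool (T \<le> B \<pi> (fst kl) (snd kl))))"
  proof (rule avg_union_bound)
    fix \<pi> assume H: "\<not> opnorm_le n (norm_bound K * sqrt n) (\<lambda>i j. x (\<pi> (i, j)))"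
    have "T / (8 * real n) = norm_bound K * sqrt n" using n by (simp add: T_def norm_bound_def field_simps)
    then have "\<not> opnorm_le n (T / (8 * real n)) (\<lambda>i j. x (\<pi> (i, j)))" using H by simp
    then obtain k l where "k \<in> G" "l \<in> G" "\<not> B \<pi> k l \<le> T"
      using opnorm_le_grid[OF n, of "\<lambda>i j. x (\<pi> (i, j))" T] unfolding G_def B_def by blast
    then show "\<exists>kl\<in>G \<times> G. T \<le> B \<pi> (fst kl) (snd kl)" by (intro bexI[of _ "(k, l)"]) auto
  qed (use finG in auto)
  also have "\<dots> \<le> (\<Sum>kl\<in>G \<times> G. exp (- 37 * real n))"
  proof (rule sum_mono)
    fix kl assume kl: "kl \<in> G \<times> G"
    obtain k l where e: "kl = (k, l)" "k \<in> G" "l \<in> G" using kl by auto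
    define b where "b = (\<lambda>q::nat \<times> nat. real_of_int (k (fst q)) * real_of_int (l (snd q)))"
    have Bsum: "B \<pi> k l = (\<Sum>q\<in>P. b q * x (\<pi> q))" for \<pi>
      unfolding B_def bil_def P_def mat_positions_def b_def
      by (simp add: sum.cartesian_product case_prod_unfold lessThan_atLeast0 mult_ac)
    \<comment> \<open>With this Chernoff parameter both the threshold term and the moment exponent
      are linear in n, matching the exponential size of the grid.\<close>
    define s where "s = 1 / sqrt n"
    have "avg (perms P) (\<lambda>\<pi>. of_bool (T \<le> B \<pi> k l)) \<le> exp (- s * T) * avg (perms P) (\<lambda>\<pi>. exp (s * B \<pi> k l))"
      by (rule avg_exp_markov) (simp add: s_def)
    also have "avg (perms P) (\<lambda>\<pi>. exp (s * B \<pi> k l)) = avg (perms P) (\<lambda>\<pi>. exp (\<Sum>q\<in>P. s * b q * x (\<pi> q)))"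
      unfolding Bsum sum_distrib_left mult.assoc ..
    also have "\<dots> \<le> exp (4 * K\<^sup>2 * (\<Sum>q\<in>P. (s * b q)\<^sup>2))"
      using x xK P by (intro perms_exp_linear_le) (auto simp: P_def)
    also have "\<dots> \<le> exp (1024 * K\<^sup>2 * n)"
    proof -
      have "(\<Sum>q\<in>P. (b q)\<^sup>2) = (\<Sum>i<n. (real_of_int (k i))\<^sup>2) * (\<Sum>j<n. (real_of_int (l j))\<^sup>2)"
        unfolding P_def mat_positions_def b_def sum_product
        by (simp add: sum.cartesian_product case_prod_unfold lessThan_atLeast0 power_mult_distrib)
      also have "\<dots> \<le> (16 * real n) * (16 * real n)"
      proof (rule mult_mono)
        show "(\<Sum>i<n. (real_of_int (k i))\<^sup>2) \<le> 16 * real n" "(\<Sum>j<n. (real_of_int (l j))\<^sup>2) \<le> 16 * real n"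
          using e(2,3) by (simp_all add: G_def int_ball_def)
        show "0 \<le> (\<Sum>j<n. (real_of_int (l j))\<^sup>2)" by (rule sum_nonneg) simp
      qed simp
      finally have "(\<Sum>q\<in>P. (b q)\<^sup>2) \<le> 256 * (real n * real n)" by simp
      then have "s\<^sup>2 * (\<Sum>q\<in>P. (b q)\<^sup>2) \<le> s\<^sup>2 * (256 * (real n * real n))" by (intro mult_left_mono) auto
      also have "\<dots> = 256 * n" using n by (simp add: s_def power_divide)
      finally have "(\<Sum>q\<in>P. (s * b q)\<^sup>2) \<le> 256 * n" by (simp add: power_mult_distrib sum_distrib_left)
      then have "4 * K\<^sup>2 * (\<Sum>q\<in>P. (s * b q)\<^sup>2) \<le> 4 * K\<^sup>2 * (256 * n)" by (intro mult_left_mono) auto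
      then show ?thesis by simp
    qed
    also have "exp (- s * T) * exp (1024 * K\<^sup>2 * n) = exp (- 37 * real n)"
    proof -
      have "s * T = (37 + 1024 * K\<^sup>2) * n" using n by (simp add: s_def T_def)
      then show ?thesis unfolding exp_add[symmetric] by (simp add: algebra_simps)
    qed
    finally show "avg (perms P) (\<lambda>\<pi>. of_bool (T \<le> B \<pi> (fst kl) (snd kl))) \<le> exp (- 37 * real n)"
      by (simp add: e)
  qed
  also have "\<dots> = (real (card G))\<^sup>2 * exp (- 37 * real n)"
    by (simp add: card_cartesian_product power2_eq_square)
  also have "\<dots> \<le> (exp (18 * real n))\<^sup>2 * exp (- 37 * real n)"
  proof (intro mult_right_mono power_mono)
    have "1 + 4 * exp (- 1) \<le> exp (2 :: real)"
    proof -
      have "2 \<le> exp (1 :: real)" using exp_ge_add_one_self[of 1] by simp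
      then have "exp (- 1 :: real) \<le> 1/2" by (simp add: exp_minus field_simps)
      moreover have "3 \<le> exp (2 :: real)" using exp_ge_add_one_self[of 2] by simp
      ultimately show ?thesis by simp
    qed
    then have "(1 + 4 * exp (- 1)) ^ n \<le> exp (2 :: real) ^ n" by (intro power_mono) (auto simp: add_nonneg_nonneg)
    also have "\<dots> = exp (2 * real n)" by (simp add: exp_of_nat_mult[symmetric] mult.commute)
    finally have "exp (1 * (16 * real n)) * (1 + 4 * exp (- 1)) ^ n \<le> exp (16 * real n) * exp (2 * real n)" by simp
    moreover have "real (card G) \<le> exp (1 * (16 * real n)) * (1 + 4 * exp (- 1)) ^ n"
      using card_int_ball_le[of "{..<n}" 1 "16 * real n"] by (simp add: G_def)
    ultimately show "real (card G) \<le> exp (18 * real n)" by (simp flip: exp_add)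
  qed auto
  also have "\<dots> = exp (- real n)" by (simp add: exp_double[symmetric] flip: exp_add)
  finally show ?thesis unfolding P_def .
qed

lemma opnorm_le_complex:
  assumes A: "opnorm_le n M A"
  shows "(\<Sum>i<n. (cmod (\<Sum>j<n. of_real (A i j) * u j))\<^sup>2) \<le> M\<^sup>2 * (\<Sum>j<n. (cmod (u j))\<^sup>2)"
proof -
  have "(\<Sum>i<n. (cmod (\<Sum>j<n. of_real (A i j) * u j))\<^sup>2)
    = (\<Sum>i<n. (\<Sum>j<n. A i j * Re (u j))\<^sup>2) + (\<Sum>i<n. (\<Sum>j<n. A i j * Im (u j))\<^sup>2)"
    by (simp add: cmod_power2 sum.distrib)
  also have "\<dots> \<le> M\<^sup>2 * (\<Sum>j<n. (Re (u j))\<^sup>2) + M\<^sup>2 * (\<Sum>j<n. (Im (u j))\<^sup>2)"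
    using A unfolding opnorm_le_def by (intro add_mono) auto
  finally show ?thesis by (simp add: cmod_power2 sum.distrib distrib_left)
qed

section \<open>Almost constant vectors\<close>

definition normsq :: "nat \<Rightarrow> (nat \<Rightarrow> complex) \<Rightarrow> real" where
  "normsq n u = (\<Sum>j<n. (cmod (u j))\<^sup>2)"

text \<open>Approximation by a constant \<open>c\<close>, not only by \<open>0\<close>, has to be allowed: permuting the entries
  within a row does not change its sum.\<close>

definition almost_constant :: "nat \<Rightarrow> real \<Rightarrow> real \<Rightarrow> (nat \<Rightarrow> complex) \<Rightarrow> bool" where
  "almost_constant n \<delta> \<kappa> u \<longleftrightarrow>
     (\<exists>c J. J \<subseteq> {..<n} \<and> real (card ({..<n} - J)) \<le> \<delta> * n \<and> (\<Sum>j\<in>J. (cmod (u j - c))\<^sup>2) \<le> \<kappa>\<^sup>2)"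

text \<open>Coordinate k of (X - z * sqrt n * Id) u. Vectors are functions of which the values below
  n matter.\<close>

definition shifted_apply :: "nat \<Rightarrow> complex \<Rightarrow> (nat \<Rightarrow> nat \<Rightarrow> real) \<Rightarrow> (nat \<Rightarrow> complex) \<Rightarrow> nat \<Rightarrow> complex" where
  "shifted_apply n z X u k = (\<Sum>j<n. of_real (X k j) * u j) - z * of_real (sqrt n) * u k"

text \<open>A gridded sparse part plus a gridded constant. The meshes differ because the first error
  is incurred on at most D coordinates and the second on all n; each adds up to the order of
  g.\<close>

definition net_point :: "nat \<Rightarrow> real \<Rightarrow> real \<Rightarrow> (nat \<Rightarrow> int) \<Rightarrow> (nat \<Rightarrow> int) \<Rightarrow> int \<Rightarrow> int \<Rightarrow> nat \<Rightarrow> complex" where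
  "net_point n D g k l a b j =
     of_real (g / sqrt D) * Complex (real_of_int (k j)) (real_of_int (l j))
     + of_real (g / sqrt n) * Complex (real_of_int a) (real_of_int b)"

lemma cmod_add_sq_le: "(cmod (a + b))\<^sup>2 \<le> 2 * (cmod a)\<^sup>2 + 2 * (cmod b)\<^sup>2"
proof -
  have "(cmod (a + b))\<^sup>2 \<le> (cmod a + cmod b)\<^sup>2" by (intro power_mono norm_triangle_ineq) auto
  also have "\<dots> \<le> 2 * (cmod a)\<^sup>2 + 2 * (cmod b)\<^sup>2"
    using sum_squares_ge_zero[of "cmod a - cmod b" 0] by (simp add: power2_eq_square algebra_simps)
  finally show ?thesis .
qed

lemma cmod_diff_sq_le: "(cmod (a - b))\<^sup>2 \<le> 2 * (cmod a)\<^sup>2 + 2 * (cmod b)\<^sup>2"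
  using cmod_add_sq_le[of a "- b"] by simp

lemma sum_cmod_add_sq_le: "(\<Sum>j\<in>J. (cmod (u j + v j))\<^sup>2) \<le> 2 * (\<Sum>j\<in>J. (cmod (u j))\<^sup>2) + 2 * (\<Sum>j\<in>J. (cmod (v j))\<^sup>2)"
  unfolding sum_distrib_left sum.distrib[symmetric] by (intro sum_mono cmod_add_sq_le)

lemma sum_cmod_diff_sq_le: "(\<Sum>j\<in>J. (cmod (u j - v j))\<^sup>2) \<le> 2 * (\<Sum>j\<in>J. (cmod (u j))\<^sup>2) + 2 * (\<Sum>j\<in>J. (cmod (v j))\<^sup>2)"
  unfolding sum_distrib_left sum.distrib[symmetric] by (intro sum_mono cmod_diff_sq_le)

lemma shifted_apply_add: "shifted_apply n z X (\<lambda>j. u j + v j) k = shifted_apply n z X u k + shifted_apply n z X v k"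
  unfolding shifted_apply_def by (simp add: algebra_simps sum.distrib)

lemma shifted_apply_normsq_le:
  assumes "opnorm_le n (N * sqrt n) X"
  shows "normsq n (shifted_apply n z X u) \<le> 2 * (N\<^sup>2 + (cmod z)\<^sup>2) * n * normsq n u"
proof -
  have "normsq n (shifted_apply n z X u)
    \<le> 2 * (\<Sum>k<n. (cmod (\<Sum>j<n. of_real (X k j) * u j))\<^sup>2) + 2 * (\<Sum>k<n. (cmod (z * of_real (sqrt n) * u k))\<^sup>2)"
    unfolding normsq_def shifted_apply_def by (rule sum_cmod_diff_sq_le)
  also have "(\<Sum>k<n. (cmod (\<Sum>j<n. of_real (X k j) * u j))\<^sup>2) \<le> (N * sqrt n)\<^sup>2 * normsq n u"
    unfolding normsq_def by (rule opnorm_le_complex[OF assms])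
  also have "(\<Sum>k<n. (cmod (z * of_real (sqrt n) * u k))\<^sup>2) = (cmod z)\<^sup>2 * n * normsq n u"
    by (simp add: normsq_def norm_mult power_mult_distrib sum_distrib_left)
  finally show ?thesis by (simp add: power_mult_distrib algebra_simps)
qed

lemma round0_complex_error:
  assumes "g > 0"
  shows "(cmod (c - of_real g * Complex (real_of_int (round0 (Re c / g))) (real_of_int (round0 (Im c / g)))))\<^sup>2 \<le> 2 * g\<^sup>2"
  using round0_scaled_error[OF assms, of "Re c"] round0_scaled_error[OF assms, of "Im c"]
  by (simp add: cmod_power2)

text \<open>The vector is a constant c, plus a correction on the exceptional coordinates, plus an
  error of norm at most \<kappa>. Constant and correction are bounded and rounded separately; the
  correction needs only radius of order sqrt (\<delta> * n) / \<kappa> in lattice units, which keeps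
  the grid small.\<close>

lemma almost_constant_net:
  assumes n: "n > 0" and \<delta>: "0 < \<delta>" "\<delta> \<le> 1/2" and \<kappa>: "0 < \<kappa>" "\<kappa> \<le> 1/4"
    and u: "normsq n u = 1" "almost_constant n \<delta> \<kappa> u"
  shows "\<exists>k\<in>int_ball {..<n} (64 * \<delta> / \<kappa>\<^sup>2 * n). \<exists>l\<in>int_ball {..<n} (64 * \<delta> / \<kappa>\<^sup>2 * n).
     \<exists>a\<in>{- \<lceil>6 / \<kappa>\<rceil>..\<lceil>6 / \<kappa>\<rceil>}. \<exists>b\<in>{- \<lceil>6 / \<kappa>\<rceil>..\<lceil>6 / \<kappa>\<rceil>}.
       normsq n (\<lambda>j. u j - net_point n (\<delta> * n) (\<kappa> / 2) k l a b j) \<le> 4 * \<kappa>\<^sup>2"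
proof -
  obtain c J where J: "J \<subseteq> {..<n}" "real (card ({..<n} - J)) \<le> \<delta> * n" "(\<Sum>j\<in>J. (cmod (u j - c))\<^sup>2) \<le> \<kappa>\<^sup>2"
    using u(2) unfolding almost_constant_def by blast
  define g where "g = \<kappa> / 2"
  define D where "D = \<delta> * n"
  define Jc where "Jc = {..<n} - J"
  have D: "D > 0" using n \<delta> by (simp add: D_def)
  have fin: "finite J" "finite Jc" using J(1) finite_subset by (auto simp: Jc_def)
  have split: "(\<Sum>j<n. f j) = (\<Sum>j\<in>J. f j) + (\<Sum>j\<in>Jc. f j)" for f :: "nat \<Rightarrow> real"
    using sum.subset_diff[OF J(1), of f] by (simp add: Jc_def add.commute)
  have part: "(\<Sum>j\<in>J. (cmod (u j))\<^sup>2) \<le> 1" "(\<Sum>j\<in>Jc. (cmod (u j))\<^sup>2) \<le> 1"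
    using u(1) split[of "\<lambda>j. (cmod (u j))\<^sup>2"] sum_nonneg[of J "\<lambda>j. (cmod (u j))\<^sup>2"] sum_nonneg[of Jc "\<lambda>j. (cmod (u j))\<^sup>2"]
    unfolding normsq_def by auto
  have \<kappa>2: "\<kappa>\<^sup>2 \<le> 1/16" using power_mono[OF \<kappa>(2), of 2] \<kappa> by (simp add: power2_eq_square)
  have "\<delta> * n \<le> 1/2 * n" using \<delta>(2) by (intro mult_right_mono) auto
  then have "card Jc \<le> real n / 2" using J(2) by (simp add: Jc_def)
  moreover have "card J + card Jc = n" using J(1) fin by (simp add: Jc_def card_Diff_subset card_mono[of "{..<n}", simplified])
  ultimately have cJ: "real n / 2 \<le> card J" "card Jc \<le> real n / 2" by linarith+
  \<comment> \<open>At least half of the coordinates of a unit vector are close to c in mean square,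
    so c has modulus O(1 / sqrt n).\<close>
  have c: "(cmod c)\<^sup>2 * n \<le> 9/2"
  proof -
    have "(cmod c)\<^sup>2 * card J = (\<Sum>j\<in>J. (cmod (u j - (u j - c)))\<^sup>2)" by simp
    also have "\<dots> \<le> 2 * (\<Sum>j\<in>J. (cmod (u j))\<^sup>2) + 2 * (\<Sum>j\<in>J. (cmod (u j - c))\<^sup>2)" by (rule sum_cmod_diff_sq_le)
    also have "\<dots> \<le> 9/4" using part J(3) \<kappa>2 by linarith
    finally have "(cmod c)\<^sup>2 * card J \<le> 9/4" .
    moreover have "(cmod c)\<^sup>2 * (n / 2) \<le> (cmod c)\<^sup>2 * card J" using cJ by (intro mult_left_mono) auto
    ultimately show ?thesis by simp
  qed
  have sJc: "(\<Sum>j\<in>Jc. (cmod (u j - c))\<^sup>2) \<le> 16"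
  proof -
    have "(\<Sum>j\<in>Jc. (cmod (u j - c))\<^sup>2) \<le> 2 * (\<Sum>j\<in>Jc. (cmod (u j))\<^sup>2) + 2 * (\<Sum>j\<in>Jc. (cmod c)\<^sup>2)" by (rule sum_cmod_diff_sq_le)
    also have "(\<Sum>j\<in>Jc. (cmod c)\<^sup>2) \<le> (cmod c)\<^sup>2 * (n / 2)" using mult_right_mono[OF cJ(2), of "(cmod c)\<^sup>2"] by (simp add: mult.commute)
    finally show ?thesis using c part by simp
  qed
  define s where "s = (\<lambda>j. if j \<in> Jc then u j - c else 0)"
  have ss: "(\<Sum>j<n. (cmod (s j))\<^sup>2) \<le> 16"
  proof -
    have "(\<Sum>j\<in>J. (cmod (s j))\<^sup>2) = 0" by (rule sum.neutral) (auto simp: s_def Jc_def)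
    moreover have "(\<Sum>j\<in>Jc. (cmod (s j))\<^sup>2) = (\<Sum>j\<in>Jc. (cmod (u j - c))\<^sup>2)"
      by (rule sum.cong) (auto simp: s_def)
    ultimately show ?thesis using sJc unfolding split by simp
  qed
  define h where "h = g / sqrt D"
  define h' where "h' = g / sqrt n"
  have h: "h > 0" "h' > 0" "h\<^sup>2 = g\<^sup>2 / D" "h'\<^sup>2 = g\<^sup>2 / n" using D n \<kappa> by (auto simp: h_def h'_def g_def power_divide)
  define k where "k = restrict (\<lambda>j. round0 (Re (s j) / h)) {..<n}"
  define l where "l = restrict (\<lambda>j. round0 (Im (s j) / h)) {..<n}"
  define a where "a = round0 (Re c / h')"
  define b where "b = round0 (Im c / h')"
  have R: "16 / h\<^sup>2 = 64 * \<delta> / \<kappa>\<^sup>2 * n" using D \<kappa> unfolding h(3) by (simp add: g_def D_def power_divide field_simps)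
  have kl: "k \<in> int_ball {..<n} (64 * \<delta> / \<kappa>\<^sup>2 * n)" "l \<in> int_ball {..<n} (64 * \<delta> / \<kappa>\<^sup>2 * n)"
    unfolding k_def l_def R[symmetric]
  proof -
    have "(\<Sum>j<n. (Re (s j))\<^sup>2) \<le> (\<Sum>j<n. (cmod (s j))\<^sup>2)" "(\<Sum>j<n. (Im (s j))\<^sup>2) \<le> (\<Sum>j<n. (cmod (s j))\<^sup>2)"
      by (rule sum_mono, simp add: cmod_power2)+
    then have "(\<Sum>j<n. (Re (s j))\<^sup>2) \<le> 16" "(\<Sum>j<n. (Im (s j))\<^sup>2) \<le> 16" using ss by linarith+
    then show "restrict (\<lambda>j. round0 (Re (s j) / h)) {..<n} \<in> int_ball {..<n} (16 / h\<^sup>2)"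
      "restrict (\<lambda>j. round0 (Im (s j) / h)) {..<n} \<in> int_ball {..<n} (16 / h\<^sup>2)"
      using round0_grid[OF h(1), of "\<lambda>j. Re (s j)"] round0_grid[OF h(1), of "\<lambda>j. Im (s j)"] by auto
  qed
  have ab: "round0 (r / h') \<in> {- \<lceil>6 / \<kappa>\<rceil>..\<lceil>6 / \<kappa>\<rceil>}" if r: "\<bar>r\<bar> \<le> cmod c" for r
  proof -
    have "(cmod c * sqrt n)\<^sup>2 \<le> 3\<^sup>2" using c by (simp add: power_mult_distrib)
    then have "cmod c * sqrt n \<le> 3" by (rule power2_le_imp_le) simp
    then have "\<bar>r\<bar> * sqrt n \<le> 3" using mult_right_mono[OF r, of "sqrt n"] by simp
    then have "\<bar>r\<bar> * sqrt n / g \<le> 3 / g" using \<kappa> by (intro divide_right_mono) (auto simp: g_def)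
    moreover have "\<bar>r / h'\<bar> = \<bar>r\<bar> * sqrt n / g" using h n \<kappa> by (simp add: h'_def g_def abs_mult)
    ultimately have "\<bar>real_of_int (round0 (r / h'))\<bar> \<le> 6 / \<kappa>" using round0_abs_le[of "r / h'"] by (simp add: g_def)
    then have "\<bar>round0 (r / h')\<bar> \<le> \<lceil>6 / \<kappa>\<rceil>" by (simp add: le_ceiling_iff le_floor_iff)
    then show ?thesis by auto
  qed
  define e1 where "e1 = (\<lambda>j. (if j \<in> J then u j - c else 0) + (s j - of_real h * Complex (real_of_int (k j)) (real_of_int (l j))))"
  define e2 where "e2 = c - of_real h' * Complex (real_of_int a) (real_of_int b)"
  have "normsq n (\<lambda>j. u j - net_point n D g k l a b j) = (\<Sum>j<n. (cmod (e1 j + e2))\<^sup>2)"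
    unfolding normsq_def
    by (intro sum.cong refl) (auto simp: net_point_def e1_def e2_def s_def Jc_def h_def h'_def algebra_simps)
  also have "\<dots> \<le> 2 * (\<Sum>j<n. (cmod (e1 j))\<^sup>2) + 2 * (\<Sum>j<n. (cmod e2)\<^sup>2)" by (rule sum_cmod_add_sq_le)
  also have "(\<Sum>j<n. (cmod e2)\<^sup>2) \<le> 2 * g\<^sup>2"
  proof -
    have "(cmod e2)\<^sup>2 \<le> 2 * h'\<^sup>2" unfolding e2_def a_def b_def by (rule round0_complex_error[OF h(2)])
    then have "real n * (cmod e2)\<^sup>2 \<le> real n * (2 * h'\<^sup>2)" by (intro mult_left_mono) auto
    then show ?thesis using n by (simp add: h(4))
  qed
  also have "(\<Sum>j<n. (cmod (e1 j))\<^sup>2) \<le> \<kappa>\<^sup>2 + 2 * g\<^sup>2"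
  proof -
    \<comment> \<open>The correction vanishes on J and zero is rounded to zero, so rounding costs
      nothing there; only the few coordinates of Jc contribute to its error.\<close>
    have "(\<Sum>j\<in>J. (cmod (e1 j))\<^sup>2) = (\<Sum>j\<in>J. (cmod (u j - c))\<^sup>2)"
      using J(1) by (intro sum.cong refl) (auto simp: e1_def s_def Jc_def k_def l_def round0_def zero_complex.code[symmetric] subset_iff)
    moreover have "(\<Sum>j\<in>Jc. (cmod (e1 j))\<^sup>2) \<le> (\<Sum>j\<in>Jc. 2 * h\<^sup>2)"
    proof (rule sum_mono)
      fix j assume j: "j \<in> Jc"
      then have "e1 j = s j - of_real h * Complex (real_of_int (round0 (Re (s j) / h))) (real_of_int (round0 (Im (s j) / h)))"
        by (simp add: e1_def k_def l_def Jc_def)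
      then show "(cmod (e1 j))\<^sup>2 \<le> 2 * h\<^sup>2" using round0_complex_error[OF h(1)] by simp
    qed
    moreover have "(\<Sum>j\<in>Jc. 2 * h\<^sup>2) \<le> 2 * g\<^sup>2"
    proof -
      have "real (card Jc) * (2 * h\<^sup>2) \<le> D * (2 * h\<^sup>2)" using J(2) by (intro mult_right_mono) (auto simp: Jc_def D_def)
      then show ?thesis using D by (simp add: h(3))
    qed
    ultimately show ?thesis using J(3) unfolding split by linarith
  qed
  finally have "normsq n (\<lambda>j. u j - net_point n D g k l a b j) \<le> 4 * \<kappa>\<^sup>2" by (simp add: g_def power_divide)
  moreover have "a \<in> {- \<lceil>6 / \<kappa>\<rceil>..\<lceil>6 / \<kappa>\<rceil>}" "b \<in> {- \<lceil>6 / \<kappa>\<rceil>..\<lceil>6 / \<kappa>\<rceil>}"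
    unfolding a_def b_def by (rule ab[OF abs_Re_le_cmod], rule ab[OF abs_Im_le_cmod])
  ultimately show ?thesis using kl unfolding D_def g_def by blast
qed

section \<open>Union bound over the grid\<close>

text \<open>X is real, so the real part of the image of v is X applied to the real part of v, minus
  a vector that is deterministic for fixed v; likewise for imaginary parts. Each alternative is thus
  an instance of \<open>single_vector_small_ball\<close>.\<close>

definition net_event :: "nat \<Rightarrow> complex \<Rightarrow> real \<Rightarrow> nat \<Rightarrow> (nat \<Rightarrow> nat \<Rightarrow> real) \<Rightarrow> (nat \<Rightarrow> complex) \<Rightarrow> bool" where
  "net_event n z \<gamma> i X v \<longleftrightarrow>
     1/8 \<le> (\<Sum>j<n. (Re (v j))\<^sup>2) \<and> (\<Sum>j<n. (Re (v j))\<^sup>2) \<le> 4 \<and>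
       (\<Sum>k\<in>{..<n} - {i}. (Re (shifted_apply n z X v k))\<^sup>2) \<le> \<gamma> * n \<or>
     1/8 \<le> (\<Sum>j<n. (Im (v j))\<^sup>2) \<and> (\<Sum>j<n. (Im (v j))\<^sup>2) \<le> 4 \<and>
       (\<Sum>k\<in>{..<n} - {i}. (Im (shifted_apply n z X v k))\<^sup>2) \<le> \<gamma> * n"

text \<open>The grid point keeps squared norm between 1/4 and 4, so its real or its imaginary part
  has at least 1/8. The operator norm carries smallness of the image from u to the grid
  point.\<close>

lemma almost_constant_net_event:
  assumes n: "n > 0" and \<delta>: "0 < \<delta>" "\<delta> \<le> 1/2" and \<kappa>: "0 < \<kappa>" "\<kappa> \<le> 1/4"
    and X: "opnorm_le n (N * sqrt n) X" and \<gamma>: "\<kappa>\<^sup>2 * (2 + 16 * (N\<^sup>2 + (cmod z)\<^sup>2)) \<le> \<gamma>"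
    and u: "normsq n u = 1" "almost_constant n \<delta> \<kappa> u"
    and small: "(\<Sum>k\<in>{..<n} - {i}. (cmod (shifted_apply n z X u k))\<^sup>2) \<le> \<kappa>\<^sup>2 * n"
  shows "\<exists>k\<in>int_ball {..<n} (64 * \<delta> / \<kappa>\<^sup>2 * n). \<exists>l\<in>int_ball {..<n} (64 * \<delta> / \<kappa>\<^sup>2 * n).
     \<exists>a\<in>{- \<lceil>6 / \<kappa>\<rceil>..\<lceil>6 / \<kappa>\<rceil>}. \<exists>b\<in>{- \<lceil>6 / \<kappa>\<rceil>..\<lceil>6 / \<kappa>\<rceil>}.
       net_event n z \<gamma> i X (net_point n (\<delta> * n) (\<kappa> / 2) k l a b)"
proof -
  obtain k l a b where net: "k \<in> int_ball {..<n} (64 * \<delta> / \<kappa>\<^sup>2 * n)" "l \<in> int_ball {..<n} (64 * \<delta> / \<kappa>\<^sup>2 * n)"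
      "a \<in> {- \<lceil>6 / \<kappa>\<rceil>..\<lceil>6 / \<kappa>\<rceil>}" "b \<in> {- \<lceil>6 / \<kappa>\<rceil>..\<lceil>6 / \<kappa>\<rceil>}"
      "normsq n (\<lambda>j. u j - net_point n (\<delta> * n) (\<kappa> / 2) k l a b j) \<le> 4 * \<kappa>\<^sup>2"
    using almost_constant_net[OF n \<delta> \<kappa> u] by blast
  define v where "v = net_point n (\<delta> * n) (\<kappa> / 2) k l a b"
  define e where "e = (\<lambda>j. u j - v j)"
  have e: "normsq n e \<le> 4 * \<kappa>\<^sup>2" using net(5) by (simp add: e_def v_def)
  have \<kappa>2: "\<kappa>\<^sup>2 \<le> 1/16" using power_mono[OF \<kappa>(2), of 2] \<kappa> by (simp add: power2_eq_square)
  have "normsq n (\<lambda>j. v j + e j) \<le> 2 * normsq n v + 2 * normsq n e" unfolding normsq_def by (rule sum_cmod_add_sq_le)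
  then have lo: "1/4 \<le> normsq n v" using u(1) e \<kappa>2 by (simp add: e_def)
  have "normsq n (\<lambda>j. u j - e j) \<le> 2 * normsq n u + 2 * normsq n e" unfolding normsq_def by (rule sum_cmod_diff_sq_le)
  then have hi: "normsq n v \<le> 4" using u(1) e \<kappa>2 by (simp add: e_def)
  have parts: "normsq n v = (\<Sum>j<n. (Re (v j))\<^sup>2) + (\<Sum>j<n. (Im (v j))\<^sup>2)"
    "0 \<le> (\<Sum>j<n. (Re (v j))\<^sup>2)" "0 \<le> (\<Sum>j<n. (Im (v j))\<^sup>2)"
    by (auto simp: normsq_def cmod_power2 sum.distrib intro: sum_nonneg)
  let ?R = "{..<n} - {i}"
  have "(\<Sum>k\<in>?R. (cmod (shifted_apply n z X v k))\<^sup>2) \<le> \<gamma> * n"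
  proof -
    have "shifted_apply n z X v k = shifted_apply n z X u k - shifted_apply n z X e k" for k
      using shifted_apply_add[of n z X v e k] by (simp add: e_def)
    then have "(\<Sum>k\<in>?R. (cmod (shifted_apply n z X v k))\<^sup>2) \<le>
      2 * (\<Sum>k\<in>?R. (cmod (shifted_apply n z X u k))\<^sup>2) + 2 * (\<Sum>k\<in>?R. (cmod (shifted_apply n z X e k))\<^sup>2)"
      by (simp only: sum_cmod_diff_sq_le)
    also have "(\<Sum>k\<in>?R. (cmod (shifted_apply n z X e k))\<^sup>2) \<le> normsq n (shifted_apply n z X e)"
      unfolding normsq_def by (intro sum_mono2) auto
    also have "\<dots> \<le> 2 * (N\<^sup>2 + (cmod z)\<^sup>2) * n * normsq n e" by (rule shifted_apply_normsq_le[OF X])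
    also have "\<dots> \<le> 2 * (N\<^sup>2 + (cmod z)\<^sup>2) * n * (4 * \<kappa>\<^sup>2)" using e by (intro mult_left_mono) auto
    also have "2 * (\<Sum>k\<in>?R. (cmod (shifted_apply n z X u k))\<^sup>2) \<le> 2 * (\<kappa>\<^sup>2 * n)" using small by simp
    finally have "(\<Sum>k\<in>?R. (cmod (shifted_apply n z X v k))\<^sup>2) \<le> \<kappa>\<^sup>2 * (2 + 16 * (N\<^sup>2 + (cmod z)\<^sup>2)) * n"
      by (simp add: algebra_simps)
    also have "\<dots> \<le> \<gamma> * n" using \<gamma> by (intro mult_right_mono) auto
    finally show ?thesis .
  qed
  moreover have "(\<Sum>k\<in>?R. (Re (shifted_apply n z X v k))\<^sup>2) \<le> (\<Sum>k\<in>?R. (cmod (shifted_apply n z X v k))\<^sup>2)"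
    "(\<Sum>k\<in>?R. (Im (shifted_apply n z X v k))\<^sup>2) \<le> (\<Sum>k\<in>?R. (cmod (shifted_apply n z X v k))\<^sup>2)"
    by (rule sum_mono, simp add: cmod_power2)+
  ultimately have "net_event n z \<gamma> i X v"
    unfolding net_event_def using lo hi parts by linarith
  then show ?thesis using net unfolding v_def by blast
qed

lemma net_event_unlikely:
  fixes x :: "nat \<times> nat \<Rightarrow> real"
  assumes "K > 0" "\<alpha> > 0" "\<beta> > 0" "\<And>q. q \<in> mat_positions n \<Longrightarrow> \<bar>x q\<bar> \<le> K"
    and "spread \<alpha> \<beta> (mat_positions n) x" "4 \<le> \<beta> * real n"
  shows "avg (perms (mat_positions n)) (\<lambda>\<pi>. of_bool (net_event n z (3 * K\<^sup>2 * row_rate K \<alpha> \<beta>) i (\<lambda>i j. x (\<pi> (i, j))) v))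
    \<le> 2 * (exp (2 * row_rate K \<alpha> \<beta>) * exp (- row_rate K \<alpha> \<beta> / 4 * n))"
proof -
  define \<rho> where "\<rho> = row_rate K \<alpha> \<beta>"
  define E where "E = (\<lambda>(a :: nat \<Rightarrow> real) t (\<pi> :: nat \<times> nat \<Rightarrow> nat \<times> nat). 1/8 \<le> (\<Sum>j<n. (a j)\<^sup>2) \<and> (\<Sum>j<n. (a j)\<^sup>2) \<le> 4 \<and>
     (\<Sum>k\<in>{..<n} - {i}. ((\<Sum>j<n. x (\<pi> (k, j)) * a j) - t k)\<^sup>2) \<le> 3 * K\<^sup>2 * \<rho> * n)"
  have E: "avg (perms (mat_positions n)) (\<lambda>\<pi>. of_bool (E a t \<pi>)) \<le> exp (2 * \<rho>) * exp (- \<rho> / 4 * n)" for a t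
  proof (cases "1/8 \<le> (\<Sum>j<n. (a j)\<^sup>2) \<and> (\<Sum>j<n. (a j)\<^sup>2) \<le> 4")
    case True
    then show ?thesis using single_vector_small_ball[OF assms, of a t i] by (simp add: E_def \<rho>_def)
  next
    case False
    then have "E a t = (\<lambda>\<pi>. False)" by (auto simp: E_def fun_eq_iff)
    then show ?thesis by (simp add: avg_perms_const)
  qed
  have "avg (perms (mat_positions n)) (\<lambda>\<pi>. of_bool (net_event n z (3 * K\<^sup>2 * \<rho>) i (\<lambda>i j. x (\<pi> (i, j))) v))
    \<le> avg (perms (mat_positions n)) (\<lambda>\<pi>. of_bool (E (\<lambda>j. Re (v j)) (\<lambda>k. Re (z * of_real (sqrt n) * v k)) \<pi>)
       + of_bool (E (\<lambda>j. Im (v j)) (\<lambda>k. Im (z * of_real (sqrt n) * v k)) \<pi>))"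
    by (rule avg_mono) (auto simp: E_def net_event_def shifted_apply_def)
  also have "\<dots> \<le> 2 * (exp (2 * \<rho>) * exp (- \<rho> / 4 * n))"
    unfolding avg_add by (rule order_trans[OF add_mono[OF E E]]) simp
  finally show ?thesis unfolding \<rho>_def .
qed

lemma exp_neg_le_const_div_sqrt:
  assumes "r > 0" "n \<ge> 1"
  shows "exp (- r * real n) \<le> 1 / sqrt r / sqrt (real n)"
  using exp_neg_le_inverse_sqrt[of "r * real n"] assms by (simp add: real_sqrt_mult)

text \<open>For i < n one row is ignored, as suits the normal of the other rows. The index i = n
  ignores no row and is used for left vectors.\<close>

definition almost_constant_kernel :: "nat \<Rightarrow> real \<Rightarrow> real \<Rightarrow> complex \<Rightarrow> nat \<Rightarrow> (nat \<Rightarrow> nat \<Rightarrow> real) \<Rightarrow> bool" where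
  "almost_constant_kernel n \<delta> \<kappa> z i X \<longleftrightarrow> (\<exists>u. normsq n u = 1 \<and> almost_constant n \<delta> \<kappa> u \<and>
     (\<Sum>k\<in>{..<n} - {i}. (cmod (shifted_apply n z X u k))\<^sup>2) \<le> \<kappa>\<^sup>2 * n)"

lemma almost_constant_kernel_unlikely:
  fixes K \<alpha> \<beta> \<delta>0 :: real and z :: complex
  assumes K: "K > 0" and \<alpha>: "\<alpha> > 0" and \<beta>: "\<beta> > 0" and \<delta>0: "\<delta>0 > 0"
  obtains \<delta> \<kappa> C where "0 < \<delta>" "\<delta> \<le> \<delta>0" "0 < \<kappa>" "0 < C"
    "\<And>n (x :: nat \<times> nat \<Rightarrow> real) i. n \<ge> 1 \<Longrightarrow> spread \<alpha> \<beta> (mat_positions n) x \<Longrightarrow>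
      (\<And>q. q \<in> mat_positions n \<Longrightarrow> \<bar>x q\<bar> \<le> K) \<Longrightarrow> (\<Sum>q\<in>mat_positions n. x q) = 0 \<Longrightarrow>
      avg (perms (mat_positions n)) (\<lambda>\<pi>. of_bool (almost_constant_kernel n \<delta> \<kappa> z i (\<lambda>i j. x (\<pi> (i, j))))) \<le> C / sqrt n"
proof -
  define \<rho> where "\<rho> = row_rate K \<alpha> \<beta>"
  define \<gamma> where "\<gamma> = 3 * K\<^sup>2 * \<rho>"
  define N where "N = norm_bound K"
  define M where "M = 2 + 16 * (N\<^sup>2 + (cmod z)\<^sup>2)"
  \<comment> \<open>Makes \<kappa>^2 * M \<le> \<gamma>, so that the approximation error stays below
    the single-vector threshold.\<close>
  define \<kappa> where "\<kappa> = min (1/4) (sqrt (\<gamma> / M))"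
  \<comment> \<open>Gives 1 + 4 * exp (- s) \<le> exp (\<rho> / 32) in the lattice count.\<close>
  define s where "s = max 1 (ln (128 / \<rho>))"
  \<comment> \<open>Keeps the other factor of the lattice count below exp (\<rho> * n / 32). Real
    and imaginary grids together then have at most exp (\<rho> * n / 8) points, against the
    single-vector bound of order exp (- \<rho> * n / 4).\<close>
  define \<delta> where "\<delta> = min (min \<delta>0 (1/2)) (\<rho> * \<kappa>\<^sup>2 / (2048 * s))"
  define Z where "Z = {- \<lceil>6 / \<kappa>\<rceil>..\<lceil>6 / \<kappa>\<rceil>}"
  \<comment> \<open>The three summands cover n < 4 / \<beta>, the failure of the norm bound, and the
    union bound, where the squared cardinality of Z counts the gridded constants.\<close>
  define C where "C = 4 / \<beta> + 1 + (real (card (Z)))\<^sup>2 * (2 * exp (2 * \<rho>)) * (1 / sqrt (\<rho> / 8))"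
  have \<rho>: "\<rho> > 0" unfolding \<rho>_def using K \<alpha> \<beta> by (rule row_rate_pos)
  have \<gamma>: "\<gamma> > 0" using K \<rho> by (simp add: \<gamma>_def)
  have M: "M > 0" unfolding M_def by (simp add: add_pos_nonneg)
  have \<kappa>: "0 < \<kappa>" "\<kappa> \<le> 1/4" "\<kappa>\<^sup>2 * M \<le> \<gamma>"
  proof -
    show "0 < \<kappa>" "\<kappa> \<le> 1/4" using \<gamma> M by (auto simp: \<kappa>_def)
    then have "\<kappa>\<^sup>2 \<le> (sqrt (\<gamma> / M))\<^sup>2" by (intro power_mono) (auto simp: \<kappa>_def)
    also have "\<dots> = \<gamma> / M" using \<gamma> M by simp
    finally show "\<kappa>\<^sup>2 * M \<le> \<gamma>" using M by (simp add: field_simps)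
  qed
  have s: "s \<ge> 1" "exp (- s) \<le> \<rho> / 128"
  proof -
    show "s \<ge> 1" by (simp add: s_def)
    have "exp (- s) \<le> exp (- ln (128 / \<rho>))" by (simp add: s_def)
    also have "\<dots> = \<rho> / 128" using \<rho> by (simp add: exp_minus)
    finally show "exp (- s) \<le> \<rho> / 128" .
  qed
  have \<delta>: "0 < \<delta>" "\<delta> \<le> \<delta>0" "\<delta> \<le> 1/2" "s * (64 * \<delta> / \<kappa>\<^sup>2) \<le> \<rho> / 32"
  proof -
    show "0 < \<delta>" "\<delta> \<le> \<delta>0" "\<delta> \<le> 1/2" using \<delta>0 \<rho> \<kappa> s(1) by (auto simp: \<delta>_def)
    have "\<delta> \<le> \<rho> * \<kappa>\<^sup>2 / (2048 * s)" by (simp add: \<delta>_def)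
    then have "\<delta> * (2048 * s) \<le> \<rho> * \<kappa>\<^sup>2" using s(1) by (simp add: pos_le_divide_eq)
    then show "s * (64 * \<delta> / \<kappa>\<^sup>2) \<le> \<rho> / 32" using \<kappa>(1) by (simp add: field_simps)
  qed
  have C: "C > 0" unfolding C_def using \<beta> \<rho> by (intro add_pos_nonneg) auto
  have main: "avg (perms (mat_positions n)) (\<lambda>\<pi>. of_bool (almost_constant_kernel n \<delta> \<kappa> z i (\<lambda>i j. x (\<pi> (i, j))))) \<le> C / sqrt n"
    if n: "n \<ge> 1" and sp: "spread \<alpha> \<beta> (mat_positions n) x" and xK: "\<And>q. q \<in> mat_positions n \<Longrightarrow> \<bar>x q\<bar> \<le> K"
      and x0: "(\<Sum>q\<in>mat_positions n. x q) = 0" for n i and x :: "nat \<times> nat \<Rightarrow> real"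
  proof -
    define P where "P = mat_positions n"
    define X where "X = (\<lambda>(\<pi> :: nat \<times> nat \<Rightarrow> nat \<times> nat) i j. x (\<pi> (i, j)))"
    define Ev where "Ev = (\<lambda>\<pi>. almost_constant_kernel n \<delta> \<kappa> z i (X \<pi>))"
    have sn: "sqrt n \<ge> 1" using n by simp
    have "avg (perms P) (\<lambda>\<pi>. of_bool (Ev \<pi>)) \<le> C / sqrt n"
    proof (cases "4 \<le> \<beta> * n")
      case False
      have "sqrt n \<le> n" using sn by (metis mult_left_mono mult.right_neutral of_nat_0_le_iff real_sqrt_ge_zero real_sqrt_mult_self abs_of_nat)
      also have "real n \<le> 4 / \<beta>" using False \<beta> by (simp add: field_simps)
      also have "\<dots> \<le> C" unfolding C_def using \<rho> by simp
      finally have "1 \<le> C / sqrt n" using sn by (simp add: field_simps)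
      moreover have "avg (perms P) (\<lambda>\<pi>. of_bool (Ev \<pi>)) \<le> avg (perms P) (\<lambda>\<pi>. 1)" by (rule avg_mono) simp
      ultimately show ?thesis by (simp add: avg_perms_const P_def)
    next
      case True
      define B where "B = int_ball {..<n} (64 * \<delta> / \<kappa>\<^sup>2 * real n)"
      define W where "W = (B \<times> B) \<times> (Z \<times> Z)"
      define np where "np = (\<lambda>w. net_point n (\<delta> * n) (\<kappa> / 2) (fst (fst w)) (snd (fst w)) (fst (snd w)) (snd (snd w)))"
      have finB: "finite B" unfolding B_def by (rule finite_int_ball) simp
      then have finW: "finite W" by (simp add: W_def Z_def)
      have cB: "real (card B) \<le> exp (\<rho> / 16 * n)"
      proof -
        have "real (card B) \<le> exp (s * (64 * \<delta> / \<kappa>\<^sup>2 * real n)) * (1 + 4 * exp (- s)) ^ n"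
          unfolding B_def using card_int_ball_le[OF _ s(1), of "{..<n}" "64 * \<delta> / \<kappa>\<^sup>2 * real n"] by simp
        also have "\<dots> \<le> exp (\<rho> / 32 * n) * exp (\<rho> / 32 * n)"
        proof (rule mult_mono)
          have "s * (64 * \<delta> / \<kappa>\<^sup>2) * n \<le> \<rho> / 32 * n" using \<delta>(4) by (rule mult_right_mono) simp
          then show "exp (s * (64 * \<delta> / \<kappa>\<^sup>2 * real n)) \<le> exp (\<rho> / 32 * n)" by (simp add: mult.assoc)
          have "1 + 4 * exp (- s) \<le> 1 + \<rho> / 32" using s(2) by simp
          also have "\<dots> \<le> exp (\<rho> / 32)" by (rule exp_ge_add_one_self)
          finally have "(1 + 4 * exp (- s)) ^ n \<le> exp (\<rho> / 32) ^ n" by (intro power_mono) (auto simp: add_nonneg_nonneg)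
          then show "(1 + 4 * exp (- s)) ^ n \<le> exp (\<rho> / 32 * n)" by (simp add: exp_of_nat_mult[symmetric] mult.commute)
        qed (auto simp: add_nonneg_nonneg)
        also have "\<dots> = exp (\<rho> / 16 * n)" by (simp flip: exp_add)
        finally show ?thesis .
      qed
      have "avg (perms P) (\<lambda>\<pi>. of_bool (Ev \<pi>)) \<le> avg (perms P) (\<lambda>\<pi>. of_bool (\<not> opnorm_le n (N * sqrt n) (X \<pi>))
         + of_bool (\<exists>w\<in>W. net_event n z \<gamma> i (X \<pi>) (np w)))"
      proof (rule avg_mono)
        fix \<pi>
        have "Ev \<pi> \<Longrightarrow> opnorm_le n (N * sqrt n) (X \<pi>) \<Longrightarrow> \<exists>w\<in>W. net_event n z \<gamma> i (X \<pi>) (np w)"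
        proof -
          assume "Ev \<pi>" and op: "opnorm_le n (N * sqrt n) (X \<pi>)"
          then obtain u where u: "normsq n u = 1" "almost_constant n \<delta> \<kappa> u"
            "(\<Sum>k\<in>{..<n} - {i}. (cmod (shifted_apply n z (X \<pi>) u k))\<^sup>2) \<le> \<kappa>\<^sup>2 * n" by (auto simp: Ev_def almost_constant_kernel_def)
          have "n > 0" using n by simp
          then obtain k l a b where "k \<in> B" "l \<in> B" "a \<in> Z" "b \<in> Z"
            "net_event n z \<gamma> i (X \<pi>) (net_point n (\<delta> * n) (\<kappa> / 2) k l a b)"
            using almost_constant_net_event[OF _ \<delta>(1,3) \<kappa>(1,2) op \<kappa>(3)[unfolded M_def] u]
            unfolding B_def Z_def by blast
          then show ?thesis by (intro bexI[of _ "((k, l), (a, b))"]) (auto simp: W_def np_def)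
        qed
        then show "of_bool (Ev \<pi>) \<le> of_bool (\<not> opnorm_le n (N * sqrt n) (X \<pi>))
         + (of_bool (\<exists>w\<in>W. net_event n z \<gamma> i (X \<pi>) (np w)) :: real)" by auto
      qed
      also have "\<dots> \<le> exp (- real n) + (\<Sum>w\<in>W. avg (perms P) (\<lambda>\<pi>. of_bool (net_event n z \<gamma> i (X \<pi>) (np w))))"
        unfolding avg_add
      proof (rule add_mono)
        show "avg (perms P) (\<lambda>\<pi>. of_bool (\<not> opnorm_le n (N * sqrt n) (X \<pi>))) \<le> exp (- real n)"
          unfolding P_def N_def X_def using n x0 xK by (intro opnorm_tail) auto
        show "avg (perms P) (\<lambda>\<pi>. of_bool (\<exists>w\<in>W. net_event n z \<gamma> i (X \<pi>) (np w)))
          \<le> (\<Sum>w\<in>W. avg (perms P) (\<lambda>\<pi>. of_bool (net_event n z \<gamma> i (X \<pi>) (np w))))"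
          using finW by (intro avg_union_bound) auto
      qed
      also have "\<dots> \<le> exp (- real n) + (\<Sum>w\<in>W. 2 * (exp (2 * \<rho>) * exp (- \<rho> / 4 * n)))"
        unfolding \<gamma>_def X_def P_def \<rho>_def
        by (intro add_left_mono sum_mono net_event_unlikely K \<alpha> \<beta> xK sp True)
      also have "\<dots> = exp (- real n) + (real (card (Z)))\<^sup>2 * (2 * exp (2 * \<rho>)) * ((real (card B))\<^sup>2 * exp (- \<rho> / 4 * n))"
        by (simp add: W_def card_cartesian_product power2_eq_square mult_ac)
      also have "\<dots> \<le> exp (- 1 * real n) + (real (card (Z)))\<^sup>2 * (2 * exp (2 * \<rho>)) * exp (- (\<rho> / 8) * n)"
      proof -
        have "(real (card B))\<^sup>2 * exp (- \<rho> / 4 * n) \<le> (exp (\<rho> / 16 * n))\<^sup>2 * exp (- \<rho> / 4 * n)"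
          using cB by (intro mult_right_mono power_mono) auto
        also have "\<dots> = exp (- (\<rho> / 8) * n)"
          unfolding exp_double[symmetric] exp_add[symmetric] by (simp add: field_simps)
        finally show ?thesis by (simp add: mult_left_mono)
      qed
      also have "\<dots> \<le> 1 / sqrt 1 / sqrt n + (real (card (Z)))\<^sup>2 * (2 * exp (2 * \<rho>)) * (1 / sqrt (\<rho> / 8) / sqrt n)"
        using n \<rho> by (intro add_mono mult_left_mono exp_neg_le_const_div_sqrt) auto
      also have "\<dots> \<le> C / sqrt n"
      proof -
        have "(1 + (real (card (Z)))\<^sup>2 * (2 * exp (2 * \<rho>)) * (1 / sqrt (\<rho> / 8))) / sqrt n \<le> C / sqrt n"
          using \<beta> unfolding C_def by (intro divide_right_mono) auto
        then show ?thesis by (simp add: add_divide_distrib)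
      qed
      finally show ?thesis .
    qed
    then show ?thesis unfolding Ev_def X_def P_def .
  qed
  show ?thesis by (rule that[OF \<delta>(1,2) \<kappa>(1) C main])
qed

section \<open>Distance to the span of the other rows\<close>

lemma disjoint_pairs_or_clustered:
  fixes u :: "nat \<Rightarrow> complex"
  assumes h: "h > 0"
  shows "(\<exists>p p'. disjoint_pairs p p' {..<m} {..<n} \<and> (\<forall>l<m. h \<le> cmod (u (p l) - u (p' l))))
    \<or> (\<exists>J\<subseteq>{..<n}. card ({..<n} - J) \<le> 2 * m \<and> (\<forall>i\<in>J. \<forall>j\<in>J. cmod (u i - u j) < h))"
proof (induction m)
  case 0
  then show ?case by (intro disjI1) (auto simp: disjoint_pairs_def)
next
  case (Suc m)
  from Suc.IH show ?case
  proof
    assume "\<exists>J\<subseteq>{..<n}. card ({..<n} - J) \<le> 2 * m \<and> (\<forall>i\<in>J. \<forall>j\<in>J. cmod (u i - u j) < h)"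
    then obtain J where J: "J \<subseteq> {..<n}" "card ({..<n} - J) \<le> 2 * m" "\<forall>i\<in>J. \<forall>j\<in>J. cmod (u i - u j) < h" by blast
    moreover have "card ({..<n} - J) \<le> 2 * Suc m" using J(2) by simp
    ultimately show ?thesis by blast
  next
    assume "\<exists>p p'. disjoint_pairs p p' {..<m} {..<n} \<and> (\<forall>l<m. h \<le> cmod (u (p l) - u (p' l)))"
    then obtain p p' where p: "disjoint_pairs p p' {..<m} {..<n}" "\<And>l. l < m \<Longrightarrow> h \<le> cmod (u (p l) - u (p' l))" by blast
    define C where "C = p ` {..<m} \<union> p' ` {..<m}"
    define J where "J = {..<n} - C"
    show ?thesis
    proof (cases "\<forall>i\<in>J. \<forall>j\<in>J. cmod (u i - u j) < h")
      case True
      have "card ({..<n} - J) \<le> card C" by (intro card_mono) (auto simp: J_def C_def)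
      also have "\<dots> \<le> card (p ` {..<m}) + card (p' ` {..<m})" unfolding C_def by (rule card_Un_le)
      also have "\<dots> \<le> m + m" using card_image_le[of "{..<m}" p] card_image_le[of "{..<m}" p'] by simp
      finally have "card ({..<n} - J) \<le> 2 * Suc m" by simp
      moreover have "J \<subseteq> {..<n}" by (auto simp: J_def)
      ultimately show ?thesis using True by blast
    next
      case False
      then obtain i j where ij: "i \<in> J" "j \<in> J" "h \<le> cmod (u i - u j)" by (auto simp: not_less)
      have "i \<noteq> j" using ij h by auto
      define r r' where "r = p(m := i)" and "r' = p'(m := j)"
      have im: "r ` {..<m} = p ` {..<m}" "r' ` {..<m} = p' ` {..<m}"
        by (rule image_cong; simp add: r_def r'_def)+
      have inj: "inj_on r {..<m}" "inj_on r' {..<m}"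
        using p(1) inj_on_cong[of "{..<m}" r p] inj_on_cong[of "{..<m}" r' p']
        unfolding disjoint_pairs_def r_def r'_def by simp_all
      have at: "r m = i" "r' m = j" "i \<notin> C" "j \<notin> C" "i < n" "j < n" using ij by (auto simp: r_def r'_def J_def)
      have D: "p ` {..<m} \<inter> p' ` {..<m} = {}" "p ` {..<m} \<subseteq> {..<n}" "p' ` {..<m} \<subseteq> {..<n}"
        using p(1) unfolding disjoint_pairs_def by blast+
      have e: "{..<m} - {m} = {..<m}" by auto
      have ni: "r m \<notin> r ` {..<m}" "r' m \<notin> r' ` {..<m}" using at unfolding im C_def by simp_all
      have "inj_on r {..<Suc m}" "inj_on r' {..<Suc m}"
        using inj ni unfolding lessThan_Suc inj_on_insert e by simp_all
      moreover have "r ` {..<Suc m} \<inter> r' ` {..<Suc m} = {}" "r ` {..<Suc m} \<subseteq> {..<n}" "r' ` {..<Suc m} \<subseteq> {..<n}"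
        using at D \<open>i \<noteq> j\<close> unfolding lessThan_Suc image_insert im C_def by auto
      ultimately have "disjoint_pairs r r' {..<Suc m} {..<n}" unfolding disjoint_pairs_def by blast
      moreover have "h \<le> cmod (u (r l) - u (r' l))" if "l < Suc m" for l
        using p(2)[of l] ij(3) that by (auto simp: r_def r'_def less_Suc_eq)
      ultimately show ?thesis by blast
    qed
  qed
qed

lemma not_almost_constant_pairs:
  assumes n: "n > 0" and \<kappa>: "\<kappa> > 0" and u: "\<not> almost_constant n \<delta> \<kappa> u" and m: "2 * real m \<le> \<delta> * n"
  obtains p p' where "disjoint_pairs p p' {..<m} {..<n}" "\<And>l. l < m \<Longrightarrow> \<kappa> / sqrt n \<le> cmod (u (p l) - u (p' l))"
proof -
  have h: "\<kappa> / sqrt n > 0" using n \<kappa> by simp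
  have "\<not> (\<exists>J\<subseteq>{..<n}. card ({..<n} - J) \<le> 2 * m \<and> (\<forall>i\<in>J. \<forall>j\<in>J. cmod (u i - u j) < \<kappa> / sqrt n))"
  proof
    assume "\<exists>J\<subseteq>{..<n}. card ({..<n} - J) \<le> 2 * m \<and> (\<forall>i\<in>J. \<forall>j\<in>J. cmod (u i - u j) < \<kappa> / sqrt n)"
    then obtain J where J: "J \<subseteq> {..<n}" "card ({..<n} - J) \<le> 2 * m" "\<And>i j. i \<in> J \<Longrightarrow> j \<in> J \<Longrightarrow> cmod (u i - u j) < \<kappa> / sqrt n" by blast
    \<comment> \<open>Any member of the cluster serves as its centre; for empty J the value is
      arbitrary and the sum is empty.\<close>
    define c where "c = u (SOME j. j \<in> J)"
    have "(\<Sum>j\<in>J. (cmod (u j - c))\<^sup>2) \<le> (\<Sum>j\<in>J. (\<kappa> / sqrt n)\<^sup>2)"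
    proof (rule sum_mono)
      fix j assume j: "j \<in> J"
      then have "(SOME j. j \<in> J) \<in> J" by (rule someI)
      then have "cmod (u j - c) \<le> \<kappa> / sqrt n" unfolding c_def using J(3) j less_imp_le by blast
      then show "(cmod (u j - c))\<^sup>2 \<le> (\<kappa> / sqrt n)\<^sup>2" by (intro power_mono) auto
    qed
    also have "\<dots> = card J * (\<kappa>\<^sup>2 / n)" by (simp add: power_divide)
    also have "\<dots> \<le> n * (\<kappa>\<^sup>2 / n)" using card_mono[OF _ J(1)] by (intro mult_right_mono) auto
    also have "\<dots> = \<kappa>\<^sup>2" using n by simp
    finally have "almost_constant n \<delta> \<kappa> u" unfolding almost_constant_def using J(1,2) m by (intro exI[of _ c] exI[of _ J]) auto
    then show False using u by simp
  qed
  then show ?thesis using disjoint_pairs_or_clustered[OF h, of m n u] that by blast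
qed

text \<open>The approximating constant is taken to be 0 here.\<close>

lemma not_almost_constant_large_coords:
  assumes n: "n > 0" and \<kappa>: "\<kappa> > 0" and u: "\<not> almost_constant n \<delta> \<kappa> u"
  shows "\<delta> * n \<le> card {i. i < n \<and> \<kappa> / sqrt n \<le> cmod (u i)}"
proof (rule ccontr)
  assume H: "\<not> \<delta> * n \<le> card {i. i < n \<and> \<kappa> / sqrt n \<le> cmod (u i)}"
  define J where "J = {i. i < n \<and> cmod (u i) < \<kappa> / sqrt n}"
  have "{..<n} - J = {i. i < n \<and> \<kappa> / sqrt n \<le> cmod (u i)}" by (auto simp: J_def)
  then have c: "real (card ({..<n} - J)) \<le> \<delta> * n" using H by simp
  have J: "J \<subseteq> {..<n}" by (auto simp: J_def)
  have "(\<Sum>j\<in>J. (cmod (u j - 0))\<^sup>2) \<le> (\<Sum>j\<in>J. (\<kappa> / sqrt n)\<^sup>2)"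
    by (intro sum_mono power_mono) (auto simp: J_def)
  also have "\<dots> = card J * (\<kappa>\<^sup>2 / n)" by (simp add: power_divide)
  also have "\<dots> \<le> n * (\<kappa>\<^sup>2 / n)" using card_mono[OF _ J] by (intro mult_right_mono) auto
  also have "\<dots> = \<kappa>\<^sup>2" using n by simp
  finally have "almost_constant n \<delta> \<kappa> u" unfolding almost_constant_def using J c by blast
  then show False using u by simp
qed

section \<open>Unit normals to all rows but one\<close>

text \<open>Orthogonality is bilinear, without conjugation, so that it matches matrix-vector
  products.\<close>

definition is_normal :: "nat \<Rightarrow> complex \<Rightarrow> nat \<Rightarrow> (nat \<Rightarrow> nat \<Rightarrow> real) \<Rightarrow> (nat \<Rightarrow> complex) \<Rightarrow> bool" where
  "is_normal n z i X u \<longleftrightarrow> normsq n u = 1 \<and> (\<forall>k<n. k \<noteq> i \<longrightarrow> shifted_apply n z X u k = 0)"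

text \<open>Replacing row i by zero makes the matrix singular; a kernel vector is
  normalised.\<close>

lemma is_normal_exists:
  assumes i: "i < n"
  shows "\<exists>u. is_normal n z i X u"
proof -
  define A where "A = mat n n (\<lambda>(k, j). if k = i then 0 else complex_of_real (X k j) - (if k = j then z * of_real (sqrt n) else 0))"
  have A: "A \<in> carrier_mat n n" by (simp add: A_def)
  have "A = mat\<^sub>r n n (\<lambda>k. if k = i then 0\<^sub>v n else row A k)"
    by (rule eq_matI) (auto simp: A_def)
  then have "det A = 0" using det_row_0[OF i, of "row A"] A by auto
  then obtain v where v: "v \<in> carrier_vec n" "v \<noteq> 0\<^sub>v n" "A *\<^sub>v v = 0\<^sub>v n"
    using det_0_iff_vec_prod_zero[OF A] by blast
  define u where "u = (\<lambda>j. vec_index v j)"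
  have z: "shifted_apply n z X u k = 0" if k: "k < n" "k \<noteq> i" for k
  proof -
    have "0 = vec_index (A *\<^sub>v v) k" using v(3) k by simp
    also have "\<dots> = (\<Sum>j<n. (of_real (X k j) - (if k = j then z * of_real (sqrt n) else 0)) * u j)"
      using k v(1) A by (simp add: A_def scalar_prod_def u_def lessThan_atLeast0)
    also have "\<dots> = shifted_apply n z X u k"
      using k by (simp add: shifted_apply_def left_diff_distrib sum_subtractf if_distrib[of "\<lambda>x. x * _"] cong: if_cong)
    finally show ?thesis by simp
  qed
  define s where "s = normsq n u"
  have "s \<noteq> 0"
  proof
    assume "s = 0"
    then have "u j = 0" if "j < n" for j using that by (auto simp: s_def normsq_def sum_nonneg_eq_0_iff)
    then have "v = 0\<^sub>v n" using v(1) by (intro eq_vecI) (auto simp: u_def)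
    then show False using v(2) by simp
  qed
  then have s: "s > 0" unfolding s_def normsq_def by (metis less_eq_real_def sum_nonneg zero_le_power2)
  define w where "w = (\<lambda>j. of_real (1 / sqrt s) * u j)"
  have "normsq n w = (1 / sqrt s)\<^sup>2 * normsq n u"
    unfolding normsq_def w_def norm_mult power_mult_distrib sum_distrib_left[symmetric] norm_of_real power2_abs ..
  then have "normsq n w = 1" using s by (simp add: s_def power_divide)
  moreover have "shifted_apply n z X w k = of_real (1 / sqrt s) * shifted_apply n z X u k" for k
    unfolding shifted_apply_def w_def by (simp add: sum_distrib_left right_diff_distrib mult_ac)
  ultimately show ?thesis using z unfolding is_normal_def by (intro exI[of _ w]) auto
qed

definition normal_vec :: "nat \<Rightarrow> complex \<Rightarrow> nat \<Rightarrow> (nat \<Rightarrow> nat \<Rightarrow> real) \<Rightarrow> nat \<Rightarrow> complex" where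
  "normal_vec n z i X = (SOME u. is_normal n z i X u)"

lemma normal_vec: "i < n \<Longrightarrow> is_normal n z i X (normal_vec n z i X)"
  unfolding normal_vec_def by (rule someI_ex[OF is_normal_exists])

lemma shifted_apply_cong:
  "(\<And>j. j < n \<Longrightarrow> X k j = Y k j) \<Longrightarrow> shifted_apply n z X u k = shifted_apply n z Y u k"
  unfolding shifted_apply_def by (metis (mono_tags, lifting) lessThan_iff sum.cong)

text \<open>The choice depends only on the predicate, which never looks at row i. Permuting the
  entries of row i therefore leaves the chosen normal literally unchanged, and the other rows may be
  conditioned on.\<close>

lemma normal_vec_cong:
  assumes "\<And>k j. k < n \<Longrightarrow> k \<noteq> i \<Longrightarrow> j < n \<Longrightarrow> X k j = Y k j"
  shows "normal_vec n z i X = normal_vec n z i Y"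
proof -
  have "is_normal n z i X u \<longleftrightarrow> is_normal n z i Y u" for u
    unfolding is_normal_def using assms shifted_apply_cong[of n X _ Y z u] by metis
  then have "is_normal n z i X = is_normal n z i Y" by (rule ext)
  then show ?thesis unfolding normal_vec_def by simp
qed

section \<open>Small ball estimate for a random row\<close>

text \<open>A Chernoff bound for the number of positions in R whose value satisfies Q. Since Q is
  closed downwards for the order given by y, the weight exp (- 1) on Q is monotone and negative
  association gives a product bound; half of its exponent pays for the threshold.\<close>

lemma perms_rare_value_unlikely:
  fixes y :: "'a \<Rightarrow> real" and \<beta> :: real
  assumes P: "finite P" "P \<noteq> {}" and R: "R \<subseteq> P" and \<beta>: "\<beta> > 0"
    and Q: "\<beta> * card P \<le> card {q\<in>P. Q q}"
    and anti: "\<And>q q'. q \<in> P \<Longrightarrow> q' \<in> P \<Longrightarrow> y q \<le> y q' \<Longrightarrow> Q q' \<Longrightarrow> Q q"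
  shows "avg (perms P) (\<lambda>\<pi>. of_bool (card {q\<in>R. Q (\<pi> q)} < \<beta> / 4 * card R)) \<le> exp (- (\<beta> / 4) * card R)"
proof -
  have finR: "finite R" using R P finite_subset by blast
  define f where "f = (\<lambda>(p :: 'a) q. exp (- of_bool (Q q)) :: real)"
  have avf: "avg P (f p) \<le> exp (- (\<beta> / 2))" for p
  proof -
    have "avg P (f p) = avg P (\<lambda>q. 1 + (- (1 - exp (- 1))) * of_bool (Q q))"
      by (intro avg_cong) (simp add: f_def)
    also have "\<dots> = 1 - (1 - exp (- 1)) * avg P (\<lambda>q. of_bool (Q q))"
      unfolding avg_add avg_cmult avg_const[OF P] by (simp only: mult_minus_left diff_conv_add_uminus)
    also have "avg P (\<lambda>q. of_bool (Q q)) = card {q\<in>P. Q q} / card P"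
      unfolding avg_def using P by (simp add: of_bool_def sum.If_cases Int_def)
    also have "1 - (1 - exp (- 1)) * (card {q\<in>P. Q q} / card P) \<le> 1 - 1/2 * \<beta>"
    proof -
      have "2 \<le> exp (1 :: real)" using exp_ge_add_one_self[of 1] by simp
      then have e: "exp (- 1 :: real) \<le> 1/2" by (simp add: exp_minus field_simps)
      have "real (card P) > 0" using P by (simp add: card_gt_0_iff)
      then have "\<beta> \<le> card {q\<in>P. Q q} / card P" using Q by (simp add: field_simps)
      then have "1/2 * \<beta> \<le> (1 - exp (- 1)) * (card {q\<in>P. Q q} / card P)"
        using e \<beta> by (intro mult_mono) auto
      then show ?thesis by simp
    qed
    also have "\<dots> \<le> exp (- (\<beta> / 2))" using exp_ge_add_one_self[of "- (\<beta> / 2)"] by simp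
    finally show ?thesis .
  qed
  have "avg (perms P) (\<lambda>\<pi>. of_bool (card {q\<in>R. Q (\<pi> q)} < \<beta> / 4 * card R))
    \<le> avg (perms P) (\<lambda>\<pi>. exp (\<beta> / 4 * card R) * (\<Prod>q\<in>R. f q (\<pi> q)))"
  proof (rule avg_mono)
    fix \<pi>
    have "(\<Prod>q\<in>R. f q (\<pi> q)) = exp (- (\<Sum>q\<in>R. of_bool (Q (\<pi> q))))"
      unfolding f_def using finR by (simp add: exp_sum[symmetric] sum_negf)
    also have "(\<Sum>q\<in>R. of_bool (Q (\<pi> q)) :: real) = card {q\<in>R. Q (\<pi> q)}"
      using finR by (simp add: of_bool_def sum.If_cases Int_def)
    finally have pe: "(\<Prod>q\<in>R. f q (\<pi> q)) = exp (- real (card {q\<in>R. Q (\<pi> q)}))" .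
    show "of_bool (card {q\<in>R. Q (\<pi> q)} < \<beta> / 4 * card R) \<le> exp (\<beta> / 4 * card R) * (\<Prod>q\<in>R. f q (\<pi> q))"
      unfolding pe exp_add[symmetric] by simp
  qed
  also have "\<dots> \<le> exp (\<beta> / 4 * card R) * (\<Prod>q\<in>R. avg P (f q))"
    unfolding avg_cmult using P R anti
    by (intro mult_left_mono perms_prod_comonotone_le[where x = y]) (auto simp: f_def)
  also have "\<dots> \<le> exp (\<beta> / 4 * card R) * (\<Prod>q\<in>R. exp (- (\<beta> / 2)))"
    using avf by (intro mult_left_mono prod_mono) (auto simp: f_def intro: avg_nonneg)
  also have "\<dots> = exp (- (\<beta> / 4) * card R)"
    by (simp add: exp_of_nat_mult[symmetric] exp_add[symmetric])
  finally show ?thesis .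
qed

lemma spread_row:
  fixes x :: "'a \<Rightarrow> real"
  assumes P: "finite P" "P \<noteq> {}" and R: "R \<subseteq> P" and \<beta>: "\<beta> > 0" and sp: "spread \<alpha> \<beta> P x"
  shows "avg (perms P) (\<lambda>\<pi>. of_bool (\<not> spread \<alpha> (\<beta> / 4) R (\<lambda>q. x (\<pi> q)))) \<le> 2 * exp (- (\<beta> / 4) * card R)"
proof -
  have "avg (perms P) (\<lambda>\<pi>. of_bool (\<not> spread \<alpha> (\<beta> / 4) R (\<lambda>q. x (\<pi> q))))
    \<le> avg (perms P) (\<lambda>\<pi>. of_bool (card {q\<in>R. \<alpha> \<le> x (\<pi> q)} < \<beta> / 4 * card R)
        + of_bool (card {q\<in>R. x (\<pi> q) \<le> - \<alpha>} < \<beta> / 4 * card R))"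
    by (rule avg_mono) (auto simp: spread_def)
  also have "\<dots> \<le> exp (- (\<beta> / 4) * card R) + exp (- (\<beta> / 4) * card R)"
    unfolding avg_add
  proof (rule add_mono)
    show "avg (perms P) (\<lambda>\<pi>. of_bool (card {q\<in>R. \<alpha> \<le> x (\<pi> q)} < \<beta> / 4 * card R)) \<le> exp (- (\<beta> / 4) * card R)"
      using sp by (intro perms_rare_value_unlikely[where y = "\<lambda>q. - x q"] P R \<beta>) (auto simp: spread_def)
    show "avg (perms P) (\<lambda>\<pi>. of_bool (card {q\<in>R. x (\<pi> q) \<le> - \<alpha>} < \<beta> / 4 * card R)) \<le> exp (- (\<beta> / 4) * card R)"
      using sp by (intro perms_rare_value_unlikely[where y = "\<lambda>q. x q"] P R \<beta>) (auto simp: spread_def)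
  qed
  finally show ?thesis by simp
qed

text \<open>The row is permuted uniformly within itself while everything else, including the normal,
  is fixed. A normal that is not almost constant supplies separated pairs, and the row inherits
  spread with \<beta> / 4 except with exponentially small probability.\<close>

lemma row_small_ball:
  fixes x :: "nat \<times> nat \<Rightarrow> real"
  assumes \<alpha>: "\<alpha> > 0" and \<beta>: "\<beta> > 0" and \<kappa>: "\<kappa> > 0" and \<delta>: "0 < \<delta>" "\<delta> \<le> \<beta> / 8"
    and n: "4 \<le> \<delta> * n" and i: "i < n" and sp: "spread \<alpha> \<beta> (mat_positions n) x" and e: "\<epsilon> \<ge> 0"
  defines "X \<equiv> \<lambda>(\<pi> :: nat \<times> nat \<Rightarrow> nat \<times> nat) i j. x (\<pi> (i, j))"
  defines "C1 \<equiv> 5 * (2 / (\<alpha> * \<kappa>) + 1) / sqrt (swap_rate (\<beta> / 4) * \<delta> / 8)"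
  shows "avg (perms (mat_positions n)) (\<lambda>\<pi>. of_bool (cmod (shifted_apply n z (X \<pi>) (normal_vec n z i (X \<pi>)) i) \<le> \<epsilon>
      \<and> \<not> almost_constant n \<delta> \<kappa> (normal_vec n z i (X \<pi>))))
    \<le> 2 * exp (- (\<beta> / 4) * n) + C1 * (\<epsilon> + 1 / sqrt n)"
proof -
  define P where "P = mat_positions n"
  define R where "R = Pair i ` {..<n}"
  have npos: "n > 0" using i by simp
  have R: "R \<subseteq> P" "finite R" "card R = n" using i by (auto simp: R_def P_def card_image inj_on_def)
  have P: "finite P" "P \<noteq> {}" using R npos by (auto simp: P_def)
  have sr: "swap_rate (\<beta> / 4) > 0" using \<beta> by (intro swap_rate_pos) simp
  have C1: "C1 > 0" unfolding C1_def using \<alpha> \<kappa> \<delta> sr by (intro divide_pos_pos mult_pos_pos add_nonneg_pos) auto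
  \<comment> \<open>The floor still leaves m \<ge> \<delta> * n / 4 because \<delta> * n \<ge> 4,
    while \<delta> \<le> \<beta> / 8 keeps the pairs few enough for
    \<open>small_ball_complex\<close>.\<close>
  define m where "m = nat \<lfloor>\<delta> * n / 2\<rfloor>"
  have m: "2 * real m \<le> \<delta> * n" "\<delta> * n / 4 \<le> real m"
  proof -
    have "real m = of_int \<lfloor>\<delta> * n / 2\<rfloor>" unfolding m_def using \<delta> by simp
    then have "real m \<le> \<delta> * n / 2" "\<delta> * n / 2 - 1 \<le> real m" by linarith+
    then show "2 * real m \<le> \<delta> * n" "\<delta> * n / 4 \<le> real m" using n by linarith+
  qed
  have mpos: "m > 0" using m(2) n by (cases "m = 0") auto
  define F where "F = (\<lambda>\<pi>. of_bool (cmod (shifted_apply n z (X \<pi>) (normal_vec n z i (X \<pi>)) i) \<le> \<epsilon>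
      \<and> \<not> almost_constant n \<delta> \<kappa> (normal_vec n z i (X \<pi>))) :: real)"
  have "avg (perms P) F \<le> avg (perms P) (\<lambda>\<pi>. of_bool (\<not> spread \<alpha> (\<beta> / 4) R (\<lambda>q. x (\<pi> q))) + C1 * (\<epsilon> + 1 / sqrt n))"
  proof (rule avg_perms_exchange_le[where T = "perms R" and \<tau> = "\<lambda>t. t"])
    show "finite (perms R)" "perms R \<noteq> {}" by (rule finite_perms[OF R(2)], rule perms_nonempty)
    show "t permutes P" if "t \<in> perms R" for t using that R(1) permutes_subset by blast
    fix \<pi>
    define u where "u = normal_vec n z i (X \<pi>)"
    have Rfix: "t (k, j) = (k, j)" if "t \<in> perms R" "k \<noteq> i" for t k j
      using that permutes_not_in[of t R "(k, j)"] by (auto simp: R_def)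
    have nv: "normal_vec n z i (X (\<pi> \<circ> t)) = u" if "t \<in> perms R" for t
      unfolding u_def using Rfix[OF that] by (intro normal_vec_cong) (simp add: X_def)
    show "avg (perms R) (\<lambda>t. F (\<pi> \<circ> t)) \<le> of_bool (\<not> spread \<alpha> (\<beta> / 4) R (\<lambda>q. x (\<pi> q))) + C1 * (\<epsilon> + 1 / sqrt n)"
    proof (cases "spread \<alpha> (\<beta> / 4) R (\<lambda>q. x (\<pi> q)) \<and> \<not> almost_constant n \<delta> \<kappa> u")
      case False
      have "avg (perms R) (\<lambda>t. F (\<pi> \<circ> t)) \<le> avg (perms R) (\<lambda>t. of_bool (\<not> spread \<alpha> (\<beta> / 4) R (\<lambda>q. x (\<pi> q))))"
        using False by (intro avg_mono) (auto simp: F_def nv)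
      also have "\<dots> = of_bool (\<not> spread \<alpha> (\<beta> / 4) R (\<lambda>q. x (\<pi> q)))" using R(2) by (simp add: avg_perms_const)
      finally show ?thesis using C1 e by (simp add: add_increasing2)
    next
      case True
      then obtain p p' where pp: "disjoint_pairs p p' {..<m} {..<n}"
        "\<And>l. l < m \<Longrightarrow> \<kappa> / sqrt n \<le> cmod (u (p l) - u (p' l))"
        using not_almost_constant_pairs[OF npos \<kappa> _ m(1)] by metis
      define t0 where "t0 = - (z * of_real (sqrt n) * u i)"
      have eqS: "shifted_apply n z (X (\<pi> \<circ> t)) u i = (\<Sum>q\<in>R. of_real (x (\<pi> (t q))) * u (snd q)) + t0" for t
        unfolding R_def by (subst sum.reindex) (auto simp: shifted_apply_def X_def t0_def inj_on_def)
      have "avg (perms R) (\<lambda>t. F (\<pi> \<circ> t))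
        = avg (perms R) (\<lambda>t. of_bool (cmod ((\<Sum>q\<in>R. of_real (x (\<pi> (t q))) * u (snd q)) + t0) \<le> \<epsilon>))"
        using True by (intro avg_cong) (simp only: F_def nv eqS simp_thms)
      also have "\<dots> \<le> 5 * (2 * \<epsilon> / (\<alpha> * (\<kappa> / sqrt n)) + 1) / sqrt (swap_rate (\<beta> / 4) * card {..<m} / 2)"
      proof (rule small_ball_complex[where p = "\<lambda>l. (i, p l)" and p' = "\<lambda>l. (i, p' l)" and y = "\<lambda>q. x (\<pi> q)"])
        show "disjoint_pairs (\<lambda>l. (i, p l)) (\<lambda>l. (i, p' l)) {..<m} R"
          using pp(1) unfolding disjoint_pairs_def R_def by (auto simp: inj_on_def)
        show "4 * real (card {..<m}) \<le> \<beta> / 4 * real (card R)"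
          using m(1) mult_right_mono[OF \<delta>(2), of "real n"] by (simp add: R(3))
        show "\<beta> / 4 * real (card R) \<le> card {q\<in>R. \<alpha> \<le> x (\<pi> q)}" "\<beta> / 4 * real (card R) \<le> card {q\<in>R. x (\<pi> q) \<le> - \<alpha>}"
          using True unfolding spread_def by blast+
      qed (use R(2) mpos \<alpha> \<beta> \<kappa> npos e pp(2) in auto)
      also have "\<dots> \<le> 5 * (2 * \<epsilon> / (\<alpha> * (\<kappa> / sqrt n)) + 1) / sqrt (swap_rate (\<beta> / 4) * (\<delta> * n / 4) / 2)"
      proof (rule divide_left_mono)
        have "swap_rate (\<beta> / 4) * (\<delta> * n / 4) \<le> swap_rate (\<beta> / 4) * m" using m(2) sr by (intro mult_left_mono) auto
        then show "sqrt (swap_rate (\<beta> / 4) * (\<delta> * n / 4) / 2) \<le> sqrt (swap_rate (\<beta> / 4) * card {..<m} / 2)"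
          by (intro real_sqrt_le_mono divide_right_mono) simp_all
        show "0 < sqrt (swap_rate (\<beta> / 4) * card {..<m} / 2) * sqrt (swap_rate (\<beta> / 4) * (\<delta> * n / 4) / 2)"
          using sr mpos \<delta> npos by simp
      qed (use \<alpha> \<kappa> e in auto)
      also have "sqrt (swap_rate (\<beta> / 4) * (\<delta> * n / 4) / 2) = sqrt (swap_rate (\<beta> / 4) * \<delta> / 8) * sqrt n"
        by (simp add: real_sqrt_mult[symmetric] mult_ac)
      also have "5 * (2 * \<epsilon> / (\<alpha> * (\<kappa> / sqrt n)) + 1) / (sqrt (swap_rate (\<beta> / 4) * \<delta> / 8) * sqrt n) \<le> C1 * (\<epsilon> + 1 / sqrt n)"
      proof -
        define D where "D = sqrt (swap_rate (\<beta> / 4) * \<delta> / 8)"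
        define a where "a = 2 / (\<alpha> * \<kappa>)"
        have D: "D > 0" unfolding D_def using sr \<delta> by simp
        have a: "a > 0" unfolding a_def using \<alpha> \<kappa> by simp
        have "2 * \<epsilon> / (\<alpha> * (\<kappa> / sqrt n)) = a * \<epsilon> * sqrt n" by (simp add: a_def)
        then have "5 * (2 * \<epsilon> / (\<alpha> * (\<kappa> / sqrt n)) + 1) / (D * sqrt n) = 5 * (a * \<epsilon> + 1 / sqrt n) / D"
          using npos D by (simp add: field_simps)
        also have "\<dots> \<le> 5 * ((a + 1) * (\<epsilon> + 1 / sqrt n)) / D"
        proof (intro divide_right_mono mult_left_mono)
          have R: "a * \<epsilon> + r \<le> (a + 1) * (\<epsilon> + r)" if "0 \<le> r" for r
            using that a e by (simp add: algebra_simps)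
          show "a * \<epsilon> + 1 / sqrt n \<le> (a + 1) * (\<epsilon> + 1 / sqrt n)" by (rule R) simp
        qed (use D in auto)
        also have "\<dots> = C1 * (\<epsilon> + 1 / sqrt n)" by (simp add: C1_def a_def D_def)
        finally show ?thesis unfolding D_def .
      qed
      finally show ?thesis by (rule order_trans) simp
    qed
  qed
  also have "\<dots> \<le> 2 * exp (- (\<beta> / 4) * n) + C1 * (\<epsilon> + 1 / sqrt n)"
    unfolding avg_add avg_perms_const[OF P(1)] using spread_row[OF P R(1) \<beta> sp[folded P_def]] by (simp add: R(3))
  finally show ?thesis unfolding F_def P_def .
qed

section \<open>The smallest singular value in coordinates\<close>

lemma shifted_apply_transpose:
  "(\<Sum>j<n. shifted_apply n z (\<lambda>i j. X j i) w j * u j) = (\<Sum>i<n. w i * shifted_apply n z X u i)"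
proof -
  have "(\<Sum>j<n. shifted_apply n z (\<lambda>i j. X j i) w j * u j)
    = (\<Sum>j<n. \<Sum>i<n. of_real (X i j) * w i * u j) - (\<Sum>j<n. z * of_real (sqrt n) * w j * u j)"
    by (simp add: shifted_apply_def left_diff_distrib sum_subtractf sum_distrib_right)
  also have "(\<Sum>j<n. \<Sum>i<n. of_real (X i j) * w i * u j) = (\<Sum>i<n. \<Sum>j<n. of_real (X i j) * w i * u j)"
    by (rule sum.swap)
  also have "\<dots> - (\<Sum>j<n. z * of_real (sqrt n) * w j * u j) = (\<Sum>i<n. w i * shifted_apply n z X u i)"
    by (simp add: shifted_apply_def right_diff_distrib sum_subtractf sum_distrib_left mult_ac)
  finally show ?thesis .
qed

lemma cmod_sum_mult_le:
  fixes f g :: "nat \<Rightarrow> complex"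
  shows "cmod (\<Sum>j<n. f j * g j) \<le> sqrt (normsq n f) * sqrt (normsq n g)"
proof -
  have "cmod (\<Sum>j<n. f j * g j) \<le> (\<Sum>j<n. \<bar>cmod (f j)\<bar> * \<bar>cmod (g j)\<bar>)"
    by (rule order_trans[OF norm_sum]) (simp add: norm_mult)
  also have "\<dots> \<le> sqrt (normsq n f) * sqrt (normsq n g)"
    using L2_set_mult_ineq[of "\<lambda>j. cmod (f j)" "\<lambda>j. cmod (g j)" "{..<n}"] by (simp add: L2_set_def normsq_def)
  finally show ?thesis .
qed

text \<open>Pairing the transposed image of w with the normal u leaves only the term of row i, as u
  annihilates the other rows; Cauchy-Schwarz bounds it by s.\<close>

lemma left_singular_imp_normal:
  assumes i: "i < n" and w: "normsq n (shifted_apply n z (\<lambda>i j. X j i) w) \<le> s\<^sup>2" and s: "s \<ge> 0"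
  shows "cmod (w i) * cmod (shifted_apply n z X (normal_vec n z i X) i) \<le> s"
proof -
  define u where "u = normal_vec n z i X"
  have u: "normsq n u = 1" "\<And>k. k < n \<Longrightarrow> k \<noteq> i \<Longrightarrow> shifted_apply n z X u k = 0"
    using normal_vec[OF i, of z X] by (auto simp: is_normal_def u_def)
  have "(\<Sum>k<n. w k * shifted_apply n z X u k) = w i * shifted_apply n z X u i"
    using i u(2) by (subst sum.remove[of _ i]) auto
  then have "cmod (w i) * cmod (shifted_apply n z X u i) = cmod (\<Sum>j<n. shifted_apply n z (\<lambda>i j. X j i) w j * u j)"
    unfolding shifted_apply_transpose by (simp add: norm_mult)
  also have "\<dots> \<le> sqrt (normsq n (shifted_apply n z (\<lambda>i j. X j i) w)) * sqrt (normsq n u)" by (rule cmod_sum_mult_le)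
  also have "\<dots> \<le> s" using real_sqrt_le_mono[OF w] s by (simp add: u(1))
  finally show ?thesis unfolding u_def .
qed

text \<open>Transposing positions is itself a permutation of them, so the random matrix and its
  transpose have the same law.\<close>

lemma avg_perms_transpose:
  "avg (perms (mat_positions n)) (\<lambda>\<pi>. F (\<pi> \<circ> (\<lambda>q. if q \<in> mat_positions n then (snd q, fst q) else q)))
    = avg (perms (mat_positions n)) F"
proof (rule avg_perms_compose_right)
  show "(\<lambda>q. if q \<in> mat_positions n then (snd q, fst q) else q) permutes mat_positions n"
    by (rule bij_imp_permutes[OF bij_betw_byWitness[where f' = "\<lambda>q. (snd q, fst q)"]]) (auto simp: mat_positions_def)
qed

text \<open>A left vector that is not almost constant has at least \<delta> * n coordinates of
  modulus at least \<kappa> / sqrt n, and each such i makes row i nearly orthogonal to its normal at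
  level \<epsilon> / \<kappa>. The event therefore costs at most the sum of the row probabilities
  divided by \<delta> * n.\<close>

lemma smallest_singular_value_tail:
  fixes K \<alpha> \<beta> :: real and z :: complex
  assumes K: "K > 0" and \<alpha>: "\<alpha> > 0" and \<beta>: "\<beta> > 0"
  obtains C where "C > 0"
    "\<And>n (x :: nat \<times> nat \<Rightarrow> real) \<epsilon>. n \<ge> 1 \<Longrightarrow> spread \<alpha> \<beta> (mat_positions n) x \<Longrightarrow>
      (\<And>q. q \<in> mat_positions n \<Longrightarrow> \<bar>x q\<bar> \<le> K) \<Longrightarrow> (\<Sum>q\<in>mat_positions n. x q) = 0 \<Longrightarrow> \<epsilon> > 0 \<Longrightarrow>
      avg (perms (mat_positions n)) (\<lambda>\<pi>. of_bool (\<exists>w. normsq n w = 1 \<and>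
        normsq n (shifted_apply n z (\<lambda>i j. x (\<pi> (j, i))) w) \<le> (\<epsilon> / sqrt n)\<^sup>2)) \<le> C * (\<epsilon> + 1 / sqrt n)"
proof -
  have \<beta>8: "\<beta> / 8 > 0" using \<beta> by simp
  show ?thesis
  proof (rule almost_constant_kernel_unlikely[OF K \<alpha> \<beta> \<beta>8, of z])
    fix \<delta> \<kappa> C0
    assume \<delta>: "0 < \<delta>" "\<delta> \<le> \<beta> / 8" and \<kappa>: "0 < \<kappa>" and C0: "0 < C0" and
      ac: "\<And>n (x :: nat \<times> nat \<Rightarrow> real) i. n \<ge> 1 \<Longrightarrow> spread \<alpha> \<beta> (mat_positions n) x \<Longrightarrow>
        (\<And>q. q \<in> mat_positions n \<Longrightarrow> \<bar>x q\<bar> \<le> K) \<Longrightarrow> (\<Sum>q\<in>mat_positions n. x q) = 0 \<Longrightarrow>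
        avg (perms (mat_positions n)) (\<lambda>\<pi>. of_bool (almost_constant_kernel n \<delta> \<kappa> z i (\<lambda>i j. x (\<pi> (i, j))))) \<le> C0 / sqrt n"
    define C1 where "C1 = 5 * (2 / (\<alpha> * \<kappa>) + 1) / sqrt (swap_rate (\<beta> / 4) * \<delta> / 8)"
    define C2 where "C2 = 2 / sqrt (\<beta> / 4)"
    have C1: "C1 > 0" unfolding C1_def using \<alpha> \<kappa> \<delta> \<beta> swap_rate_pos[of "\<beta> / 4"]
      by (intro divide_pos_pos mult_pos_pos add_nonneg_pos) auto
    have C2: "C2 > 0" unfolding C2_def using \<beta> by simp
    \<comment> \<open>4 / \<delta> and 1 / \<kappa> make the claim trivial for small n and for
      \<epsilon> > \<kappa>; the bracket collects the coefficients of the actual estimate.\<close>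
    define C where "C = 4 / \<delta> + 1 / \<kappa> + (C0 + (1 / \<delta>) * (C2 + C1 + C0) + (1 / \<delta>) * (C1 / \<kappa>))"
    have C: "C > 0" unfolding C_def using \<delta> \<kappa> C0 C1 C2 by (intro add_pos_nonneg) auto
    have main: "avg (perms (mat_positions n)) (\<lambda>\<pi>. of_bool (\<exists>w. normsq n w = 1 \<and>
          normsq n (shifted_apply n z (\<lambda>i j. x (\<pi> (j, i))) w) \<le> (\<epsilon> / sqrt n)\<^sup>2)) \<le> C * (\<epsilon> + 1 / sqrt n)"
      if n: "n \<ge> 1" and sp: "spread \<alpha> \<beta> (mat_positions n) x" and xK: "\<And>q. q \<in> mat_positions n \<Longrightarrow> \<bar>x q\<bar> \<le> K"
        and x0: "(\<Sum>q\<in>mat_positions n. x q) = 0" and e: "\<epsilon> > 0" for n \<epsilon> and x :: "nat \<times> nat \<Rightarrow> real"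
    proof -
      define P where "P = mat_positions n"
      define X where "X = (\<lambda>(\<pi> :: nat \<times> nat \<Rightarrow> nat \<times> nat) i j. x (\<pi> (i, j)))"
      define L where "L = (\<lambda>\<pi>. \<exists>w. normsq n w = 1 \<and> normsq n (shifted_apply n z (\<lambda>i j. X \<pi> j i) w) \<le> (\<epsilon> / sqrt n)\<^sup>2)"
      have sn: "sqrt n \<ge> 1" using n by simp
      have triv: "avg (perms P) (\<lambda>\<pi>. of_bool (L \<pi>)) \<le> 1"
      proof -
        have "avg (perms P) (\<lambda>\<pi>. of_bool (L \<pi>)) \<le> avg (perms P) (\<lambda>\<pi>. 1)" by (rule avg_mono) simp
        then show ?thesis by (simp add: avg_perms_const P_def)
      qed
      have "avg (perms P) (\<lambda>\<pi>. of_bool (L \<pi>)) \<le> C * (\<epsilon> + 1 / sqrt n)"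
      proof (cases "4 \<le> \<delta> * n \<and> \<epsilon> \<le> \<kappa>")
        case False
        have "1 \<le> C * (\<epsilon> + 1 / sqrt n)"
        proof (cases "4 \<le> \<delta> * n")
          case True
          then have "1 \<le> 1 / \<kappa> * \<epsilon>" using False \<kappa> by (simp add: field_simps)
          also have "\<dots> \<le> C * \<epsilon>" unfolding C_def using \<delta> \<kappa> C0 C1 C2 e by (intro mult_right_mono) auto
          also have "\<dots> \<le> C * (\<epsilon> + 1 / sqrt n)" using C by (intro mult_left_mono) auto
          finally show ?thesis .
        next
          case False
          have "sqrt n \<le> sqrt n * sqrt n" using mult_left_mono[OF sn, of "sqrt n"] by simp
          also have "\<dots> \<le> 4 / \<delta>" using False \<delta> by (simp add: field_simps)
          also have "\<dots> \<le> C" unfolding C_def using \<delta> \<kappa> C0 C1 C2 by simp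
          finally have "1 \<le> C * (1 / sqrt n)" using sn by (simp add: field_simps)
          also have "\<dots> \<le> C * (\<epsilon> + 1 / sqrt n)" using C e by (intro mult_left_mono) auto
          finally show ?thesis .
        qed
        then show ?thesis using triv by linarith
      next
        case True
        define Bd where "Bd = (\<lambda>i \<pi>. almost_constant_kernel n \<delta> \<kappa> z i (X \<pi>))"
        define LB where "LB = (\<lambda>\<pi>. almost_constant_kernel n \<delta> \<kappa> z n (\<lambda>i j. X \<pi> j i))"
        define Fi where "Fi = (\<lambda>i \<pi>. cmod (shifted_apply n z (X \<pi>) (normal_vec n z i (X \<pi>)) i) \<le> \<epsilon> / \<kappa>)"
        have PBd: "avg (perms P) (\<lambda>\<pi>. of_bool (Bd i \<pi>)) \<le> C0 / sqrt n" for i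
          unfolding Bd_def X_def P_def using n sp xK x0 by (rule ac)
        have PLB: "avg (perms P) (\<lambda>\<pi>. of_bool (LB \<pi>)) \<le> C0 / sqrt n"
        proof -
          define fl where "fl = (\<lambda>q. if q \<in> mat_positions n then (snd q, fst q) else q)"
          have "shifted_apply n z (\<lambda>i j. X (\<pi> \<circ> fl) j i) u k = shifted_apply n z (X \<pi>) u k" if "k < n" for u k \<pi>
            using that by (intro shifted_apply_cong) (simp add: X_def fl_def)
          then have "(\<Sum>k\<in>{..<n} - {n}. (cmod (shifted_apply n z (\<lambda>i j. X (\<pi> \<circ> fl) j i) u k))\<^sup>2)
            = (\<Sum>k\<in>{..<n} - {n}. (cmod (shifted_apply n z (X \<pi>) u k))\<^sup>2)" for u \<pi>
            by (intro sum.cong) auto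
          then have "LB (\<pi> \<circ> fl) = Bd n \<pi>" for \<pi> unfolding LB_def Bd_def almost_constant_kernel_def by simp
          then show ?thesis using PBd[of n] avg_perms_transpose[of n "\<lambda>\<pi>. of_bool (LB \<pi>)"]
            unfolding fl_def P_def by simp
        qed
        have PF: "avg (perms P) (\<lambda>\<pi>. of_bool (Fi i \<pi>)) \<le> C1 * (\<epsilon> / \<kappa>) + (C2 + C1 + C0) / sqrt n" if i: "i < n" for i
        proof -
          define Gi where "Gi = (\<lambda>\<pi>. Fi i \<pi> \<and> \<not> almost_constant n \<delta> \<kappa> (normal_vec n z i (X \<pi>)))"
          have "avg (perms P) (\<lambda>\<pi>. of_bool (Fi i \<pi>)) \<le> avg (perms P) (\<lambda>\<pi>. of_bool (Gi \<pi>) + of_bool (Bd i \<pi>))"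
          proof (rule avg_mono)
            fix \<pi>
            have "Bd i \<pi>" if "almost_constant n \<delta> \<kappa> (normal_vec n z i (X \<pi>))"
            proof -
              have nv: "is_normal n z i (X \<pi>) (normal_vec n z i (X \<pi>))" using i by (rule normal_vec)
              have "(\<Sum>k\<in>{..<n} - {i}. (cmod (shifted_apply n z (X \<pi>) (normal_vec n z i (X \<pi>)) k))\<^sup>2) = 0"
                using nv by (intro sum.neutral) (auto simp: is_normal_def)
              then show ?thesis unfolding Bd_def almost_constant_kernel_def using that nv by (intro exI[of _ "normal_vec n z i (X \<pi>)"]) (auto simp: is_normal_def)
            qed
            then show "of_bool (Fi i \<pi>) \<le> of_bool (Gi \<pi>) + (of_bool (Bd i \<pi>) :: real)" by (auto simp: Gi_def)
          qed
          also have "\<dots> \<le> (2 * exp (- (\<beta> / 4) * n) + C1 * (\<epsilon> / \<kappa> + 1 / sqrt n)) + C0 / sqrt n"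
            unfolding avg_add
          proof (rule add_mono[OF _ PBd])
            show "avg (perms P) (\<lambda>\<pi>. of_bool (Gi \<pi>)) \<le> 2 * exp (- (\<beta> / 4) * n) + C1 * (\<epsilon> / \<kappa> + 1 / sqrt n)"
              unfolding Gi_def Fi_def P_def X_def C1_def using True e \<kappa>
              by (intro row_small_ball \<alpha> \<beta> \<delta> i sp) auto
          qed
          also have "\<dots> \<le> (2 * (1 / sqrt (\<beta> / 4) / sqrt n) + C1 * (\<epsilon> / \<kappa> + 1 / sqrt n)) + C0 / sqrt n"
            using n \<beta> by (intro add_right_mono mult_left_mono exp_neg_le_const_div_sqrt) auto
          also have "\<dots> = C1 * (\<epsilon> / \<kappa>) + (C2 + C1 + C0) / sqrt n"
            by (simp add: C2_def distrib_left add_divide_distrib)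
          finally show ?thesis .
        qed
        have "avg (perms P) (\<lambda>\<pi>. of_bool (L \<pi>)) \<le> avg (perms P) (\<lambda>\<pi>. of_bool (LB \<pi>) + 1 / (\<delta> * n) * (\<Sum>i<n. of_bool (Fi i \<pi>)))"
        proof (rule avg_mono)
          fix \<pi>
          have pos: "0 \<le> 1 / (\<delta> * n) * (\<Sum>i<n. of_bool (Fi i \<pi>) :: real)" using \<delta> by (intro mult_nonneg_nonneg sum_nonneg) auto
          show "of_bool (L \<pi>) \<le> of_bool (LB \<pi>) + 1 / (\<delta> * n) * (\<Sum>i<n. of_bool (Fi i \<pi>))"
          proof (cases "L \<pi> \<and> \<not> LB \<pi>")
            case False
            then show ?thesis using pos by auto
          next
            case LL: True
            then obtain w where w: "normsq n w = 1" "normsq n (shifted_apply n z (\<lambda>i j. X \<pi> j i) w) \<le> (\<epsilon> / sqrt n)\<^sup>2"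
              by (auto simp: L_def)
            have "(\<Sum>k\<in>{..<n} - {n}. (cmod (shifted_apply n z (\<lambda>i j. X \<pi> j i) w k))\<^sup>2) \<le> \<kappa>\<^sup>2 * n"
            proof -
              have "{..<n} - {n} = {..<n}" by auto
              then have "(\<Sum>k\<in>{..<n} - {n}. (cmod (shifted_apply n z (\<lambda>i j. X \<pi> j i) w k))\<^sup>2) \<le> (\<epsilon> / sqrt n)\<^sup>2"
                using w(2) by (simp add: normsq_def)
              also have "\<dots> \<le> \<kappa>\<^sup>2"
              proof (intro power_mono)
                have "\<epsilon> / sqrt n \<le> \<epsilon> / 1" using sn e by (intro divide_left_mono) auto
                then show "\<epsilon> / sqrt n \<le> \<kappa>" using True by simp
              qed (use e in simp)
              also have "\<dots> \<le> \<kappa>\<^sup>2 * n" using mult_left_mono[of 1 "real n" "\<kappa>\<^sup>2"] n by simp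
              finally show ?thesis .
            qed
            then have nac: "\<not> almost_constant n \<delta> \<kappa> w" using LL w(1) unfolding LB_def almost_constant_kernel_def by blast
            have "\<delta> * n \<le> card {i. i < n \<and> \<kappa> / sqrt n \<le> cmod (w i)}"
              using n by (intro not_almost_constant_large_coords \<kappa> nac) auto
            also have "real (card {i. i < n \<and> \<kappa> / sqrt n \<le> cmod (w i)}) \<le> card {i. i < n \<and> Fi i \<pi>}"
            proof -
              have "Fi i \<pi>" if i: "i < n" "\<kappa> / sqrt n \<le> cmod (w i)" for i
              proof -
                define c where "c = cmod (shifted_apply n z (X \<pi>) (normal_vec n z i (X \<pi>)) i)"
                have "\<kappa> / sqrt n * c \<le> cmod (w i) * c" using i(2) by (intro mult_right_mono) (auto simp: c_def)
                also have "\<dots> \<le> \<epsilon> / sqrt n" unfolding c_def using e by (intro left_singular_imp_normal[OF i(1) w(2)]) auto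
                finally have "\<kappa> * c \<le> \<epsilon>" using sn by (simp add: field_simps)
                then show ?thesis using \<kappa> by (simp add: Fi_def c_def field_simps)
              qed
              then show ?thesis by (intro of_nat_mono card_mono) auto
            qed
            also have "real (card {i. i < n \<and> Fi i \<pi>}) = (\<Sum>i<n. of_bool (Fi i \<pi>))"
              by (simp add: of_bool_def sum.If_cases Int_def)
            finally have "1 \<le> 1 / (\<delta> * n) * (\<Sum>i<n. of_bool (Fi i \<pi>))" using \<delta> n by (simp add: field_simps)
            then show ?thesis by (simp add: add_increasing)
          qed
        qed
        also have "\<dots> = avg (perms P) (\<lambda>\<pi>. of_bool (LB \<pi>)) + 1 / (\<delta> * n) * (\<Sum>i<n. avg (perms P) (\<lambda>\<pi>. of_bool (Fi i \<pi>)))"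
          by (simp only: avg_add avg_cmult avg_sum)
        also have "\<dots> \<le> C0 / sqrt n + 1 / (\<delta> * n) * (\<Sum>i<n. C1 * (\<epsilon> / \<kappa>) + (C2 + C1 + C0) / sqrt n)"
          using PLB PF \<delta> by (intro add_mono mult_left_mono sum_mono) auto
        also have "\<dots> = (1 / \<delta> * (C1 / \<kappa>)) * \<epsilon> + (C0 + 1 / \<delta> * (C2 + C1 + C0)) * (1 / sqrt n)"
          using n \<delta> by (simp add: field_simps)
        also have "\<dots> \<le> C * \<epsilon> + C * (1 / sqrt n)"
        proof (intro add_mono mult_right_mono)
          have p: "0 \<le> 4 / \<delta>" "0 \<le> 1 / \<kappa>" "0 \<le> 1 / \<delta> * (C2 + C1 + C0)" "0 \<le> 1 / \<delta> * (C1 / \<kappa>)" using \<delta> \<kappa> C0 C1 C2 by auto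
          show "1 / \<delta> * (C1 / \<kappa>) \<le> C" "C0 + 1 / \<delta> * (C2 + C1 + C0) \<le> C" unfolding C_def using p C0 by linarith+
        qed (use e in auto)
        finally show ?thesis by (simp only: distrib_left)
      qed
      then show ?thesis unfolding L_def X_def P_def .
    qed
    show thesis by (rule that[OF C main])
  qed
qed

section \<open>Spread of the entries from their moments\<close>

text \<open>The second moment is at most K times the sum of moduli, which by centring is twice the
  sum of positive parts. Positive parts below 1 / (4 * K) account for at most half of this, so many
  entries are larger; -x gives the other side.\<close>

lemma spread_of_moments:
  fixes x :: "'a \<Rightarrow> real"
  assumes P: "finite P" and K: "K > 0" and x0: "(\<Sum>q\<in>P. x q) = 0" and x2: "(\<Sum>q\<in>P. (x q)\<^sup>2) = card P"
    and xK: "\<And>q. q \<in> P \<Longrightarrow> \<bar>x q\<bar> \<le> K"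
  shows "spread (1 / (4 * K)) (1 / (4 * K\<^sup>2)) P x"
proof -
  have half: "1 / (4 * K\<^sup>2) * card P \<le> card {q\<in>P. 1 / (4 * K) \<le> y q}"
    if y0: "(\<Sum>q\<in>P. y q) = 0" and y2: "(\<Sum>q\<in>P. (y q)\<^sup>2) = card P" and yK: "\<And>q. q \<in> P \<Longrightarrow> \<bar>y q\<bar> \<le> K" for y :: "'a \<Rightarrow> real"
  proof -
    have "real (card P) = (\<Sum>q\<in>P. (y q)\<^sup>2)" using y2 by simp
    also have "\<dots> \<le> (\<Sum>q\<in>P. K * (2 * max 0 (y q) - y q))"
    proof (rule sum_mono)
      fix q assume q: "q \<in> P"
      have "(y q)\<^sup>2 = \<bar>y q\<bar> * \<bar>y q\<bar>" by (simp add: power2_eq_square)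
      also have "\<dots> \<le> K * \<bar>y q\<bar>" using yK[OF q] by (intro mult_right_mono) auto
      also have "\<bar>y q\<bar> = 2 * max 0 (y q) - y q" by (auto simp: max_def)
      finally show "(y q)\<^sup>2 \<le> K * (2 * max 0 (y q) - y q)" .
    qed
    also have "\<dots> = 2 * K * (\<Sum>q\<in>P. max 0 (y q))"
      using y0 by (simp add: sum_distrib_left[symmetric] sum_subtractf)
    also have "(\<Sum>q\<in>P. max 0 (y q)) \<le> (\<Sum>q\<in>P. K * of_bool (1 / (4 * K) \<le> y q) + 1 / (4 * K))"
      using yK K by (intro sum_mono) (auto simp: max_def of_bool_def abs_le_iff add_increasing2)
    also have "\<dots> = K * card {q\<in>P. 1 / (4 * K) \<le> y q} + card P / (4 * K)"
      using P by (simp add: sum.distrib sum_distrib_left[symmetric] of_bool_def sum.If_cases Int_def)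
    finally have "real (card P) \<le> 2 * K * (K * card {q\<in>P. 1 / (4 * K) \<le> y q} + card P / (4 * K))"
      using K by (simp add: mult_left_mono)
    then show ?thesis using K by (simp add: field_simps power2_eq_square)
  qed
  have "1 / (4 * K\<^sup>2) * card P \<le> card {q\<in>P. 1 / (4 * K) \<le> - x q}"
    using x0 x2 xK by (intro half) (auto simp: sum_negf)
  then have "1 / (4 * K\<^sup>2) * card P \<le> card {q\<in>P. x q \<le> - (1 / (4 * K))}"
    by (simp add: le_minus_iff)
  then show ?thesis unfolding spread_def using half[OF x0 x2 xK] by blast
qed

section \<open>Singular values\<close>

lemma mat_adjoint_dim [simp]: "dim_row (mat_adjoint A) = dim_col A" "dim_col (mat_adjoint A) = dim_row A"
  by (simp_all add: mat_adjoint_def)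

lemma mat_adjoint_index [simp]:
  "i < dim_col A \<Longrightarrow> j < dim_row A \<Longrightarrow> mat_adjoint A $$ (i, j) = conjugate (A $$ (j, i))"
  by (simp add: mat_adjoint_def mat_of_rows_index)

lemma mat_adjoint_carrier [simp]: "A \<in> carrier_mat n m \<Longrightarrow> mat_adjoint A \<in> carrier_mat m n"
  by (rule carrier_matI) auto

lemma mat_adjoint_adjoint [simp]: "mat_adjoint (mat_adjoint A) = (A :: complex mat)"
  by (rule eq_matI) auto

lemma mat_adjoint_mult:
  fixes A B :: "complex mat"
  assumes "A \<in> carrier_mat n m" "B \<in> carrier_mat m k"
  shows "mat_adjoint (A * B) = mat_adjoint B * mat_adjoint A"
  using assms by (intro eq_matI) (auto simp: scalar_prod_def cnj_sum mult.commute)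

lemma mat_adjoint_minus:
  fixes A B :: "complex mat"
  assumes "A \<in> carrier_mat n m" "B \<in> carrier_mat n m"
  shows "mat_adjoint (A - B) = mat_adjoint A - mat_adjoint B"
  using assms by (intro eq_matI) auto

lemma mult_mat_vec_cscalar_prod:
  fixes A :: "complex mat"
  assumes A: "A \<in> carrier_mat n m" and v: "v \<in> carrier_vec m" and w: "w \<in> carrier_vec n"
  shows "(A *\<^sub>v v) \<bullet>c w = v \<bullet>c (mat_adjoint A *\<^sub>v w)"
proof -
  have "(A *\<^sub>v v) \<bullet>c w = (\<Sum>i = 0..<n. \<Sum>j = 0..<m. A $$ (i, j) * vec_index v j * cnj (vec_index w i))"
    using A v w by (simp add: scalar_prod_def sum_distrib_right)
  also have "\<dots> = (\<Sum>j = 0..<m. \<Sum>i = 0..<n. A $$ (i, j) * vec_index v j * cnj (vec_index w i))"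
    by (rule sum.swap)
  also have "\<dots> = v \<bullet>c (mat_adjoint A *\<^sub>v w)"
    using A v w by (simp add: scalar_prod_def sum_distrib_left cnj_sum mult_ac)
  finally show ?thesis .
qed

lemma cscalar_prod_self: "v \<in> carrier_vec n \<Longrightarrow> v \<bullet>c v = of_real (\<Sum>k = 0..<n. (cmod (vec_index v k))\<^sup>2)"
  unfolding of_real_sum complex_norm_square by (simp add: scalar_prod_def)

text \<open>Gram-Schmidt leaves the first vector of the completed basis unchanged, so after
  normalisation the first column is still a multiple of v.\<close>

lemma eigenvector_orthonormal_completion:
  fixes v :: "complex vec"
  assumes v: "v \<in> carrier_vec n" "v \<noteq> 0\<^sub>v n" and n: "n > 0"
  obtains U c where "U \<in> carrier_mat n n" "mat_adjoint U * U = 1\<^sub>m n" "c \<noteq> 0" "col U 0 = c \<cdot>\<^sub>v v"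
proof -
  interpret cof_vec_space n "TYPE(complex)" .
  define b where "b = basis_completion v"
  define ws where "ws = gram_schmidt n b"
  from basis_completion[OF v, folded b_def]
  have dist_b: "distinct b" and indep: "\<not> lin_dep (set b)" and b: "set b \<subseteq> carrier_vec n" and hdb: "hd b = v"
    and len_b: "length b = n" by auto
  from hdb len_b n obtain vs where bv: "b = v # vs" by (cases b) auto
  from gram_schmidt_result[OF b dist_b indep refl, folded ws_def]
  have ws: "set ws \<subseteq> carrier_vec n" "corthogonal ws" "length ws = n" by (auto simp: len_b)
  have "hd ws = v" unfolding ws_def bv using v(1) by (rule gram_schmidt_hd)
  then have ws0: "ws ! 0 = v" using ws(3) n by (metis hd_conv_nth length_0_conv less_irrefl)
  have wc: "ws ! i \<in> carrier_vec n" if "i < n" for i using ws that by auto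
  define r where "r = (\<lambda>i. sqrt (\<Sum>k = 0..<n. (cmod (vec_index (ws ! i) k))\<^sup>2))"
  have r2: "ws ! i \<bullet>c ws ! i = of_real ((r i)\<^sup>2)" if "i < n" for i
    using cscalar_prod_self[OF wc[OF that]] by (simp add: r_def sum_nonneg)
  have r0: "r i \<noteq> 0" if "i < n" for i
    using corthogonalD[OF ws(2), of i i] r2[OF that] that ws(3) by auto
  define U where "U = mat n n (\<lambda>(k, i). vec_index (ws ! i) k / of_real (r i))"
  have U: "U \<in> carrier_mat n n" by (simp add: U_def)
  have "mat_adjoint U * U = 1\<^sub>m n"
  proof (rule eq_matI)
    fix i j assume "i < dim_row (1\<^sub>m n :: complex mat)" "j < dim_col (1\<^sub>m n :: complex mat)"
    then have ij: "i < n" "j < n" by auto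
    have "(mat_adjoint U * U) $$ (i, j) = (\<Sum>k = 0..<n. cnj (vec_index (ws ! i) k / of_real (r i)) * (vec_index (ws ! j) k / of_real (r j)))"
      using ij by (simp add: U_def scalar_prod_def)
    also have "\<dots> = (ws ! j \<bullet>c ws ! i) / of_real (r i * r j)"
      using wc[OF ij(1)] wc[OF ij(2)] by (simp add: scalar_prod_def sum_divide_distrib mult.commute)
    also have "\<dots> = 1\<^sub>m n $$ (i, j)"
      using corthogonalD[OF ws(2), of j i] ij ws(3) r2[OF ij(1)] r0[OF ij(1)] by (auto simp: power2_eq_square)
    finally show "(mat_adjoint U * U) $$ (i, j) = 1\<^sub>m n $$ (i, j)" .
  qed (auto simp: U_def)
  moreover have "col U 0 = of_real (1 / r 0) \<cdot>\<^sub>v v"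
    using v n ws0 by (intro eq_vecI) (auto simp: U_def)
  ultimately show ?thesis using that[OF U] r0[OF n] by (metis divide_eq_0_iff of_real_eq_0_iff one_neq_zero)
qed

lemma mat_adjoint_left_inverse:
  fixes U :: "complex mat"
  shows "U \<in> carrier_mat n n \<Longrightarrow> mat_adjoint U * U = 1\<^sub>m n \<Longrightarrow> U * mat_adjoint U = 1\<^sub>m n"
  using mat_mult_left_right_inverse[of "mat_adjoint U" n U] by simp

text \<open>Spectral theorem by deflation: in an orthonormal basis starting with an eigenvector the
  first column is a multiple of the first unit vector. Hermitian symmetry then clears the first row
  and makes the eigenvalue real, leaving a smaller Hermitian block.\<close>

lemma hermitian_diagonalization:
  fixes M :: "complex mat"
  assumes "M \<in> carrier_mat n n" "mat_adjoint M = M"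
  shows "\<exists>U d. U \<in> carrier_mat n n \<and> mat_adjoint U * U = 1\<^sub>m n
    \<and> M = U * mat_diag n (\<lambda>i. complex_of_real (d i)) * mat_adjoint U"
  using assms
proof (induction n arbitrary: M)
  case 0
  then show ?case by (intro exI[of _ "1\<^sub>m 0"] exI[of _ "\<lambda>_. 0"]) (auto intro!: eq_matI)
next
  case (Suc n)
  let ?N = "Suc n"
  note M = Suc.prems(1)
  have "degree (char_poly M) = ?N" using degree_monic_char_poly[OF M] by simp
  then have "\<not> constant (poly (char_poly M))" by (simp add: constant_degree)
  then obtain e where "poly (char_poly M) e = 0" using fundamental_theorem_of_algebra by blast
  then have "eigenvalue M e" using eigenvalue_root_char_poly[OF M] by simp
  then obtain v where v: "v \<in> carrier_vec ?N" "v \<noteq> 0\<^sub>v ?N" "M *\<^sub>v v = e \<cdot>\<^sub>v v"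
    using M unfolding eigenvalue_def eigenvector_def by auto
  obtain W c where W: "W \<in> carrier_mat ?N ?N" "mat_adjoint W * W = 1\<^sub>m ?N" and c: "col W 0 = c \<cdot>\<^sub>v v"
    using eigenvector_orthonormal_completion[OF v(1,2) zero_less_Suc] by metis
  note WW = mat_adjoint_left_inverse[OF W]
  define A where "A = mat_adjoint W * (M * W)"
  have A: "A \<in> carrier_mat ?N ?N"
    unfolding A_def using W M by (intro mult_carrier_mat[of _ ?N ?N _ ?N] mat_adjoint_carrier) auto
  have Aadj: "mat_adjoint A = A"
    using W M Suc.prems(2) unfolding A_def
    by (simp add: mat_adjoint_mult[of _ ?N ?N _ ?N] assoc_mult_mat[of _ ?N ?N _ ?N _ ?N])
  have col0: "A $$ (i, 0) = (if i = 0 then e else 0)" if i: "i < ?N" for i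
  proof -
    have "col (M * W) 0 = e \<cdot>\<^sub>v col W 0"
    proof -
      have "col (M * W) 0 = M *\<^sub>v col W 0" using M W by (intro col_mult2[of _ ?N ?N _ ?N]) auto
      also have "\<dots> = c \<cdot>\<^sub>v (M *\<^sub>v v)" unfolding c using M v(1) by (simp add: mult_mat_vec)
      also have "\<dots> = e \<cdot>\<^sub>v col W 0" unfolding c v(3) by (simp add: smult_smult_assoc mult.commute)
      finally show ?thesis .
    qed
    then have "A $$ (i, 0) = row (mat_adjoint W) i \<bullet> (e \<cdot>\<^sub>v col W 0)"
      using i W M by (simp add: A_def)
    also have "\<dots> = e * (row (mat_adjoint W) i \<bullet> col W 0)" using i W(1) by simp
    also have "row (mat_adjoint W) i \<bullet> col W 0 = (mat_adjoint W * W) $$ (i, 0)"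
      using i W(1) by (intro index_mult_mat(1)[symmetric]) auto
    also have "e * (mat_adjoint W * W) $$ (i, 0) = (if i = 0 then e else 0)" using i by (simp add: W(2))
    finally show ?thesis .
  qed
  have row0: "A $$ (0, j) = cnj (A $$ (j, 0))" if "j < ?N" for j
    using arg_cong[OF Aadj, of "\<lambda>X. X $$ (0, j)"] A that by simp
  have ereal: "e = of_real (Re e)" using row0[of 0] col0[of 0] by (simp add: complex_eq_iff)
  define A3 where "A3 = mat n n (\<lambda>(i, j). A $$ (Suc i, Suc j))"
  have A3: "A3 \<in> carrier_mat n n" by (simp add: A3_def)
  have "mat_adjoint A3 = A3"
  proof (rule eq_matI)
    fix i j assume "i < dim_row A3" "j < dim_col A3"
    then show "mat_adjoint A3 $$ (i, j) = A3 $$ (i, j)"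
      using arg_cong[OF Aadj, of "\<lambda>X. X $$ (Suc i, Suc j)"] A by (simp add: A3_def)
  qed (auto simp: A3_def)
  then obtain U3 d3 where U3: "U3 \<in> carrier_mat n n" "mat_adjoint U3 * U3 = 1\<^sub>m n"
    "A3 = U3 * mat_diag n (\<lambda>i. complex_of_real (d3 i)) * mat_adjoint U3" using Suc.IH[OF A3] by blast
  define V where "V = four_block_mat (1\<^sub>m 1) (0\<^sub>m 1 n) (0\<^sub>m n 1) U3"
  define d where "d = (\<lambda>i. case i of 0 \<Rightarrow> Re e | Suc i \<Rightarrow> d3 i)"
  define E where "E = mat 1 1 (\<lambda>_. e)"
  define D3 where "D3 = mat_diag n (\<lambda>i. complex_of_real (d3 i))"
  have E: "E \<in> carrier_mat 1 1" and D3: "D3 \<in> carrier_mat n n" by (auto simp: E_def D3_def)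
  have V: "V \<in> carrier_mat ?N ?N" using U3(1) unfolding V_def by auto
  have Vadj: "mat_adjoint V = four_block_mat (1\<^sub>m 1) (0\<^sub>m 1 n) (0\<^sub>m n 1) (mat_adjoint U3)"
    using U3(1) by (intro eq_matI) (auto simp: V_def)
  have VV: "mat_adjoint V * V = 1\<^sub>m ?N"
    unfolding Vadj unfolding V_def
    by (subst mult_four_block_mat[of _ 1 1 _ n _ n _ _ 1 _ n]) (use U3 in \<open>auto intro!: eq_matI\<close>)
  have Dblock: "mat_diag ?N (\<lambda>i. complex_of_real (d i)) = four_block_mat E (0\<^sub>m 1 n) (0\<^sub>m n 1) D3"
    using ereal by (intro eq_matI) (auto simp: mat_diag_def E_def D3_def d_def split: nat.splits)
  have Ablock: "A = four_block_mat E (0\<^sub>m 1 n) (0\<^sub>m n 1) A3"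
  proof (rule eq_matI)
    fix i j assume "i < dim_row (four_block_mat E (0\<^sub>m 1 n) (0\<^sub>m n 1) A3)" "j < dim_col (four_block_mat E (0\<^sub>m 1 n) (0\<^sub>m n 1) A3)"
    then have "i < ?N" "j < ?N" by (auto simp: E_def A3_def)
    then show "A $$ (i, j) = four_block_mat E (0\<^sub>m 1 n) (0\<^sub>m n 1) A3 $$ (i, j)"
      using col0[of i] row0[of j] col0[of j] by (auto simp: E_def A3_def)
  qed (use A in \<open>auto simp: E_def A3_def\<close>)
  have "V * mat_diag ?N (\<lambda>i. complex_of_real (d i)) = four_block_mat E (0\<^sub>m 1 n) (0\<^sub>m n 1) (U3 * D3)"
    unfolding Dblock V_def
    by (subst mult_four_block_mat[of _ 1 1 _ n _ n _ _ 1 _ n]) (use U3 E D3 in auto)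
  then have "V * mat_diag ?N (\<lambda>i. complex_of_real (d i)) * mat_adjoint V = four_block_mat E (0\<^sub>m 1 n) (0\<^sub>m n 1) (U3 * D3 * mat_adjoint U3)"
    unfolding Vadj
    by (simp, subst mult_four_block_mat[of _ 1 1 _ n _ n _ _ 1 _ n]) (use U3 E D3 in auto)
  then have VA: "V * mat_diag ?N (\<lambda>i. complex_of_real (d i)) * mat_adjoint V = A"
    unfolding Ablock U3(3) D3_def .
  have D: "mat_diag ?N (\<lambda>i. complex_of_real (d i)) \<in> carrier_mat ?N ?N" by simp
  note as = assoc_mult_mat[of _ ?N ?N _ ?N _ ?N]
  have "M = (W * mat_adjoint W) * M * (W * mat_adjoint W)" using M by (simp add: WW)
  also have "\<dots> = W * A * mat_adjoint W" using W(1) M by (simp add: A_def as mult_carrier_mat[of _ ?N ?N _ ?N])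
  also have "\<dots> = (W * V) * mat_diag ?N (\<lambda>i. complex_of_real (d i)) * mat_adjoint (W * V)"
    unfolding VA[symmetric] mat_adjoint_mult[OF W(1) V] using W(1) V D
    by (simp add: as mult_carrier_mat[of _ ?N ?N _ ?N])
  finally have "M = (W * V) * mat_diag ?N (\<lambda>i. complex_of_real (d i)) * mat_adjoint (W * V)" .
  moreover have "mat_adjoint (W * V) * (W * V) = 1\<^sub>m ?N"
  proof -
    have "mat_adjoint W * (W * V) = V" using W V by (simp flip: as)
    then show ?thesis unfolding mat_adjoint_mult[OF W(1) V] using W(1) V VV
      by (simp add: as mult_carrier_mat[of _ ?N ?N _ ?N])
  qed
  moreover have "W * V \<in> carrier_mat ?N ?N" using W V by simp
  ultimately show ?case by blast
qed

lemma mat_adjoint_diag_real: "mat_adjoint (mat_diag n (\<lambda>i. complex_of_real (d i))) = mat_diag n (\<lambda>i. complex_of_real (d i))"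
  by (rule eq_matI) (auto simp: mat_diag_def)

section \<open>Positive semidefinite square roots\<close>

lemma psd_mat_square:
  fixes C :: "complex mat"
  assumes C: "C \<in> carrier_mat n n" "mat_adjoint C = C"
  shows "psd_mat (C * C)"
proof -
  have "0 \<le> Re ((C * C *\<^sub>v v) \<bullet>c v)" if v: "v \<in> carrier_vec n" for v
  proof -
    have "(C * C *\<^sub>v v) \<bullet>c v = (C *\<^sub>v (C *\<^sub>v v)) \<bullet>c v" using C v by (simp add: assoc_mult_mat_vec)
    also have "\<dots> = (C *\<^sub>v v) \<bullet>c (C *\<^sub>v v)"
      using mult_mat_vec_cscalar_prod[OF C(1), of "C *\<^sub>v v" v] C v by simp
    also have "\<dots> = of_real (\<Sum>k = 0..<n. (cmod (vec_index (C *\<^sub>v v) k))\<^sup>2)"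
      using C v by (intro cscalar_prod_self) simp
    finally show ?thesis by (simp add: sum_nonneg)
  qed
  then show ?thesis unfolding psd_mat_def using C by (simp add: mat_adjoint_mult[OF C(1) C(1)])
qed

lemma psd_sqrt_exists:
  fixes A :: "complex mat"
  assumes A: "A \<in> carrier_mat n n"
  shows "\<exists>B. psd_mat B \<and> B * B = A * mat_adjoint A"
proof -
  define M where "M = A * mat_adjoint A"
  have M: "M \<in> carrier_mat n n" "mat_adjoint M = M"
    using A mat_adjoint_mult[of A n n "mat_adjoint A" n] by (auto simp: M_def)
  obtain U d where U: "U \<in> carrier_mat n n" "mat_adjoint U * U = 1\<^sub>m n"
    and Md: "M = U * mat_diag n (\<lambda>i. complex_of_real (d i)) * mat_adjoint U"
    using hermitian_diagonalization[OF M] by blast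
  note as = assoc_mult_mat[of _ n n _ n _ n]
  define dg where "dg = (\<lambda>f. mat_diag n (\<lambda>i. complex_of_real (f i)))"
  have dg: "dg f \<in> carrier_mat n n" for f by (simp add: dg_def)
  define F where "F = (\<lambda>f. U * dg f * mat_adjoint U)"
  have canc: "mat_adjoint U * (U * Y) = Y" if "Y \<in> carrier_mat n n" for Y
    using that U by (simp flip: as)
  have Fc: "F f \<in> carrier_mat n n" for f
    unfolding F_def using U dg by (intro mult_carrier_mat[of _ n n _ n] mat_adjoint_carrier) auto
  have Fadj: "mat_adjoint (F f) = F f" for f
    using U dg[of f] mat_adjoint_diag_real[of n f] unfolding F_def
    by (simp add: mat_adjoint_mult[of _ n n _ n] mult_carrier_mat[of _ n n _ n] as dg_def)
  have Fmult: "F f * F g = F (\<lambda>i. f i * g i)" for f g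
  proof -
    have e: "dg (\<lambda>i. f i * g i) = dg f * dg g" by (simp add: dg_def)
    show ?thesis unfolding F_def e using U(1) dg[of f] dg[of g]
      by (simp add: as canc mult_carrier_mat[of _ n n _ n])
  qed
  \<comment> \<open>In the eigenbasis d i is a diagonal entry of G * G^*, with G the adjoint of U
    times A, hence a sum of squared moduli.\<close>
  have d0: "0 \<le> d i" if i: "i < n" for i
  proof -
    have "M = U * dg d * mat_adjoint U" by (simp add: Md dg_def)
    then have "dg d = mat_adjoint U * M * U"
      using U dg[of d] by (simp add: as canc mult_carrier_mat[of _ n n _ n])
    then have "of_real (d i) = (mat_adjoint U * M * U) $$ (i, i)" using i by (simp add: dg_def mat_diag_def flip: \<open>dg d = mat_adjoint U * M * U\<close>)
    also have "mat_adjoint U * M * U = mat_adjoint U * A * mat_adjoint (mat_adjoint U * A)"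
      using U(1) A by (simp add: M_def mat_adjoint_mult[of _ n n _ n] as mult_carrier_mat[of _ n n _ n])
    also have "\<dots> $$ (i, i) = of_real (\<Sum>k = 0..<n. (cmod ((mat_adjoint U * A) $$ (i, k)))\<^sup>2)"
    proof -
      have "(G * mat_adjoint G) $$ (i, i) = of_real (\<Sum>k = 0..<n. (cmod (G $$ (i, k)))\<^sup>2)"
        if "G \<in> carrier_mat n n" for G :: "complex mat"
        unfolding of_real_sum complex_norm_square using that i by (simp add: scalar_prod_def)
      then show ?thesis using mult_carrier_mat[OF mat_adjoint_carrier[OF U(1)] A] .
    qed
    finally have "d i = (\<Sum>k = 0..<n. (cmod ((mat_adjoint U * A) $$ (i, k)))\<^sup>2)"
      by (simp only: of_real_eq_iff)
    then show ?thesis by (simp add: sum_nonneg)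
  qed
  \<comment> \<open>The root is obtained as the square of a Hermitian fourth root, so its positivity
    is an instance of \<open>psd_mat_square\<close>.\<close>
  define C where "C = F (\<lambda>i. sqrt (sqrt (d i)))"
  have C: "C \<in> carrier_mat n n" "mat_adjoint C = C" unfolding C_def using Fc Fadj by auto
  have "(C * C) * (C * C) = F (\<lambda>i. sqrt (sqrt (d i)) * sqrt (sqrt (d i)) * (sqrt (sqrt (d i)) * sqrt (sqrt (d i))))"
    unfolding C_def Fmult ..
  also have "\<dots> = M"
  proof -
    have "dg (\<lambda>i. sqrt (sqrt (d i)) * sqrt (sqrt (d i)) * (sqrt (sqrt (d i)) * sqrt (sqrt (d i)))) = dg d"
      unfolding dg_def by (intro eq_matI) (auto simp: mat_diag_def d0 simp flip: of_real_mult)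
    then show ?thesis unfolding F_def Md dg_def by simp
  qed
  finally show ?thesis using psd_mat_square[OF C] unfolding M_def by blast
qed

text \<open>\<open>D = B - C\<close> satisfies \<open>B D + D C = 0\<close>; testing this on an eigenvector of \<open>D\<close> shows that its
  eigenvalue vanishes.\<close>

lemma psd_sqrt_unique:
  fixes B C :: "complex mat"
  assumes B: "psd_mat B" and C: "psd_mat C" and eq: "B * B = C * C"
  shows "B = C"
proof -
  define n where "n = dim_row B"
  have Bc: "B \<in> carrier_mat n n" using B by (auto simp: psd_mat_def n_def)
  have "dim_row C = n" using arg_cong[OF eq, of dim_row] by (simp add: n_def)
  then have Cc: "C \<in> carrier_mat n n" using C by (auto simp: psd_mat_def)
  define D where "D = B - C"
  have D: "D \<in> carrier_mat n n" unfolding D_def using Cc by (rule minus_carrier_mat)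
  have adj: "mat_adjoint B = B" "mat_adjoint C = C" using B C by (auto simp: psd_mat_def)
  then have Dadj: "mat_adjoint D = D" unfolding D_def using mat_adjoint_minus[OF Bc Cc] by simp
  obtain U d where U: "U \<in> carrier_mat n n" "mat_adjoint U * U = 1\<^sub>m n"
    and Dd: "D = U * mat_diag n (\<lambda>i. complex_of_real (d i)) * mat_adjoint U"
    using hermitian_diagonalization[OF D Dadj] by blast
  have "d i = 0" if i: "i < n" for i
  proof (rule ccontr)
    assume di: "d i \<noteq> 0"
    define u where "u = col U i"
    have u: "u \<in> carrier_vec n" unfolding u_def using U(1) by (intro carrier_vecI) simp
    have DU: "D * U = U * mat_diag n (\<lambda>i. complex_of_real (d i))"
    proof -
      define E where "E = mat_diag n (\<lambda>i. complex_of_real (d i))"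
      have E: "E \<in> carrier_mat n n" by (simp add: E_def)
      have "D * U = U * E * (mat_adjoint U * U)"
        unfolding Dd E_def[symmetric]
        using U(1) E by (simp add: assoc_mult_mat[of _ n n _ n _ n] mult_carrier_mat[of _ n n _ n])
      then show ?thesis unfolding U(2) E_def[symmetric] using U(1) E by (simp add: mult_carrier_mat[of _ n n _ n])
    qed
    have Du: "D *\<^sub>v u = of_real (d i) \<cdot>\<^sub>v u"
    proof -
      have "D *\<^sub>v u = col (D * U) i" unfolding u_def using D U i by (intro col_mult2[symmetric]) auto
      also have "\<dots> = of_real (d i) \<cdot>\<^sub>v u"
        unfolding DU mat_diag_mult_right[OF U(1)] u_def using U i by (intro eq_vecI) auto
      finally show ?thesis .
    qed
    have uu: "u \<bullet>c u = 1"
    proof -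
      have "u \<bullet>c u = (mat_adjoint U * U) $$ (i, i)"
        using U(1) i by (simp add: u_def scalar_prod_def mult.commute)
      then show ?thesis unfolding U(2) using i by simp
    qed
    \<comment> \<open>The relation tested on u gives d i * (b + c) = 0, so both nonnegative real
      parts vanish; but b - c = d i.\<close>
    define b c where "b = (B *\<^sub>v u) \<bullet>c u" and "c = (C *\<^sub>v u) \<bullet>c u"
    have bc: "0 \<le> Re b" "0 \<le> Re c" using B C u Bc Cc unfolding psd_mat_def b_def c_def by auto
    have Bu: "B *\<^sub>v u \<in> carrier_vec n" and Cu: "C *\<^sub>v u \<in> carrier_vec n" using Bc Cc u by auto
    have "(B *\<^sub>v (D *\<^sub>v u)) \<bullet>c u + (D *\<^sub>v (C *\<^sub>v u)) \<bullet>c u = 0"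
    proof -
      have Duc: "D *\<^sub>v u = B *\<^sub>v u - C *\<^sub>v u" unfolding D_def using Bc Cc u by (rule minus_mult_distrib_mat_vec)
      have "B *\<^sub>v (D *\<^sub>v u) = B *\<^sub>v (B *\<^sub>v u) - B *\<^sub>v (C *\<^sub>v u)"
        unfolding Duc using Bc Bu Cu by (rule mult_minus_distrib_mat_vec)
      moreover have "D *\<^sub>v (C *\<^sub>v u) = B *\<^sub>v (C *\<^sub>v u) - C *\<^sub>v (C *\<^sub>v u)"
        unfolding D_def using Bc Cc Cu by (rule minus_mult_distrib_mat_vec)
      moreover have "B *\<^sub>v (B *\<^sub>v u) = C *\<^sub>v (C *\<^sub>v u)"
        using assoc_mult_mat_vec[OF Bc Bc u] assoc_mult_mat_vec[OF Cc Cc u] eq by metis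
      moreover have "B *\<^sub>v (C *\<^sub>v u) \<in> carrier_vec n" "C *\<^sub>v (C *\<^sub>v u) \<in> carrier_vec n"
        using Bc Cc Cu by auto
      ultimately show ?thesis using u by (simp add: minus_scalar_prod_distrib[of _ n])
    qed
    moreover have "(B *\<^sub>v (D *\<^sub>v u)) \<bullet>c u = of_real (d i) * b"
      unfolding Du b_def using Bc u by (simp add: mult_mat_vec)
    moreover have "(D *\<^sub>v (C *\<^sub>v u)) \<bullet>c u = of_real (d i) * c"
    proof -
      have "(D *\<^sub>v (C *\<^sub>v u)) \<bullet>c u = (C *\<^sub>v u) \<bullet>c (D *\<^sub>v u)"
        using mult_mat_vec_cscalar_prod[OF D Cu u] Dadj by simp
      then show ?thesis unfolding Du c_def using Cu u by (simp add: conjugate_smult_vec)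
    qed
    ultimately have "of_real (d i) * (b + c) = 0" by (simp add: distrib_left)
    then have "b + c = 0" using di by simp
    then have "Re b = 0" "Re c = 0" using bc by (auto simp: complex_eq_iff)
    moreover have "b - c = of_real (d i)"
    proof -
      have "(D *\<^sub>v u) \<bullet>c u = b - c" unfolding D_def b_def c_def
        using Bc Cc u Bu Cu by (simp add: minus_mult_distrib_mat_vec minus_scalar_prod_distrib[of _ n])
      then show ?thesis unfolding Du using u uu by simp
    qed
    then have "Re b - Re c = d i" by (metis Re_complex_of_real minus_complex.simps(1))
    ultimately show False using di by simp
  qed
  then have "mat_diag n (\<lambda>i. complex_of_real (d i)) = 0\<^sub>m n n" by (intro eq_matI) (auto simp: mat_diag_def)
  then have "D = 0\<^sub>m n n" unfolding Dd using U by simp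
  have "B $$ (i, j) - C $$ (i, j) = 0" if "i < n" "j < n" for i j
    using arg_cong[OF \<open>D = 0\<^sub>m n n\<close>, of "\<lambda>X. X $$ (i, j)"] that Bc Cc by (simp add: D_def)
  then show ?thesis using Bc Cc by (intro eq_matI) auto
qed

lemma psd_sqrt_spec:
  assumes "A \<in> carrier_mat n n"
  shows "psd_mat (psd_sqrt (A * mat_adjoint A))"
    and "psd_sqrt (A * mat_adjoint A) * psd_sqrt (A * mat_adjoint A) = A * mat_adjoint A"
proof -
  have "\<exists>!B. psd_mat B \<and> B * B = A * mat_adjoint A"
    using psd_sqrt_exists[OF assms] psd_sqrt_unique by metis
  then have "psd_mat (psd_sqrt (A * mat_adjoint A)) \<and> psd_sqrt (A * mat_adjoint A) * psd_sqrt (A * mat_adjoint A) = A * mat_adjoint A"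
    unfolding psd_sqrt_def by (rule theI')
  then show "psd_mat (psd_sqrt (A * mat_adjoint A))"
    "psd_sqrt (A * mat_adjoint A) * psd_sqrt (A * mat_adjoint A) = A * mat_adjoint A" by auto
qed

section \<open>From singular values to approximate kernel vectors\<close>

text \<open>A singular value is an eigenvalue of the square root B of A * A^*. For its eigenvector v
  the squared norm of A^* v is the quadratic form of B^2 at v, so A^* stretches v by exactly the
  singular value.\<close>

lemma singular_value_vector:
  fixes A :: "complex mat"
  assumes A: "A \<in> carrier_mat n n" and k: "1 \<le> k" "k \<le> n"
  obtains v where "v \<in> carrier_vec n" "v \<noteq> 0\<^sub>v n" "0 \<le> singular_value k A"
    "(mat_adjoint A *\<^sub>v v) \<bullet>c (mat_adjoint A *\<^sub>v v) = of_real ((singular_value k A)\<^sup>2) * (v \<bullet>c v)"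
proof -
  define B where "B = psd_sqrt (A * mat_adjoint A)"
  have psd: "psd_mat B" and BB: "B * B = A * mat_adjoint A" using psd_sqrt_spec[OF A] by (auto simp: B_def)
  have "dim_row B = n" using arg_cong[OF BB, of dim_row] A by simp
  then have B: "B \<in> carrier_mat n n" using psd by (auto simp: psd_mat_def)
  have adj: "mat_adjoint B = B" using psd by (simp add: psd_mat_def)
  define ms where "ms = image_mset Re (eigenvalue_mset B)"
  \<comment> \<open>Over the complex numbers the roots of the characteristic polynomial number n
    with multiplicity, so position k - 1 lies inside the list.\<close>
  have "size ms = n" unfolding ms_def eigenvalue_mset_def
    using degree_monic_char_poly[OF B] by (simp add: size_proots_complex)
  then have len: "length (singular_values A) = n"
    unfolding singular_values_def B_def[symmetric] ms_def[symmetric] by (metis length_rev mset_sorted_list_of_multiset size_mset)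
  then have "singular_value k A \<in> set (singular_values A)" unfolding singular_value_def using k by simp
  then have "singular_value k A \<in># ms"
    unfolding singular_values_def B_def[symmetric] ms_def[symmetric] by simp
  then obtain e where e: "e \<in># eigenvalue_mset B" "singular_value k A = Re e" by (auto simp: ms_def)
  have "char_poly B \<noteq> 0" using degree_monic_char_poly[OF B] by auto
  then have "poly (char_poly B) e = 0" using e(1) by (simp add: eigenvalue_mset_def)
  then have "eigenvalue B e" using eigenvalue_root_char_poly[OF B] by simp
  then obtain v where v: "v \<in> carrier_vec n" "v \<noteq> 0\<^sub>v n" "B *\<^sub>v v = e \<cdot>\<^sub>v v"
    using B unfolding eigenvalue_def eigenvector_def by auto
  define s where "s = (\<Sum>j = 0..<n. (cmod (vec_index v j))\<^sup>2)"
  have vv: "v \<bullet>c v = of_real s" unfolding s_def using v(1) by (rule cscalar_prod_self)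
  have "s \<noteq> 0" using conjugate_square_eq_0_vec[OF v(1)] v(2) vv by simp
  moreover have "s \<ge> 0" unfolding s_def by (intro sum_nonneg) simp
  ultimately have s: "s > 0" by simp
  have "(B *\<^sub>v v) \<bullet>c v = e * of_real s" unfolding v(3) using v(1) vv by simp
  moreover have "(B *\<^sub>v v) \<bullet>c v = cnj e * of_real s"
  proof -
    have "(B *\<^sub>v v) \<bullet>c v = v \<bullet>c (B *\<^sub>v v)" using mult_mat_vec_cscalar_prod[OF B v(1) v(1)] unfolding adj .
    also have "\<dots> = v \<bullet>c (e \<cdot>\<^sub>v v)" unfolding v(3) ..
    also have "\<dots> = cnj e * of_real s" using v(1) vv by (simp add: conjugate_smult_vec)
    finally show ?thesis .
  qed
  ultimately have "e = cnj e" using s by simp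
  then have ereal: "e = of_real (Re e)" by (simp add: complex_eq_iff)
  have "0 \<le> Re ((B *\<^sub>v v) \<bullet>c v)" using psd v(1) B unfolding psd_mat_def by auto
  then have "0 \<le> Re e * s" unfolding \<open>(B *\<^sub>v v) \<bullet>c v = e * of_real s\<close> by simp
  then have e0: "0 \<le> Re e" using s by (simp add: zero_le_mult_iff)
  have "(mat_adjoint A *\<^sub>v v) \<bullet>c (mat_adjoint A *\<^sub>v v) = (A *\<^sub>v (mat_adjoint A *\<^sub>v v)) \<bullet>c v"
    using mult_mat_vec_cscalar_prod[OF A mult_mat_vec_carrier[OF mat_adjoint_carrier[OF A] v(1)] v(1)] by simp
  also have "A *\<^sub>v (mat_adjoint A *\<^sub>v v) = B *\<^sub>v (B *\<^sub>v v)"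
  proof -
    have "A *\<^sub>v (mat_adjoint A *\<^sub>v v) = (A * mat_adjoint A) *\<^sub>v v"
      by (rule assoc_mult_mat_vec[OF A mat_adjoint_carrier[OF A] v(1), symmetric])
    also have "\<dots> = B *\<^sub>v (B *\<^sub>v v)" unfolding BB[symmetric] by (rule assoc_mult_mat_vec[OF B B v(1)])
    finally show ?thesis .
  qed
  also have "(B *\<^sub>v (B *\<^sub>v v)) \<bullet>c v = e * e * (v \<bullet>c v)"
    using B v by (simp add: mult_mat_vec)
  also have "e * e = of_real ((Re e)\<^sup>2)" by (subst (1 2) ereal) (simp add: power2_eq_square)
  finally show ?thesis using that[OF v(1,2)] e0 e(2) by simp
qed

lemma small_singular_value_left_vector:
  fixes X :: "real mat"
  assumes X: "X \<in> carrier_mat n n" and n: "n \<ge> 1"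
    and s: "singular_value n (map_mat complex_of_real X - (z * complex_of_real (sqrt (real n))) \<cdot>\<^sub>m 1\<^sub>m n) \<le> s"
  shows "\<exists>w. normsq n w = 1 \<and> normsq n (shifted_apply n z (\<lambda>i j. X $$ (j, i)) w) \<le> s\<^sup>2"
proof -
  define A where "A = map_mat complex_of_real X - (z * complex_of_real (sqrt (real n))) \<cdot>\<^sub>m 1\<^sub>m n"
  have A: "A \<in> carrier_mat n n" unfolding A_def by (rule minus_carrier_mat) simp
  obtain v where v: "v \<in> carrier_vec n" "v \<noteq> 0\<^sub>v n" "0 \<le> singular_value n A"
    "(mat_adjoint A *\<^sub>v v) \<bullet>c (mat_adjoint A *\<^sub>v v) = of_real ((singular_value n A)\<^sup>2) * (v \<bullet>c v)"
    using singular_value_vector[OF A n order_refl] .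
  define r where "r = (\<Sum>k = 0..<n. (cmod (vec_index v k))\<^sup>2)"
  have vv: "v \<bullet>c v = of_real r" unfolding r_def using v(1) by (rule cscalar_prod_self)
  have "r \<noteq> 0" using conjugate_square_eq_0_vec[OF v(1)] v(2) vv by simp
  moreover have "r \<ge> 0" unfolding r_def by (intro sum_nonneg) simp
  ultimately have r: "r > 0" by simp
  \<comment> \<open>Conjugating v turns the adjoint of A into its transpose, the form in which
    \<open>shifted_apply\<close> expresses left multiplication.\<close>
  define w where "w = (\<lambda>k. of_real (1 / sqrt r) * cnj (vec_index v k))"
  have w1: "normsq n w = 1"
  proof -
    have "normsq n w = (1 / sqrt r)\<^sup>2 * r"
      unfolding normsq_def w_def r_def norm_mult power_mult_distrib sum_distrib_left[symmetric] norm_of_real power2_abs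
      by (simp add: lessThan_atLeast0)
    then show ?thesis using r by (simp add: power_divide)
  qed
  have sa: "shifted_apply n z (\<lambda>i j. X $$ (j, i)) w j = of_real (1 / sqrt r) * cnj (vec_index (mat_adjoint A *\<^sub>v v) j)"
    if j: "j < n" for j
  proof -
    have "cnj (vec_index (mat_adjoint A *\<^sub>v v) j) = (\<Sum>i<n. A $$ (i, j) * cnj (vec_index v i))"
      using A v(1) j by (simp add: scalar_prod_def cnj_sum lessThan_atLeast0)
    also have "\<dots> = (\<Sum>i<n. of_real (X $$ (i, j)) * cnj (vec_index v i)
        - (if i = j then z * of_real (sqrt n) * cnj (vec_index v i) else 0))"
      using X j by (intro sum.cong refl) (auto simp: A_def left_diff_distrib)
    also have "\<dots> = (\<Sum>i<n. of_real (X $$ (i, j)) * cnj (vec_index v i)) - z * of_real (sqrt n) * cnj (vec_index v j)"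
      using j by (simp add: sum_subtractf)
    finally show ?thesis
      unfolding shifted_apply_def w_def by (simp add: sum_distrib_left right_diff_distrib mult_ac)
  qed
  have "normsq n (shifted_apply n z (\<lambda>i j. X $$ (j, i)) w) = (\<Sum>j<n. (1 / sqrt r)\<^sup>2 * (cmod (vec_index (mat_adjoint A *\<^sub>v v) j))\<^sup>2)"
    unfolding normsq_def
  proof (intro sum.cong refl)
    fix j assume "j \<in> {..<n}"
    then show "(cmod (shifted_apply n z (\<lambda>i j. X $$ (j, i)) w j))\<^sup>2 = (1 / sqrt r)\<^sup>2 * (cmod (vec_index (mat_adjoint A *\<^sub>v v) j))\<^sup>2"
      by (simp only: lessThan_iff sa norm_mult power_mult_distrib norm_of_real power2_abs complex_mod_cnj)
  qed
  also have "\<dots> = 1 / r * (\<Sum>j = 0..<n. (cmod (vec_index (mat_adjoint A *\<^sub>v v) j))\<^sup>2)"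
    using r by (simp add: sum_distrib_left power_divide lessThan_atLeast0)
  also have "(\<Sum>j = 0..<n. (cmod (vec_index (mat_adjoint A *\<^sub>v v) j))\<^sup>2) = (singular_value n A)\<^sup>2 * r"
  proof -
    have "mat_adjoint A *\<^sub>v v \<in> carrier_vec n" using A v(1) by (intro mult_mat_vec_carrier[of _ n n] mat_adjoint_carrier)
    then have "complex_of_real (\<Sum>j = 0..<n. (cmod (vec_index (mat_adjoint A *\<^sub>v v) j))\<^sup>2) = of_real ((singular_value n A)\<^sup>2) * of_real r"
      using v(4) unfolding vv by (simp only: cscalar_prod_self)
    then show ?thesis by (simp only: of_real_mult[symmetric] of_real_eq_iff)
  qed
  also have "1 / r * ((singular_value n A)\<^sup>2 * r) = (singular_value n A)\<^sup>2" using r by simp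
  also have "\<dots> \<le> s\<^sup>2" using s v(3) unfolding A_def by (intro power_mono)
  finally show ?thesis using w1 by blast
qed

lemma prob_uniform_perm:
  "measure_pmf.prob (uniform_perm n) {\<pi>. Q \<pi>} = avg (perms (mat_positions n)) (\<lambda>\<pi>. of_bool (Q \<pi>))"
proof -
  have "perms (mat_positions n) \<noteq> {}" "finite (perms (mat_positions n))"
    by (rule perms_nonempty, rule finite_perms) simp
  then show ?thesis unfolding uniform_perm_def avg_def
    by (simp add: measure_pmf_of_set of_bool_def sum.If_cases)
qed

theorem theorem1p1:
  fixes K :: real and z :: complex
  assumes "K \<ge> 1"
  shows "\<exists>C::real. C > 0 \<and>
    (\<forall>(n::nat) (x::real mat).
       n \<ge> 1 \<longrightarrow> x \<in> carrier_mat n n \<longrightarrow>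
       (\<Sum>i = 0..<n. \<Sum>j = 0..<n. x $$ (i, j)) = 0 \<longrightarrow>
       (\<Sum>i = 0..<n. \<Sum>j = 0..<n. (x $$ (i, j))\<^sup>2) = (real n)\<^sup>2 \<longrightarrow>
       Max ((\<lambda>ij. \<bar>x $$ ij\<bar>) ` mat_positions n) = K \<longrightarrow>
       (\<forall>\<epsilon>::real. \<epsilon> > 0 \<longrightarrow>
          measure_pmf.prob (uniform_perm n)
            {\<pi>. singular_value n
                  (map_mat complex_of_real (permuted_mat n x \<pi>)
                    - (z * complex_of_real (sqrt (real n))) \<cdot>\<^sub>m 1\<^sub>m n)
                \<le> \<epsilon> * real n powr (-1/2)}
          \<le> C * (\<epsilon> + 1 / real n powr (1/2))))"
proof -
  have K: "K > 0" using assms by simp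
  \<comment> \<open>These spread parameters come from \<open>spread_of_moments\<close> and depend on
    K alone, so the constant depends only on K and z.\<close>
  show ?thesis
  proof (rule smallest_singular_value_tail[of K "1 / (4 * K)" "1 / (4 * K\<^sup>2)" z])
    fix C :: real
    assume C: "C > 0" and tail: "\<And>n (x :: nat \<times> nat \<Rightarrow> real) \<epsilon>. n \<ge> 1 \<Longrightarrow>
      spread (1 / (4 * K)) (1 / (4 * K\<^sup>2)) (mat_positions n) x \<Longrightarrow>
      (\<And>q. q \<in> mat_positions n \<Longrightarrow> \<bar>x q\<bar> \<le> K) \<Longrightarrow> (\<Sum>q\<in>mat_positions n. x q) = 0 \<Longrightarrow> \<epsilon> > 0 \<Longrightarrow>
      avg (perms (mat_positions n)) (\<lambda>\<pi>. of_bool (\<exists>w. normsq n w = 1 \<and>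
        normsq n (shifted_apply n z (\<lambda>i j. x (\<pi> (j, i))) w) \<le> (\<epsilon> / sqrt n)\<^sup>2)) \<le> C * (\<epsilon> + 1 / sqrt n)"
    show ?thesis
    proof (intro exI[of _ C] conjI C allI impI)
      fix n :: nat and x :: "real mat" and \<epsilon> :: real
      assume n: "n \<ge> 1" and x: "x \<in> carrier_mat n n"
        and x0: "(\<Sum>i = 0..<n. \<Sum>j = 0..<n. x $$ (i, j)) = 0"
        and x2: "(\<Sum>i = 0..<n. \<Sum>j = 0..<n. (x $$ (i, j))\<^sup>2) = (real n)\<^sup>2"
        and xK: "Max ((\<lambda>ij. \<bar>x $$ ij\<bar>) ` mat_positions n) = K" and e: "\<epsilon> > 0"
      let ?y = "\<lambda>q. x $$ q"
      have bound: "\<bar>?y q\<bar> \<le> K" if "q \<in> mat_positions n" for q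
        unfolding xK[symmetric] using that by (intro Max_ge) auto
      have y0: "(\<Sum>q\<in>mat_positions n. ?y q) = 0"
        using x0 by (simp add: mat_positions_def sum.cartesian_product case_prod_unfold)
      have y2: "(\<Sum>q\<in>mat_positions n. (?y q)\<^sup>2) = card (mat_positions n)"
        using x2 by (simp add: mat_positions_def sum.cartesian_product case_prod_unfold power2_eq_square)
      have sp: "spread (1 / (4 * K)) (1 / (4 * K\<^sup>2)) (mat_positions n) ?y"
        by (rule spread_of_moments[OF _ K y0 y2 bound]) simp_all
      have h: "real n powr (1/2) = sqrt n" "real n powr (-1/2) = 1 / sqrt n"
        using n by (simp_all add: powr_half_sqrt powr_minus_divide)
      have "measure_pmf.prob (uniform_perm n)
            {\<pi>. singular_value n
                  (map_mat complex_of_real (permuted_mat n x \<pi>)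
                    - (z * complex_of_real (sqrt (real n))) \<cdot>\<^sub>m 1\<^sub>m n)
                \<le> \<epsilon> * real n powr (-1/2)}
        \<le> avg (perms (mat_positions n)) (\<lambda>\<pi>. of_bool (\<exists>w. normsq n w = 1 \<and>
            normsq n (shifted_apply n z (\<lambda>i j. ?y (\<pi> (j, i))) w) \<le> (\<epsilon> / sqrt n)\<^sup>2))"
        unfolding prob_uniform_perm h
      proof (rule avg_mono)
        fix \<pi>
        have "\<exists>w. normsq n w = 1 \<and> normsq n (shifted_apply n z (\<lambda>i j. ?y (\<pi> (j, i))) w) \<le> (\<epsilon> / sqrt n)\<^sup>2"
          if "singular_value n (map_mat complex_of_real (permuted_mat n x \<pi>)
               - (z * complex_of_real (sqrt (real n))) \<cdot>\<^sub>m 1\<^sub>m n) \<le> \<epsilon> * (1 / sqrt n)"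
        proof -
          have "\<exists>w. normsq n w = 1 \<and> normsq n (shifted_apply n z (\<lambda>i j. permuted_mat n x \<pi> $$ (j, i)) w) \<le> (\<epsilon> * (1 / sqrt n))\<^sup>2"
            by (rule small_singular_value_left_vector[OF _ n that]) (simp add: permuted_mat_def)
          moreover have "normsq n (shifted_apply n z (\<lambda>i j. permuted_mat n x \<pi> $$ (j, i)) w)
            = normsq n (shifted_apply n z (\<lambda>i j. ?y (\<pi> (j, i))) w)" for w
            unfolding normsq_def
            by (intro sum.cong refl arg_cong[where f = "\<lambda>c. (cmod c)\<^sup>2"] shifted_apply_cong) (simp add: permuted_mat_def)
          ultimately show ?thesis by simp
        qed
        then show "of_bool (singular_value n (map_mat complex_of_real (permuted_mat n x \<pi>)
               - (z * complex_of_real (sqrt (real n))) \<cdot>\<^sub>m 1\<^sub>m n) \<le> \<epsilon> * (1 / sqrt n))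
          \<le> (of_bool (\<exists>w. normsq n w = 1 \<and> normsq n (shifted_apply n z (\<lambda>i j. ?y (\<pi> (j, i))) w) \<le> (\<epsilon> / sqrt n)\<^sup>2) :: real)"
          by (simp only: of_bool_def) simp
      qed
      also have "\<dots> \<le> C * (\<epsilon> + 1 / sqrt n)" using n sp bound y0 e by (rule tail)
      finally show "measure_pmf.prob (uniform_perm n)
            {\<pi>. singular_value n
                  (map_mat complex_of_real (permuted_mat n x \<pi>)
                    - (z * complex_of_real (sqrt (real n))) \<cdot>\<^sub>m 1\<^sub>m n)
                \<le> \<epsilon> * real n powr (-1/2)}
          \<le> C * (\<epsilon> + 1 / real n powr (1/2))" unfolding h .
    qed
  qed (use K in auto)
qed

end
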